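(* Let $\mathcal S$ be a pullback square in the category of crossed double categories and crossed double functors, with projections $p : P \to A$ and $q : P \to B$ of the pullback of $f : A \to C$ and $g : B \to C$ (so $fp = gq$). Suppose that $g$ is a discrete fibration and $f$ is an objectwise opfibration. Then the square $\mathrm{CoDesc}(\mathcal S)$ in $\mathbf{Cat}$ is exact; that is, the lax square with boundary $\mathrm{CoDesc}(p), \mathrm{CoDesc}(q), \mathrm{CoDesc}(f), \mathrm{CoDesc}(g)$ and 2-cell the identity $\mathrm{CoDesc}(f)\mathrm{CoDesc}(p) \to \mathrm{CoDesc}(g)\mathrm{CoDesc}(q)$ is exact.
   Context: **Crossed double categories.** A double category is a category internal to $\mathbf{Cat}$, regarded as a simplicial object $X : \Delta^{\mathrm{op}} \to \mathbf{Cat}$ such that for all $n$ the square with $d_0 d_{n+2} = d_{n+1}d_0 : X_{n+2} \to X_n$ is a pullback. Its objects and vertical arrows are the objects and arrows of $X_0$; its horizontal arrows and squares are the objects and arrows of $X_1$; $d_0 : X_1 \to X_0$ is the target and $d_1 : X_1 \to X_0$ the source (of horizontal arrows). A crossed double category is a double category together with the structure of a split opfibration on $d_0 : X_1 \to X_0$ such that $s_0 : X_0 \to X_1$ (from $1_{X_0}$ to $d_0$) and $d_1 : X_2 \to X_1$ (from $d_0^2 : X_2 \to X_0$ to $d_0$) are morphisms of split opfibrations over $X_0$ (here $d_0 : X_2 \to X_1$ carries the split opfibration structure pulled back from $d_0:X_1 \to X_0$, and $d_0^2$ is the composite). A crossed double functor $f : X \to Y$ is a double functor (morphism of simplicial objects)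 such that $(f_1,f_0)$ is a morphism of split opfibrations from $d_0 : X_1 \to X_0$ to $d_0 : Y_1 \to Y_0$. An internal (double) functor $f : X \to Y$ is a discrete fibration if the square $d_0f_1 = f_0d_0 : X_1 \to Y_0$ (with sides $f_1 : X_1 \to Y_1$, $d_0 : Y_1 \to Y_0$, $d_0 : X_1 \to X_0$, $f_0 : X_0 \to Y_0$) is a pullback. It is an objectwise opfibration if $f_0 : X_0 \to Y_0$ is an opfibration of categories. **Codescent.** For $X : \Delta^{\mathrm{op}} \to \mathbf{Cat}$, a codescent cocone with vertex $Z$ is a pair $(f_0,f_1)$ with $f_0 : X_0 \to Z$ a functor and $f_1 : f_0d_1 \to f_0d_0$ a natural transformation such that $f_1s_0 = 1_{f_0}$ and $(f_1d_0)(f_1d_2) = f_1d_1$. $\mathrm{CoDesc}(X)$ is the vertex of the (2-dimensionally) universal codescent cocone, i.e. the colimit of $X$ weighted by the inclusion $\Delta \to \mathbf{Cat}$; $\mathrm{CoDesc}$ is functorial. **Exactness in $\mathbf{Cat}$.** A lax square in $\mathbf{Cat}$, given by functors $p : P \to A$, $q : P \to B$, $f : A \to C$, $g : B \to C$ and a natural transformation $\phi : fp \to gq$, is exact if for every $\psi : h \to lf$ exhibiting $l$ as a pointwise left Kan extension of $h$ along $f$, the composite $(l\phi)(\psi p) : hp \to lgq$ exhibits $lg$ as a pointwise left Kan extension of $hp$ along $q$. (Equivalently, for all $a \in A$, $b\in B$ the canonical function $\int^{x \in P} B(qx,b)\times A(a,px) \to C(fa,gb)$ is a bijection.) *)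

theory Defs
  imports Main "HOL-Library.FuncSet" "HOL-Library.Infinite_Typeclass"
begin

section \<open>Categories, functors and natural transformations\<close>

text \<open>
  Categories live on carrier sets.  Functors and transformations are extensional, i.e. equal to
  \<open>undefined\<close> outside the carrier of their domain, so that equality of functors and of
  transformations is equality in HOL.  \<open>Comp C g f\<close> means \<open>f\<close> first, then \<open>g\<close>.
\<close>

record ('o, 'a) category =
  Obj :: "'o set"
  Arr :: "'a set"
  Dom :: "'a \<Rightarrow> 'o"
  Cod :: "'a \<Rightarrow> 'o"
  Ident :: "'o \<Rightarrow> 'a"
  Comp :: "'a \<Rightarrow> 'a \<Rightarrow> 'a"

definition hom :: "('o, 'a) category \<Rightarrow> 'o \<Rightarrow> 'o \<Rightarrow> 'a set" where
  "hom C x y = {f \<in> Arr C. Dom C f = x \<and> Cod C f = y}"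

locale category =
  fixes C :: "('o, 'a) category"
  assumes Dom_in: "f \<in> Arr C \<Longrightarrow> Dom C f \<in> Obj C"
    and Cod_in: "f \<in> Arr C \<Longrightarrow> Cod C f \<in> Obj C"
    and Ident_in: "x \<in> Obj C \<Longrightarrow> Ident C x \<in> hom C x x"
    and Comp_in: "f \<in> hom C x y \<Longrightarrow> g \<in> hom C y z \<Longrightarrow> Comp C g f \<in> hom C x z"
    and Ident_left: "f \<in> hom C x y \<Longrightarrow> Comp C (Ident C y) f = f"
    and Ident_right: "f \<in> hom C x y \<Longrightarrow> Comp C f (Ident C x) = f"
    and Comp_assoc: "f \<in> hom C w x \<Longrightarrow> g \<in> hom C x y \<Longrightarrow> h \<in> hom C y z \<Longrightarrow>
      Comp C h (Comp C g f) = Comp C (Comp C h g) f"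

record ('o, 'a, 'p, 'b) func =
  Omap :: "'o \<Rightarrow> 'p"
  Amap :: "'a \<Rightarrow> 'b"

locale is_functor = A: category A + B: category B
  for A :: "('o, 'a) category" and B :: "('p, 'b) category" +
  fixes F :: "('o, 'a, 'p, 'b) func"
  assumes Omap_in: "Omap F \<in> Obj A \<rightarrow>\<^sub>E Obj B"
    and Amap_ext: "Amap F \<in> extensional (Arr A)"
    and Amap_in: "m \<in> hom A x y \<Longrightarrow> Amap F m \<in> hom B (Omap F x) (Omap F y)"
    and Amap_Ident: "x \<in> Obj A \<Longrightarrow> Amap F (Ident A x) = Ident B (Omap F x)"
    and Amap_Comp: "m \<in> hom A x y \<Longrightarrow> n \<in> hom A y z \<Longrightarrow>
      Amap F (Comp A n m) = Comp B (Amap F n) (Amap F m)"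

definition id_func :: "('o, 'a) category \<Rightarrow> ('o, 'a, 'o, 'a) func" where
  "id_func A = \<lparr>Omap = (\<lambda>x\<in>Obj A. x), Amap = (\<lambda>m\<in>Arr A. m)\<rparr>"

text \<open>\<open>func_comp A G F\<close> is the composite \<open>GF\<close> of \<open>F\<close>, with domain \<open>A\<close>, and \<open>G\<close>.\<close>

definition func_comp ::
  "('o, 'a) category \<Rightarrow> ('p, 'b, 'q, 'c) func \<Rightarrow> ('o, 'a, 'p, 'b) func \<Rightarrow> ('o, 'a, 'q, 'c) func" where
  "func_comp A G F = \<lparr>Omap = compose (Obj A) (Omap G) (Omap F), Amap = compose (Arr A) (Amap G) (Amap F)\<rparr>"

locale nat_trans = F: is_functor A B F + G: is_functor A B G
  for A :: "('o, 'a) category" and B :: "('p, 'b) category" and F G +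
  fixes t :: "'o \<Rightarrow> 'b"
  assumes component_ext: "t \<in> extensional (Obj A)"
    and component_in: "x \<in> Obj A \<Longrightarrow> t x \<in> hom B (Omap F x) (Omap G x)"
    and naturality: "m \<in> hom A x y \<Longrightarrow> Comp B (t y) (Amap F m) = Comp B (Amap G m) (t x)"

section \<open>Pullback squares\<close>

text \<open>
  A commutative square with \<open>f p = g q\<close> which is a pullback in the category with objects \<open>Ob\<close>,
  hom-predicate \<open>H\<close> and composition \<open>cmp\<close>, whose first argument is the domain of the composite.
\<close>

definition is_pullback ::
  "('c \<Rightarrow> bool) \<Rightarrow> ('c \<Rightarrow> 'c \<Rightarrow> 'm \<Rightarrow> bool) \<Rightarrow> ('c \<Rightarrow> 'm \<Rightarrow> 'm \<Rightarrow> 'm) \<Rightarrow>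
   'c \<Rightarrow> 'c \<Rightarrow> 'c \<Rightarrow> 'c \<Rightarrow> 'm \<Rightarrow> 'm \<Rightarrow> 'm \<Rightarrow> 'm \<Rightarrow> bool" where
  "is_pullback Ob H cmp P A B C p q f g \<longleftrightarrow>
     Ob P \<and> Ob A \<and> Ob B \<and> Ob C \<and> H P A p \<and> H P B q \<and> H A C f \<and> H B C g \<and>
     cmp P f p = cmp P g q \<and>
     (\<forall>T a b. Ob T \<and> H T A a \<and> H T B b \<and> cmp T f a = cmp T g b \<longrightarrow>
        (\<exists>!r. H T P r \<and> cmp T p r = a \<and> cmp T q r = b))"

text \<open>
  The test objects \<open>T\<close> range over all categories on the same types.  At \<open>('u, 'u) category\<close> with
  \<open>'u\<close> infinite this is the category of small categories of cardinality at most that of \<open>'u\<close>, which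
  is closed under pullbacks and codescent objects.
\<close>

abbreviation Cat_pullback ::
  "('o, 'a) category \<Rightarrow> ('o, 'a) category \<Rightarrow> ('o, 'a) category \<Rightarrow> ('o, 'a) category \<Rightarrow>
   ('o, 'a, 'o, 'a) func \<Rightarrow> ('o, 'a, 'o, 'a) func \<Rightarrow>
   ('o, 'a, 'o, 'a) func \<Rightarrow> ('o, 'a, 'o, 'a) func \<Rightarrow> bool" where
  "Cat_pullback \<equiv> is_pullback category is_functor func_comp"

section \<open>Opfibrations\<close>

definition opcartesian ::
  "('o, 'a) category \<Rightarrow> ('p, 'b) category \<Rightarrow> ('o, 'a, 'p, 'b) func \<Rightarrow> 'a \<Rightarrow> bool" where
  "opcartesian E B F k \<longleftrightarrow> k \<in> Arr E \<and>
     (\<forall>m v. m \<in> Arr E \<and> Dom E m = Dom E k \<and>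
        v \<in> hom B (Omap F (Cod E k)) (Omap F (Cod E m)) \<and> Comp B v (Amap F k) = Amap F m \<longrightarrow>
        (\<exists>!n. n \<in> hom E (Cod E k) (Cod E m) \<and> Amap F n = v \<and> Comp E n k = m))"

definition opfibration ::
  "('o, 'a) category \<Rightarrow> ('p, 'b) category \<Rightarrow> ('o, 'a, 'p, 'b) func \<Rightarrow> bool" where
  "opfibration E B F \<longleftrightarrow> is_functor E B F \<and>
     (\<forall>e \<in> Obj E. \<forall>u \<in> Arr B. Dom B u = Omap F e \<longrightarrow>
        (\<exists>k. opcartesian E B F k \<and> Dom E k = e \<and> Amap F k = u))"

text \<open>\<open>l e u\<close> is the chosen opcartesian arrow with domain \<open>e\<close> over \<open>u\<close>.\<close>

locale split_opfibration = is_functor E B F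
  for E :: "('o, 'a) category" and B :: "('p, 'b) category" and F +
  fixes l :: "'o \<Rightarrow> 'b \<Rightarrow> 'a"
  assumes lift_opcartesian: "e \<in> Obj E \<Longrightarrow> u \<in> hom B (Omap F e) b \<Longrightarrow> opcartesian E B F (l e u)"
    and lift_Dom: "e \<in> Obj E \<Longrightarrow> u \<in> hom B (Omap F e) b \<Longrightarrow> Dom E (l e u) = e"
    and lift_over: "e \<in> Obj E \<Longrightarrow> u \<in> hom B (Omap F e) b \<Longrightarrow> Amap F (l e u) = u"
    and lift_Ident: "e \<in> Obj E \<Longrightarrow> l e (Ident B (Omap F e)) = Ident E e"
    and lift_Comp: "e \<in> Obj E \<Longrightarrow> u \<in> hom B (Omap F e) b \<Longrightarrow> v \<in> hom B b c \<Longrightarrow>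
      l e (Comp B v u) = Comp E (l (Cod E (l e u)) v) (l e u)"

definition split_opfibration_morphism ::
  "('o, 'a) category \<Rightarrow> ('p, 'b) category \<Rightarrow> ('o, 'a, 'p, 'b) func \<Rightarrow> ('o \<Rightarrow> 'b \<Rightarrow> 'a) \<Rightarrow>
   ('o2, 'a2) category \<Rightarrow> ('p2, 'b2) category \<Rightarrow> ('o2, 'a2, 'p2, 'b2) func \<Rightarrow> ('o2 \<Rightarrow> 'b2 \<Rightarrow> 'a2) \<Rightarrow>
   ('o, 'a, 'o2, 'a2) func \<Rightarrow> ('p, 'b, 'p2, 'b2) func \<Rightarrow> bool" where
  "split_opfibration_morphism E B F l E' B' F' l' H K \<longleftrightarrow>
     is_functor E E' H \<and> is_functor B B' K \<and> func_comp E F' H = func_comp E K F \<and>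
     (\<forall>e \<in> Obj E. \<forall>u \<in> Arr B. Dom B u = Omap F e \<longrightarrow>
        Amap H (l e u) = l' (Omap H e) (Amap K u))"

text \<open>
  Given a pullback square with \<open>F k = g F'\<close>, where \<open>F' : E' \<rightarrow> B'\<close> and \<open>k : E' \<rightarrow> E\<close>, a splitting \<open>l\<close>
  of \<open>F : E \<rightarrow> B\<close> induces this splitting of \<open>F'\<close>.
\<close>

definition pullback_lift ::
  "('o2, 'a2) category \<Rightarrow> ('o2, 'a2, 'p2, 'b2) func \<Rightarrow> ('o2, 'a2, 'o, 'a) func \<Rightarrow>
   ('p2, 'b2, 'p, 'b) func \<Rightarrow> ('o \<Rightarrow> 'b \<Rightarrow> 'a) \<Rightarrow> 'o2 \<Rightarrow> 'b2 \<Rightarrow> 'a2" where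
  "pullback_lift E' F' k g l e u =
     (THE w. w \<in> Arr E' \<and> Amap F' w = u \<and> Amap k w = l (Omap k e) (Amap g u))"

text \<open>The splitting of the composite of \<open>F\<close>, split by \<open>l\<close>, and a functor split by \<open>l'\<close>.\<close>

definition composite_lift ::
  "('o, 'a, 'p, 'b) func \<Rightarrow> ('o \<Rightarrow> 'b \<Rightarrow> 'a) \<Rightarrow> ('p \<Rightarrow> 'c \<Rightarrow> 'b) \<Rightarrow> 'o \<Rightarrow> 'c \<Rightarrow> 'a" where
  "composite_lift F l l' e u = l e (l' (Omap F e) u)"

section \<open>Simplicial categories and crossed double categories\<close>

text \<open>
  Simplicial objects are given by faces and degeneracies: \<open>face X n i\<close> is
  \<open>d\<^sub>i : X\<^bsub>n+1\<^esub> \<rightarrow> X\<^bsub>n\<^esub>\<close> and \<open>degen X n i\<close> is \<open>s\<^sub>i : X\<^bsub>n\<^esub> \<rightarrow> X\<^bsub>n+1\<^esub>\<close>.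
\<close>

record ('o, 'a) simplicial_cat =
  lev :: "nat \<Rightarrow> ('o, 'a) category"
  face :: "nat \<Rightarrow> nat \<Rightarrow> ('o, 'a, 'o, 'a) func"
  degen :: "nat \<Rightarrow> nat \<Rightarrow> ('o, 'a, 'o, 'a) func"

locale simplicial_cat =
  fixes X :: "('o, 'a, 'z) simplicial_cat_scheme"
  assumes lev_category: "category (lev X n)"
    and face_functor: "i \<le> n + 1 \<Longrightarrow> is_functor (lev X (n + 1)) (lev X n) (face X n i)"
    and degen_functor: "i \<le> n \<Longrightarrow> is_functor (lev X n) (lev X (n + 1)) (degen X n i)"
    and face_face: "i < j \<Longrightarrow> j \<le> n + 2 \<Longrightarrow>
      func_comp (lev X (n + 2)) (face X n i) (face X (n + 1) j) =
      func_comp (lev X (n + 2)) (face X n (j - 1)) (face X (n + 1) i)"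
    and degen_degen: "i \<le> j \<Longrightarrow> j \<le> n \<Longrightarrow>
      func_comp (lev X n) (degen X (n + 1) i) (degen X n j) =
      func_comp (lev X n) (degen X (n + 1) (j + 1)) (degen X n i)"
    and face_degen_lt: "i < j \<Longrightarrow> j \<le> n + 1 \<Longrightarrow>
      func_comp (lev X (n + 1)) (face X (n + 1) i) (degen X (n + 1) j) =
      func_comp (lev X (n + 1)) (degen X n (j - 1)) (face X n i)"
    and face_degen_id: "i = j \<or> i = j + 1 \<Longrightarrow> j \<le> n \<Longrightarrow>
      func_comp (lev X n) (face X n i) (degen X n j) = id_func (lev X n)"
    and face_degen_gt: "j + 1 < i \<Longrightarrow> i \<le> n + 2 \<Longrightarrow>
      func_comp (lev X (n + 1)) (face X (n + 1) i) (degen X (n + 1) j) =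
      func_comp (lev X (n + 1)) (degen X n j) (face X n (i - 1))"

locale double_category = simplicial_cat X for X :: "('o, 'a, 'z) simplicial_cat_scheme" +
  assumes segal: "Cat_pullback (lev X (n + 2)) (lev X (n + 1)) (lev X (n + 1)) (lev X n)
    (face X (n + 1) (n + 2)) (face X (n + 1) 0) (face X n 0) (face X n (n + 1))"

type_synonym ('o, 'a) simplicial_map = "nat \<Rightarrow> ('o, 'a, 'o, 'a) func"

definition smap_comp ::
  "('o, 'a, 'z) simplicial_cat_scheme \<Rightarrow> ('o, 'a) simplicial_map \<Rightarrow> ('o, 'a) simplicial_map \<Rightarrow>
   ('o, 'a) simplicial_map" where
  "smap_comp X g f = (\<lambda>n. func_comp (lev X n) (g n) (f n))"

locale double_functor = X: double_category X + Y: double_category Y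
  for X :: "('o, 'a, 'z) simplicial_cat_scheme" and Y :: "('o, 'a, 'z) simplicial_cat_scheme" +
  fixes f :: "('o, 'a) simplicial_map"
  assumes level_functor: "is_functor (lev X n) (lev Y n) (f n)"
    and commutes_face: "i \<le> n + 1 \<Longrightarrow>
      func_comp (lev X (n + 1)) (f n) (face X n i) = func_comp (lev X (n + 1)) (face Y n i) (f (n + 1))"
    and commutes_degen: "i \<le> n \<Longrightarrow>
      func_comp (lev X n) (f (n + 1)) (degen X n i) = func_comp (lev X n) (degen Y n i) (f n)"

text \<open>The field \<open>lift\<close> is the splitting of \<open>d\<^sub>0 : X\<^sub>1 \<rightarrow> X\<^sub>0\<close>.\<close>

record ('o, 'a) crossed_double_cat = "('o, 'a) simplicial_cat" +
  lift :: "'o \<Rightarrow> 'a \<Rightarrow> 'a"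

text \<open>
  \<open>lift_2 X\<close> is the splitting of \<open>d\<^sub>0\<^sup>2 : X\<^sub>2 \<rightarrow> X\<^sub>0\<close>, where \<open>d\<^sub>0 : X\<^sub>2 \<rightarrow> X\<^sub>1\<close> is the pullback of
  \<open>d\<^sub>0 : X\<^sub>1 \<rightarrow> X\<^sub>0\<close> along \<open>d\<^sub>1 : X\<^sub>1 \<rightarrow> X\<^sub>0\<close>, with upper edge \<open>d\<^sub>2 : X\<^sub>2 \<rightarrow> X\<^sub>1\<close>.
\<close>

definition lift_2 :: "('o, 'a) crossed_double_cat \<Rightarrow> 'o \<Rightarrow> 'a \<Rightarrow> 'a" where
  "lift_2 X = composite_lift (face X 1 0)
     (pullback_lift (lev X 2) (face X 1 0) (face X 1 2) (face X 0 1) (lift X)) (lift X)"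

locale crossed_double_category = double_category X for X :: "('o, 'a) crossed_double_cat" +
  assumes split: "split_opfibration (lev X 1) (lev X 0) (face X 0 0) (lift X)"
    and degen_morphism: "split_opfibration_morphism
      (lev X 0) (lev X 0) (id_func (lev X 0)) (\<lambda>x u. u)
      (lev X 1) (lev X 0) (face X 0 0) (lift X)
      (degen X 0 0) (id_func (lev X 0))"
    and face_morphism: "split_opfibration_morphism
      (lev X 2) (lev X 0) (func_comp (lev X 2) (face X 0 0) (face X 1 0)) (lift_2 X)
      (lev X 1) (lev X 0) (face X 0 0) (lift X)
      (face X 1 1) (id_func (lev X 0))"

locale crossed_double_functor = X: crossed_double_category X + Y: crossed_double_category Y +
  double_functor X Y f
  for X Y :: "('o, 'a) crossed_double_cat" and f +
  assumes lift_morphism: "split_opfibration_morphism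
      (lev X 1) (lev X 0) (face X 0 0) (lift X)
      (lev Y 1) (lev Y 0) (face Y 0 0) (lift Y) (f 1) (f 0)"

abbreviation crossed_pullback ::
  "('o, 'a) crossed_double_cat \<Rightarrow> ('o, 'a) crossed_double_cat \<Rightarrow> ('o, 'a) crossed_double_cat \<Rightarrow>
   ('o, 'a) crossed_double_cat \<Rightarrow> ('o, 'a) simplicial_map \<Rightarrow> ('o, 'a) simplicial_map \<Rightarrow>
   ('o, 'a) simplicial_map \<Rightarrow> ('o, 'a) simplicial_map \<Rightarrow> bool" where
  "crossed_pullback \<equiv> is_pullback crossed_double_category crossed_double_functor smap_comp"

definition discrete_fibration ::
  "('o, 'a, 'z) simplicial_cat_scheme \<Rightarrow> ('o, 'a, 'z) simplicial_cat_scheme \<Rightarrow>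
   ('o, 'a) simplicial_map \<Rightarrow> bool" where
  "discrete_fibration X Y f \<longleftrightarrow> double_functor X Y f \<and>
     Cat_pullback (lev X 1) (lev Y 1) (lev X 0) (lev Y 0) (f 1) (face X 0 0) (face Y 0 0) (f 0)"

definition objectwise_opfibration ::
  "('o, 'a, 'z) simplicial_cat_scheme \<Rightarrow> ('o, 'a, 'z) simplicial_cat_scheme \<Rightarrow>
   ('o, 'a) simplicial_map \<Rightarrow> bool" where
  "objectwise_opfibration X Y f \<longleftrightarrow> double_functor X Y f \<and> opfibration (lev X 0) (lev Y 0) (f 0)"

section \<open>Codescent objects\<close>

locale codescent_cocone = simplicial_cat X
  for X :: "('o, 'a, 'z) simplicial_cat_scheme" +
  fixes Z :: "('p, 'b) category" and k0 :: "('o, 'a, 'p, 'b) func" and k1 :: "'o \<Rightarrow> 'b"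
  assumes vertex_functor: "is_functor (lev X 0) Z k0"
    and vertex_cell: "nat_trans (lev X 1) Z
      (func_comp (lev X 1) k0 (face X 0 1)) (func_comp (lev X 1) k0 (face X 0 0)) k1"
    and cell_unit: "x \<in> Obj (lev X 0) \<Longrightarrow> k1 (Omap (degen X 0 0) x) = Ident Z (Omap k0 x)"
    and cell_comp: "x \<in> Obj (lev X 2) \<Longrightarrow>
      Comp Z (k1 (Omap (face X 1 0) x)) (k1 (Omap (face X 1 2) x)) = k1 (Omap (face X 1 1) x)"

definition cocone_morphism ::
  "('o, 'a, 'z) simplicial_cat_scheme \<Rightarrow> ('p, 'b) category \<Rightarrow>
   ('o, 'a, 'p, 'b) func \<Rightarrow> ('o \<Rightarrow> 'b) \<Rightarrow> ('o, 'a, 'p, 'b) func \<Rightarrow> ('o \<Rightarrow> 'b) \<Rightarrow> ('o \<Rightarrow> 'b) \<Rightarrow> bool" where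
  "cocone_morphism X W g0 g1 h0 h1 \<alpha> \<longleftrightarrow> nat_trans (lev X 0) W g0 h0 \<alpha> \<and>
     (\<forall>x \<in> Obj (lev X 1).
        Comp W (\<alpha> (Omap (face X 0 0) x)) (g1 x) = Comp W (h1 x) (\<alpha> (Omap (face X 0 1) x)))"

text \<open>
  The universal property says that restriction along \<open>(k0, k1)\<close> is an isomorphism from the category
  of functors \<open>Z \<rightarrow> W\<close> to the category of codescent cocones with vertex \<open>W\<close>: the first condition is
  bijectivity on objects, the second one is full faithfulness.  The test vertices \<open>W\<close> range over
  the categories on the same types as \<open>Z\<close>; at \<open>('u, 'u) category\<close> with \<open>'u\<close> infinite a codescent
  object universal among all small categories exists there, so this is the unrestricted notion.
\<close>

definition codescent_object ::
  "('o, 'a, 'z) simplicial_cat_scheme \<Rightarrow> ('p, 'b) category \<Rightarrow>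
   ('o, 'a, 'p, 'b) func \<Rightarrow> ('o \<Rightarrow> 'b) \<Rightarrow> bool" where
  "codescent_object X Z k0 k1 \<longleftrightarrow> codescent_cocone X Z k0 k1 \<and>
     (\<forall>(W :: ('p, 'b) category) g0 g1. codescent_cocone X W g0 g1 \<longrightarrow>
        (\<exists>!G. is_functor Z W G \<and> func_comp (lev X 0) G k0 = g0 \<and>
           compose (Obj (lev X 1)) (Amap G) k1 = g1)) \<and>
     (\<forall>(W :: ('p, 'b) category) G H \<alpha>. is_functor Z W G \<and> is_functor Z W H \<and>
        cocone_morphism X W
          (func_comp (lev X 0) G k0) (compose (Obj (lev X 1)) (Amap G) k1)
          (func_comp (lev X 0) H k0) (compose (Obj (lev X 1)) (Amap H) k1) \<alpha> \<longrightarrow>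
        (\<exists>!\<beta>. nat_trans Z W G H \<beta> \<and> compose (Obj (lev X 0)) \<beta> (Omap k0) = \<alpha>))"

text \<open>
  The functor \<open>CoDesc(f)\<close> between given codescent objects of \<open>X\<close> and \<open>Y\<close>: the functor induced by
  the cocone \<open>(k0' f\<^sub>0, k1' f\<^sub>1)\<close>.
\<close>

definition codescent_map ::
  "('o, 'a, 'z) simplicial_cat_scheme \<Rightarrow> ('o, 'a) simplicial_map \<Rightarrow>
   ('p, 'b) category \<Rightarrow> ('o, 'a, 'p, 'b) func \<Rightarrow> ('o \<Rightarrow> 'b) \<Rightarrow>
   ('p, 'b) category \<Rightarrow> ('o, 'a, 'p, 'b) func \<Rightarrow> ('o \<Rightarrow> 'b) \<Rightarrow> ('p, 'b, 'p, 'b) func \<Rightarrow> bool" where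
  "codescent_map X f Z k0 k1 Z' k0' k1' G \<longleftrightarrow> is_functor Z Z' G \<and>
     func_comp (lev X 0) G k0 = func_comp (lev X 0) k0' (f 0) \<and>
     compose (Obj (lev X 1)) (Amap G) k1 = compose (Obj (lev X 1)) k1' (Omap (f 1))"

section \<open>Pointwise left Kan extensions and exact squares\<close>

definition cocone ::
  "('j, 'k) category \<Rightarrow> ('p, 'b) category \<Rightarrow> ('j, 'k, 'p, 'b) func \<Rightarrow> 'p \<Rightarrow> ('j \<Rightarrow> 'b) \<Rightarrow> bool" where
  "cocone J D F w \<tau> \<longleftrightarrow> w \<in> Obj D \<and> (\<forall>j \<in> Obj J. \<tau> j \<in> hom D (Omap F j) w) \<and>
     (\<forall>m \<in> Arr J. Comp D (\<tau> (Cod J m)) (Amap F m) = \<tau> (Dom J m))"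

definition is_colimit ::
  "('j, 'k) category \<Rightarrow> ('p, 'b) category \<Rightarrow> ('j, 'k, 'p, 'b) func \<Rightarrow> 'p \<Rightarrow> ('j \<Rightarrow> 'b) \<Rightarrow> bool" where
  "is_colimit J D F w \<tau> \<longleftrightarrow> is_functor J D F \<and> cocone J D F w \<tau> \<and>
     (\<forall>w' \<tau>'. cocone J D F w' \<tau>' \<longrightarrow>
        (\<exists>!k. k \<in> hom D w w' \<and> (\<forall>j \<in> Obj J. Comp D k (\<tau> j) = \<tau>' j)))"

text \<open>
  The comma category of \<open>f\<close> over an object \<open>c\<close>.  Its objects are pairs \<open>(a, u)\<close> with \<open>u : f a \<rightarrow> c\<close>;
  an arrow from \<open>(a, u)\<close> to \<open>(a', u')\<close> is some \<open>m : a \<rightarrow> a'\<close> with \<open>u' (f m) = u\<close>, stored together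
  with its domain and codomain.
\<close>

definition comma ::
  "('o, 'a) category \<Rightarrow> ('p, 'b) category \<Rightarrow> ('o, 'a, 'p, 'b) func \<Rightarrow> 'p \<Rightarrow>
   ('o \<times> 'b, ('o \<times> 'b) \<times> 'a \<times> ('o \<times> 'b)) category" where
  "comma A C f c =
     \<lparr>Obj = {(a, u). a \<in> Obj A \<and> u \<in> hom C (Omap f a) c},
      Arr = {((a, u), m, (a', u')). u \<in> hom C (Omap f a) c \<and> u' \<in> hom C (Omap f a') c \<and>
               m \<in> hom A a a' \<and> Comp C u' (Amap f m) = u},
      Dom = (\<lambda>(s, m, t). s),
      Cod = (\<lambda>(s, m, t). t),
      Ident = (\<lambda>s. (s, Ident A (fst s), s)),
      Comp = (\<lambda>(s', n, t') (s, m, t). (s, Comp A n m, t'))\<rparr>"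

definition comma_proj ::
  "('o, 'a) category \<Rightarrow> ('p, 'b) category \<Rightarrow> ('o, 'a, 'p, 'b) func \<Rightarrow> 'p \<Rightarrow>
   ('o \<times> 'b, ('o \<times> 'b) \<times> 'a \<times> ('o \<times> 'b), 'o, 'a) func" where
  "comma_proj A C f c =
     \<lparr>Omap = restrict fst (Obj (comma A C f c)),
      Amap = restrict (\<lambda>(s, m, t). m) (Arr (comma A C f c))\<rparr>"

lemma comma_category:
  assumes f: "is_functor A C f"
  shows "category (comma A C f c)"
proof -
  interpret is_functor A C f by fact
  show ?thesis
  proof
    fix m assume "m \<in> Arr (comma A C f c)"
    then show "Dom (comma A C f c) m \<in> Obj (comma A C f c)" "Cod (comma A C f c) m \<in> Obj (comma A C f c)"
      by (auto simp: comma_def hom_def A.Dom_in A.Cod_in)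
  next
    fix x assume "x \<in> Obj (comma A C f c)"
    then obtain a u where *: "x = (a, u)" "a \<in> Obj A" "u \<in> hom C (Omap f a) c"
      by (auto simp: comma_def)
    have "Comp C u (Amap f (Ident A a)) = u"
      using * B.Ident_right by (simp add: Amap_Ident)
    then show "Ident (comma A C f c) x \<in> hom (comma A C f c) x x"
      using * A.Ident_in by (simp add: comma_def hom_def)
  next
    fix m n x y z
    assume "m \<in> hom (comma A C f c) x y" "n \<in> hom (comma A C f c) y z"
    then obtain a u m' b v n' d w where *:
      "x = (a, u)" "y = (b, v)" "z = (d, w)" "m = ((a, u), m', (b, v))" "n = ((b, v), n', (d, w))"
      "m' \<in> hom A a b" "n' \<in> hom A b d" "u \<in> hom C (Omap f a) c" "v \<in> hom C (Omap f b) c"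
      "w \<in> hom C (Omap f d) c" "Comp C v (Amap f m') = u" "Comp C w (Amap f n') = v"
      by (force simp: comma_def hom_def)
    have "Comp C w (Amap f (Comp A n' m')) = u"
      using * Amap_Comp[of m' a b n' d] B.Comp_assoc[OF Amap_in Amap_in] by metis
    then show "Comp (comma A C f c) n m \<in> hom (comma A C f c) x z"
      using * A.Comp_in[of m' a b n' d] by (auto simp: comma_def hom_def)
  next
    fix m x y
    assume "m \<in> hom (comma A C f c) x y"
    then show "Comp (comma A C f c) (Ident (comma A C f c) y) m = m"
      "Comp (comma A C f c) m (Ident (comma A C f c) x) = m"
      using A.Ident_left A.Ident_right by (auto simp: comma_def hom_def)
  next
    fix k m n w x y z
    assume "k \<in> hom (comma A C f c) w x" "m \<in> hom (comma A C f c) x y" "n \<in> hom (comma A C f c) y z"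
    then show "Comp (comma A C f c) n (Comp (comma A C f c) m k) =
      Comp (comma A C f c) (Comp (comma A C f c) n m) k"
      using A.Comp_assoc by (auto simp: comma_def hom_def)
  qed
qed

lemma comma_proj_functor:
  assumes f: "is_functor A C f"
  shows "is_functor (comma A C f c) A (comma_proj A C f c)"
proof -
  interpret is_functor A C f by fact
  interpret K: category "comma A C f c" using f by (rule comma_category)
  show ?thesis
  proof
    show "Omap (comma_proj A C f c) \<in> Obj (comma A C f c) \<rightarrow>\<^sub>E Obj A"
      by (auto simp: comma_proj_def comma_def)
    show "Amap (comma_proj A C f c) \<in> extensional (Arr (comma A C f c))"
      by (simp add: comma_proj_def)
  next
    fix m x y assume m: "m \<in> hom (comma A C f c) x y"
    then have "x \<in> Obj (comma A C f c)" "y \<in> Obj (comma A C f c)"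
      using K.Dom_in[of m] K.Cod_in[of m] unfolding hom_def by blast+
    with m show "Amap (comma_proj A C f c) m \<in>
        hom A (Omap (comma_proj A C f c) x) (Omap (comma_proj A C f c) y)"
      by (auto simp: comma_proj_def comma_def hom_def)
  next
    fix x assume x: "x \<in> Obj (comma A C f c)"
    then have "Ident (comma A C f c) x \<in> Arr (comma A C f c)"
      using K.Ident_in by (auto simp: hom_def)
    with x show "Amap (comma_proj A C f c) (Ident (comma A C f c) x) =
        Ident A (Omap (comma_proj A C f c) x)"
      by (auto simp: comma_proj_def comma_def)
  next
    fix m n x y z assume mn: "m \<in> hom (comma A C f c) x y" "n \<in> hom (comma A C f c) y z"
    then have "Comp (comma A C f c) n m \<in> Arr (comma A C f c)"
      using K.Comp_in by (auto simp: hom_def)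
    with mn show "Amap (comma_proj A C f c) (Comp (comma A C f c) n m) =
        Comp A (Amap (comma_proj A C f c) n) (Amap (comma_proj A C f c) m)"
      by (auto simp: comma_proj_def comma_def hom_def)
  qed
qed

text \<open>
  \<open>\<psi> : h \<rightarrow> l f\<close> exhibits \<open>l\<close> as a pointwise left Kan extension of \<open>h\<close> along \<open>f\<close>: for each \<open>c\<close> the
  arrows \<open>l(u) \<psi>\<^sub>a : h a \<rightarrow> l c\<close>, for \<open>u : f a \<rightarrow> c\<close>, form a colimit cocone.
\<close>

definition pointwise_lan ::
  "('o, 'a) category \<Rightarrow> ('p, 'b) category \<Rightarrow> ('q, 'd) category \<Rightarrow> ('o, 'a, 'p, 'b) func \<Rightarrow>
   ('o, 'a, 'q, 'd) func \<Rightarrow> ('p, 'b, 'q, 'd) func \<Rightarrow> ('o \<Rightarrow> 'd) \<Rightarrow> bool" where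
  "pointwise_lan A C D f h l \<psi> \<longleftrightarrow>
     is_functor A C f \<and> is_functor A D h \<and> is_functor C D l \<and> nat_trans A D h (func_comp A l f) \<psi> \<and>
     (\<forall>c \<in> Obj C. is_colimit (comma A C f c) D (func_comp (comma A C f c) h (comma_proj A C f c))
        (Omap l c) (\<lambda>(a, u). Comp D (Amap l u) (\<psi> a)))"

text \<open>
  Exactness of the lax square \<open>\<phi> : f p \<rightarrow> g q\<close> with respect to Kan extensions into categories \<open>D\<close> on
  the types given by the first argument.
\<close>

definition exact_square ::
  "('q, 'd) category itself \<Rightarrow>
   ('o1, 'a1) category \<Rightarrow> ('o2, 'a2) category \<Rightarrow> ('o3, 'a3) category \<Rightarrow> ('o4, 'a4) category \<Rightarrow>
   ('o1, 'a1, 'o2, 'a2) func \<Rightarrow> ('o1, 'a1, 'o3, 'a3) func \<Rightarrow>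
   ('o2, 'a2, 'o4, 'a4) func \<Rightarrow> ('o3, 'a3, 'o4, 'a4) func \<Rightarrow> ('o1 \<Rightarrow> 'a4) \<Rightarrow> bool" where
  "exact_square (_ :: ('q, 'd) category itself) P A B C p q f g \<phi> \<longleftrightarrow>
     is_functor P A p \<and> is_functor P B q \<and> is_functor A C f \<and> is_functor B C g \<and>
     nat_trans P C (func_comp P f p) (func_comp P g q) \<phi> \<and>
     (\<forall>(D :: ('q, 'd) category) h l \<psi>. pointwise_lan A C D f h l \<psi> \<longrightarrow>
        pointwise_lan P B D q (func_comp P h p) (func_comp B l g)
          (\<lambda>x\<in>Obj P. Comp D (Amap l (\<phi> x)) (\<psi> (Omap p x))))"

definition id_trans ::
  "('o, 'a) category \<Rightarrow> ('p, 'b) category \<Rightarrow> ('o, 'a, 'p, 'b) func \<Rightarrow> 'o \<Rightarrow> 'b" where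
  "id_trans A B F = (\<lambda>x\<in>Obj A. Ident B (Omap F x))"

end

(*
  In a crossed double category every composite of horizontal and vertical arrows can be rewritten as
  a corner, a vertical arrow followed by a horizontal one, by sliding vertical arrows to the front
  along the splitting of d_0.  So CoDesc(X) has the objects of X_0, and as arrows the corners modulo
  (v, h) ~ (d_1 a v, h') for squares a : h -> h' over an identity.

  Exactness amounts to this: every f a -> g b in CoDesc(C) factors as g u . f m with m : a -> p x and
  u : q x -> b, and any two factorisations of the same arrow are connected by arrows of CoDesc(P).  Given
  a corner (v, h), lift h along the discrete fibration g and v along the opfibration f_0; this gives a
  factorisation.  Every factorisation is connected to one obtained in this way, because horizontal
  arrows of A and vertical arrows of B lift to P.  Two lifts of the same corner are compared with an
  opcartesian lift of v, and the squares generating the equivalence of corners lift along g.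
*)

theory Submission
  imports Defs
begin

section \<open>Functors and quotient categories\<close>

text \<open>The codescent objects are known only through their universal property, and equality of
  their arrows has to be decided. Universality of the category of corners modulo squares is never
  shown. It is used as a single cocone: the functor it induces out of the codescent object sends the
  arrow represented by a corner to the class of that corner, so equal arrows have equivalent
  corners.

  All universal properties test against categories over the type \<open>'u\<close> alone. Pairs and
  classes of corners are therefore coded in \<open>'u\<close>, which is possible because
  \<open>'u\<close> is infinite. A pullback is read elementwise by two such tests: the explicit
  category of matched pairs gives existence, the kernel pair of \<open>(p, q)\<close> gives
  uniqueness. For the square of crossed double categories this requires matched pairs to be crossed
  again.

  A generating square of the congruence on corners is lifted in one direction only, since an
  opfibration transports arrows forwards. Hence the induction along a zigzag of corners speaks about
  all standard factorisations over a corner at once, and a backward step is lifted from its other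
  end.\<close>

lemma (in category) arr_hom: "m \<in> Arr C \<Longrightarrow> m \<in> hom C (Dom C m) (Cod C m)"
  by (simp add: hom_def)

lemma (in category) hom_objs:
  assumes "m \<in> hom C x y" shows "x \<in> Obj C" "y \<in> Obj C"
  using assms Dom_in Cod_in by (auto simp: hom_def)

lemma homD: "m \<in> hom C x y \<Longrightarrow> m \<in> Arr C" "m \<in> hom C x y \<Longrightarrow> Dom C m = x"
  "m \<in> hom C x y \<Longrightarrow> Cod C m = y"
  by (auto simp: hom_def)

context is_functor begin

lemma Omap_Obj: "x \<in> Obj A \<Longrightarrow> Omap F x \<in> Obj B"
  using Omap_in by auto

lemma Amap_Arr: "m \<in> Arr A \<Longrightarrow> Amap F m \<in> Arr B"
  using Amap_in[OF A.arr_hom] by (auto dest: homD)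

lemma Dom_Amap: "m \<in> Arr A \<Longrightarrow> Dom B (Amap F m) = Omap F (Dom A m)"
  using Amap_in[OF A.arr_hom] by (auto dest: homD)

lemma Cod_Amap: "m \<in> Arr A \<Longrightarrow> Cod B (Amap F m) = Omap F (Cod A m)"
  using Amap_in[OF A.arr_hom] by (auto dest: homD)

end

lemma func_comp_simps:
  "x \<in> Obj A \<Longrightarrow> Omap (func_comp A G F) x = Omap G (Omap F x)"
  "m \<in> Arr A \<Longrightarrow> Amap (func_comp A G F) m = Amap G (Amap F m)"
  by (simp_all add: func_comp_def compose_def)

lemma func_comp_eq_iff:
  "func_comp A G F = func_comp A G' F' \<longleftrightarrow>
    (\<forall>x\<in>Obj A. Omap G (Omap F x) = Omap G' (Omap F' x)) \<and>
    (\<forall>m\<in>Arr A. Amap G (Amap F m) = Amap G' (Amap F' m))"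
  by (auto simp: func_comp_def compose_def restrict_def fun_eq_iff)

lemma func_comp_eq_id_iff:
  "func_comp A G F = id_func A \<longleftrightarrow>
    (\<forall>x\<in>Obj A. Omap G (Omap F x) = x) \<and> (\<forall>m\<in>Arr A. Amap G (Amap F m) = m)"
  by (auto simp: func_comp_def id_func_def compose_def restrict_def fun_eq_iff)

lemma func_eqI:
  assumes "is_functor A B F" "is_functor A B' G"
    "\<And>x. x \<in> Obj A \<Longrightarrow> Omap F x = Omap G x" "\<And>m. m \<in> Arr A \<Longrightarrow> Amap F m = Amap G m"
  shows "F = G"
proof -
  interpret F: is_functor A B F by fact
  interpret G: is_functor A B' G by fact
  have "Omap F = Omap G"
    using F.Omap_in G.Omap_in assms(3) by (intro extensionalityI[where A="Obj A"]) (auto simp: PiE_def)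
  moreover have "Amap F = Amap G"
    using F.Amap_ext G.Amap_ext assms(4) by (rule extensionalityI)
  ultimately show ?thesis by (simp add: func.equality)
qed

lemma func_comp_eqI:
  assumes "is_functor A B F"
    "\<And>x. x \<in> Obj A \<Longrightarrow> Omap G (Omap H x) = Omap F x"
    "\<And>m. m \<in> Arr A \<Longrightarrow> Amap G (Amap H m) = Amap F m"
  shows "func_comp A G H = F"
proof -
  interpret F: is_functor A B F by fact
  have "Omap (func_comp A G H) = Omap F"
    using F.Omap_in assms(2)
    by (auto simp: func_comp_def compose_def restrict_def fun_eq_iff PiE_def extensional_def)
  moreover have "Amap (func_comp A G H) = Amap F"
    using F.Amap_ext assms(3)
    by (auto simp: func_comp_def compose_def restrict_def fun_eq_iff extensional_def)
  ultimately show ?thesis by (simp add: func.equality)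
qed

lemma func_comp_functor:
  assumes "is_functor A B F" "is_functor B C G"
  shows "is_functor A C (func_comp A G F)"
proof -
  interpret F: is_functor A B F by fact
  interpret G: is_functor B C G by fact
  show ?thesis
  proof
    show "Omap (func_comp A G F) \<in> Obj A \<rightarrow>\<^sub>E Obj C"
      by (auto simp: func_comp_def compose_def F.Omap_Obj G.Omap_Obj)
    show "Amap (func_comp A G F) \<in> extensional (Arr A)"
      by (simp add: func_comp_def compose_def)
  next
    fix m x y assume m: "m \<in> hom A x y"
    then show "Amap (func_comp A G F) m \<in> hom C (Omap (func_comp A G F) x) (Omap (func_comp A G F) y)"
      using G.Amap_in[OF F.Amap_in[OF m]] F.A.hom_objs[OF m] homD[OF m] by (simp add: func_comp_simps)
  next
    fix x assume x: "x \<in> Obj A"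
    then show "Amap (func_comp A G F) (Ident A x) = Ident C (Omap (func_comp A G F) x)"
      using F.A.Ident_in[OF x]
      by (simp add: func_comp_simps hom_def F.Amap_Ident G.Amap_Ident F.Omap_Obj)
  next
    fix m n x y z assume mn: "m \<in> hom A x y" "n \<in> hom A y z"
    then show "Amap (func_comp A G F) (Comp A n m) =
        Comp C (Amap (func_comp A G F) n) (Amap (func_comp A G F) m)"
      using F.A.Comp_in[OF mn] F.Amap_Comp[OF mn] G.Amap_Comp[OF F.Amap_in[OF mn(1)] F.Amap_in[OF mn(2)]]
      by (simp add: func_comp_simps hom_def)
  qed
qed

lemma id_functor:
  assumes "category A" shows "is_functor A A (id_func A)"
proof -
  interpret category A by fact
  show ?thesis
    by unfold_locales
      (use hom_objs Ident_in Comp_in in \<open>auto simp: id_func_def hom_def Dom_in Cod_in\<close>)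
qed

section \<open>Quotients of categories by congruences on arrows\<close>

definition image_category :: "('o, 'c) category \<Rightarrow> ('c \<Rightarrow> 'b) \<Rightarrow> ('o, 'b) category" where
  "image_category K e = (let s = inv_into (Arr K) e in
    \<lparr>Obj = Obj K, Arr = e ` Arr K, Dom = (\<lambda>m. Dom K (s m)), Cod = (\<lambda>m. Cod K (s m)),
     Ident = (\<lambda>x. e (Ident K x)), Comp = (\<lambda>n m. e (Comp K (s n) (s m)))\<rparr>)"

text \<open>The congruence is the kernel of \<open>e\<close>. Arrows of the quotient are codes
  \<open>e m\<close> instead of equivalence classes, so its arrow type can be chosen freely. Domains
  and composites are computed on the representatives picked by \<open>inv_into\<close>, and the two
  assumptions make that choice irrelevant.\<close>

locale arrow_congruence = category K for K :: "('o, 'c) category" +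
  fixes e :: "'c \<Rightarrow> 'b"
  assumes parallel: "m \<in> Arr K \<Longrightarrow> m' \<in> Arr K \<Longrightarrow> e m = e m' \<Longrightarrow> Dom K m = Dom K m' \<and> Cod K m = Cod K m'"
    and congruent: "m \<in> hom K x y \<Longrightarrow> n \<in> hom K y z \<Longrightarrow> m' \<in> hom K x y \<Longrightarrow> n' \<in> hom K y z \<Longrightarrow>
      e m = e m' \<Longrightarrow> e n = e n' \<Longrightarrow> e (Comp K n m) = e (Comp K n' m')"
begin

abbreviation "Q \<equiv> image_category K e"

lemma Obj_image: "Obj Q = Obj K" and Ident_image: "Ident Q x = e (Ident K x)"
  by (simp_all add: image_category_def Let_def)

lemma hom_image: "m \<in> hom K x y \<Longrightarrow> e m \<in> hom Q x y"
  using parallel[of "inv_into (Arr K) e (e m)" m] inv_into_into[of "e m" e "Arr K"]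
    f_inv_into_f[of "e m" e "Arr K"]
  by (auto simp: image_category_def Let_def hom_def)

lemma hom_imageE:
  assumes "k \<in> hom Q x y" obtains m where "m \<in> hom K x y" "k = e m"
proof
  show "inv_into (Arr K) e k \<in> hom K x y" "k = e (inv_into (Arr K) e k)"
    using assms inv_into_into[of k e "Arr K"] f_inv_into_f[of k e "Arr K"]
    by (auto simp: image_category_def Let_def hom_def)
qed

lemma Comp_image:
  assumes "m \<in> hom K x y" "n \<in> hom K y z"
  shows "Comp Q (e n) (e m) = e (Comp K n m)"
proof -
  have *: "inv_into (Arr K) e (e k) \<in> hom K u v" "e (inv_into (Arr K) e (e k)) = e k"
    if k: "k \<in> hom K u v" for k u v
    using k parallel[of "inv_into (Arr K) e (e k)" k] inv_into_into[of "e k" e "Arr K"]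
      f_inv_into_f[of "e k" e "Arr K"]
    by (auto simp: hom_def)
  show ?thesis
    using congruent[OF *(1)[OF assms(1)] *(1)[OF assms(2)] assms] *(2)[OF assms(1)] *(2)[OF assms(2)]
    by (simp add: image_category_def Let_def)
qed

lemma image_is_category: "category Q"
proof
  fix m assume "m \<in> Arr Q"
  then have "inv_into (Arr K) e m \<in> Arr K"
    by (auto simp: image_category_def Let_def inv_into_into)
  then show "Dom Q m \<in> Obj Q" "Cod Q m \<in> Obj Q"
    by (auto simp: image_category_def Let_def Dom_in Cod_in)
next
  fix x assume "x \<in> Obj Q" then show "Ident Q x \<in> hom Q x x"
    by (metis Obj_image Ident_image Ident_in hom_image)
next
  fix m n x y z assume "m \<in> hom Q x y" "n \<in> hom Q y z"
  then obtain m' n' where *: "m' \<in> hom K x y" "n' \<in> hom K y z" "m = e m'" "n = e n'"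
    by (elim hom_imageE) blast
  show "Comp Q n m \<in> hom Q x z"
    using hom_image[OF Comp_in[OF *(1,2)]] *(3,4) by (simp add: Comp_image[OF *(1,2)])
next
  fix m x y assume "m \<in> hom Q x y"
  then obtain m' where m': "m' \<in> hom K x y" "m = e m'" by (rule hom_imageE)
  show "Comp Q (Ident Q y) m = m" "Comp Q m (Ident Q x) = m"
    using Comp_image[OF m'(1) Ident_in] Comp_image[OF Ident_in m'(1)] hom_objs[OF m'(1)] m'
    by (simp_all add: Ident_image Ident_left[OF m'(1)] Ident_right[OF m'(1)])
next
  fix m n k w x y z assume "m \<in> hom Q w x" "n \<in> hom Q x y" "k \<in> hom Q y z"
  then obtain m' n' k' where *: "m' \<in> hom K w x" "n' \<in> hom K x y" "k' \<in> hom K y z"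
      "m = e m'" "n = e n'" "k = e k'"
    by (elim hom_imageE) blast
  show "Comp Q k (Comp Q n m) = Comp Q (Comp Q k n) m"
    using * by (simp add: Comp_image[OF *(1,2)] Comp_image[OF *(2,3)]
      Comp_image[OF Comp_in[OF *(1,2)] *(3)] Comp_image[OF *(1) Comp_in[OF *(2,3)]] Comp_assoc[OF *(1-3)])
qed

end

section \<open>Matched pairs\<close>

text \<open>Test objects for the universal properties must live on \<open>'u\<close> itself, so
  categories of pairs are coded along an injection of \<open>'u \<times> 'u\<close> into
  \<open>'u\<close>. Cardinal arithmetic provides one for every infinite type.\<close>

definition pair :: "'u::infinite \<Rightarrow> 'u \<Rightarrow> 'u" where
  "pair x y = (SOME e :: 'u \<times> 'u \<Rightarrow> 'u. inj e) (x, y)"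

lemma pair_eq_iff [simp]:
  fixes x :: "'u::infinite"
  shows "pair x y = pair x' y' \<longleftrightarrow> x = x' \<and> y = y'"
proof -
  have "(card_of (UNIV :: ('u \<times> 'u) set), card_of (UNIV :: 'u set)) \<in> ordIso"
    using card_of_Times_same_infinite[of "UNIV :: 'u set"] infinite_UNIV by simp
  then have "\<exists>e :: 'u \<times> 'u \<Rightarrow> 'u. inj e"
    using card_of_ordIso by (metis bij_betw_imp_inj_on)
  then have "inj (SOME e :: 'u \<times> 'u \<Rightarrow> 'u. inj e)" by (rule someI_ex)
  then show ?thesis by (auto simp: pair_def dest: injD)
qed

definition pfst :: "'u::infinite \<Rightarrow> 'u" where "pfst z = (SOME x. \<exists>y. z = pair x y)"
definition psnd :: "'u::infinite \<Rightarrow> 'u" where "psnd z = (SOME y. \<exists>x. z = pair x y)"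

lemma pfst_pair [simp]: "pfst (pair x y) = x" and psnd_pair [simp]: "psnd (pair x y) = y"
  by (auto simp: pfst_def psnd_def)

type_synonym ('o, 'a) cospan =
  "('o, 'a) category \<times> ('o, 'a, 'o, 'a) func \<times> ('o, 'a, 'o, 'a) func"

text \<open>
  One cospan in \<open>R\<close> gives a pullback; several give the kernel of a jointly monic family, which
  yields the uniqueness half of elementwise pullbacks.
\<close>

definition pair_cat :: "('u::infinite, 'u) category \<Rightarrow> ('u, 'u) category \<Rightarrow> ('u, 'u) cospan set \<Rightarrow>
    ('u, 'u) category" where
  "pair_cat X Y R =
    \<lparr>Obj = {pair x y | x y. x \<in> Obj X \<and> y \<in> Obj Y \<and> (\<forall>(C, F, G) \<in> R. Omap F x = Omap G y)},
     Arr = {pair m n | m n. m \<in> Arr X \<and> n \<in> Arr Y \<and> (\<forall>(C, F, G) \<in> R. Amap F m = Amap G n)},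
     Dom = (\<lambda>k. pair (Dom X (pfst k)) (Dom Y (psnd k))),
     Cod = (\<lambda>k. pair (Cod X (pfst k)) (Cod Y (psnd k))),
     Ident = (\<lambda>z. pair (Ident X (pfst z)) (Ident Y (psnd z))),
     Comp = (\<lambda>l k. pair (Comp X (pfst l) (pfst k)) (Comp Y (psnd l) (psnd k)))\<rparr>"

lemma pair_cat_simps:
  "Dom (pair_cat X Y R) (pair m n) = pair (Dom X m) (Dom Y n)"
  "Cod (pair_cat X Y R) (pair m n) = pair (Cod X m) (Cod Y n)"
  "Ident (pair_cat X Y R) (pair x y) = pair (Ident X x) (Ident Y y)"
  "Comp (pair_cat X Y R) (pair m' n') (pair m n) = pair (Comp X m' m) (Comp Y n' n)"
  by (simp_all add: pair_cat_def)

lemma pair_Obj: "pair x y \<in> Obj (pair_cat X Y R) \<longleftrightarrow>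
    x \<in> Obj X \<and> y \<in> Obj Y \<and> (\<forall>(C, F, G) \<in> R. Omap F x = Omap G y)"
  by (auto simp: pair_cat_def)

lemma pair_Arr: "pair m n \<in> Arr (pair_cat X Y R) \<longleftrightarrow>
    m \<in> Arr X \<and> n \<in> Arr Y \<and> (\<forall>(C, F, G) \<in> R. Amap F m = Amap G n)"
  by (auto simp: pair_cat_def)

lemma pair_ObjE:
  assumes "z \<in> Obj (pair_cat X Y R)"
  obtains x y where "z = pair x y" "x \<in> Obj X" "y \<in> Obj Y"
    "\<And>C F G. (C, F, G) \<in> R \<Longrightarrow> Omap F x = Omap G y"
  using assms by (fastforce simp: pair_cat_def)

lemma pair_ArrE:
  assumes "k \<in> Arr (pair_cat X Y R)"
  obtains m n where "k = pair m n" "m \<in> Arr X" "n \<in> Arr Y"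
    "\<And>C F G. (C, F, G) \<in> R \<Longrightarrow> Amap F m = Amap G n"
  using assms by (fastforce simp: pair_cat_def)

lemma pair_hom: "pair m n \<in> hom (pair_cat X Y R) (pair x y) (pair x' y') \<longleftrightarrow>
    m \<in> hom X x x' \<and> n \<in> hom Y y y' \<and> (\<forall>(C, F, G) \<in> R. Amap F m = Amap G n)"
  by (auto simp: hom_def pair_Arr pair_cat_simps)

lemma pair_homE:
  assumes "k \<in> hom (pair_cat X Y R) z z'"
  obtains m n x y x' y' where "k = pair m n" "z = pair x y" "z' = pair x' y'"
    "m \<in> hom X x x'" "n \<in> hom Y y y'" "\<And>C F G. (C, F, G) \<in> R \<Longrightarrow> Amap F m = Amap G n"
proof -
  from assms have "k \<in> Arr (pair_cat X Y R)" by (rule homD)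
  then obtain m n where *: "k = pair m n" "m \<in> Arr X" "n \<in> Arr Y"
      "\<And>C F G. (C, F, G) \<in> R \<Longrightarrow> Amap F m = Amap G n"
    by (rule pair_ArrE) blast
  show thesis
    by (rule that[of m n "Dom X m" "Dom Y n" "Cod X m" "Cod Y n"])
      (use * assms in \<open>auto simp: hom_def pair_cat_simps\<close>)
qed

locale cospans = X: category X + Y: category Y
  for X Y :: "('u::infinite, 'u) category" and R :: "('u, 'u) cospan set" +
  assumes left_functor: "(C, F, G) \<in> R \<Longrightarrow> is_functor X C F"
    and right_functor: "(C, F, G) \<in> R \<Longrightarrow> is_functor Y C G"
begin

abbreviation "XY \<equiv> pair_cat X Y R"

text \<open>The matching condition is imposed on objects and on arrows separately. Matching arrows
  have matching ends because both functors preserve ends, which keeps domains and codomains inside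
  the category of pairs.\<close>

lemma matched_Dom_Cod:
  assumes "m \<in> hom X x x'" "n \<in> hom Y y y'" "(C, F, G) \<in> R" "Amap F m = Amap G n"
  shows "Omap F x = Omap G y" "Omap F x' = Omap G y'"
  using is_functor.Amap_in[OF left_functor[OF assms(3)] assms(1)]
    is_functor.Amap_in[OF right_functor[OF assms(3)] assms(2)] assms(4)
  by (auto simp: hom_def)

lemma pair_cat_is_category: "category XY"
proof
  fix k assume "k \<in> Arr XY"
  then obtain m n where *: "k = pair m n" "m \<in> Arr X" "n \<in> Arr Y"
      "\<And>C F G. (C, F, G) \<in> R \<Longrightarrow> Amap F m = Amap G n"
    by (rule pair_ArrE) blast
  show "Dom XY k \<in> Obj XY" "Cod XY k \<in> Obj XY"
    using * matched_Dom_Cod[OF X.arr_hom Y.arr_hom]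
    by (auto simp: pair_cat_simps pair_Obj X.Dom_in Y.Dom_in X.Cod_in Y.Cod_in)
next
  fix z assume "z \<in> Obj XY"
  then obtain x y where *: "z = pair x y" "x \<in> Obj X" "y \<in> Obj Y"
      "\<And>C F G. (C, F, G) \<in> R \<Longrightarrow> Omap F x = Omap G y"
    by (rule pair_ObjE) blast
  have "Amap F (Ident X x) = Amap G (Ident Y y)" if "(C, F, G) \<in> R" for C F G
    using is_functor.Amap_Ident[OF left_functor[OF that] *(2)]
      is_functor.Amap_Ident[OF right_functor[OF that] *(3)] *(4)[OF that] by simp
  then show "Ident XY z \<in> hom XY z z"
    using * X.Ident_in Y.Ident_in by (auto simp: pair_cat_simps pair_hom)
next
  fix k l z z' z'' assume "k \<in> hom XY z z'" "l \<in> hom XY z' z''"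
  then obtain m n m' n' x y x' y' x'' y'' where
    *: "k = pair m n" "l = pair m' n'" "z = pair x y" "z' = pair x' y'" "z'' = pair x'' y''"
      "m \<in> hom X x x'" "n \<in> hom Y y y'" "m' \<in> hom X x' x''" "n' \<in> hom Y y' y''"
      "\<And>C F G. (C, F, G) \<in> R \<Longrightarrow> Amap F m = Amap G n"
      "\<And>C F G. (C, F, G) \<in> R \<Longrightarrow> Amap F m' = Amap G n'"
    by (elim pair_homE) (metis pair_eq_iff)
  have "Amap F (Comp X m' m) = Amap G (Comp Y n' n)" if "(C, F, G) \<in> R" for C F G
    using is_functor.Amap_Comp[OF left_functor[OF that] *(6,8)]
      is_functor.Amap_Comp[OF right_functor[OF that] *(7,9)] *(10,11)[OF that] by simp
  then show "Comp XY l k \<in> hom XY z z''"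
    using * X.Comp_in Y.Comp_in by (auto simp: pair_cat_simps pair_hom)
next
  fix k z z' assume "k \<in> hom XY z z'"
  then show "Comp XY (Ident XY z') k = k" "Comp XY k (Ident XY z) = k"
    by (elim pair_homE, simp add: pair_cat_simps X.Ident_left Y.Ident_left X.Ident_right Y.Ident_right)+
next
  fix j k l w x y z assume "j \<in> hom XY w x" "k \<in> hom XY x y" "l \<in> hom XY y z"
  then show "Comp XY l (Comp XY k j) = Comp XY (Comp XY l k) j"
    by (elim pair_homE) (auto simp add: pair_cat_simps X.Comp_assoc Y.Comp_assoc)
qed

definition pleft :: "('u, 'u, 'u, 'u) func" where
  "pleft = \<lparr>Omap = \<lambda>z\<in>Obj XY. pfst z, Amap = \<lambda>k\<in>Arr XY. pfst k\<rparr>"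

definition pright :: "('u, 'u, 'u, 'u) func" where
  "pright = \<lparr>Omap = \<lambda>z\<in>Obj XY. psnd z, Amap = \<lambda>k\<in>Arr XY. psnd k\<rparr>"

lemma proj_simps:
  "pair x y \<in> Obj XY \<Longrightarrow> Omap pleft (pair x y) = x"
  "pair m n \<in> Arr XY \<Longrightarrow> Amap pleft (pair m n) = m"
  "pair x y \<in> Obj XY \<Longrightarrow> Omap pright (pair x y) = y"
  "pair m n \<in> Arr XY \<Longrightarrow> Amap pright (pair m n) = n"
  by (simp_all add: pleft_def pright_def)

lemma proj_functors: "is_functor XY X pleft" "is_functor XY Y pright"
proof -
  interpret XY: category XY by (rule pair_cat_is_category)
  have in1: "k \<in> hom XY z z' \<Longrightarrow> z \<in> Obj XY \<and> z' \<in> Obj XY \<and> k \<in> Arr XY" for k z z'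
    using XY.hom_objs by (blast dest: homD)
  show "is_functor XY X pleft"
  proof
    show "Omap pleft \<in> Obj XY \<rightarrow>\<^sub>E Obj X" by (auto simp: pleft_def pair_Obj elim!: pair_ObjE)
    show "Amap pleft \<in> extensional (Arr XY)" by (simp add: pleft_def)
  next
    fix k z z' assume k: "k \<in> hom XY z z'"
    with in1[OF k] show "Amap pleft k \<in> hom X (Omap pleft z) (Omap pleft z')"
      by (auto simp: proj_simps elim!: pair_homE)
  next
    fix z assume z: "z \<in> Obj XY"
    then obtain x y where "z = pair x y" by (rule pair_ObjE)
    with z homD(1)[OF XY.Ident_in[OF z]] show "Amap pleft (Ident XY z) = Ident X (Omap pleft z)"
      by (auto simp: pair_cat_simps proj_simps)
  next
    fix k l z z' z'' assume kl: "k \<in> hom XY z z'" "l \<in> hom XY z' z''"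
    with homD(1)[OF XY.Comp_in[OF kl]] in1[OF kl(1)] in1[OF kl(2)]
    show "Amap pleft (Comp XY l k) = Comp X (Amap pleft l) (Amap pleft k)"
      by (elim pair_homE) (auto simp: pair_cat_simps proj_simps)
  qed
  show "is_functor XY Y pright"
  proof
    show "Omap pright \<in> Obj XY \<rightarrow>\<^sub>E Obj Y" by (auto simp: pright_def pair_Obj elim!: pair_ObjE)
    show "Amap pright \<in> extensional (Arr XY)" by (simp add: pright_def)
  next
    fix k z z' assume k: "k \<in> hom XY z z'"
    with in1[OF k] show "Amap pright k \<in> hom Y (Omap pright z) (Omap pright z')"
      by (auto simp: proj_simps elim!: pair_homE)
  next
    fix z assume z: "z \<in> Obj XY"
    then obtain x y where "z = pair x y" by (rule pair_ObjE)
    with z homD(1)[OF XY.Ident_in[OF z]] show "Amap pright (Ident XY z) = Ident Y (Omap pright z)"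
      by (auto simp: pair_cat_simps proj_simps)
  next
    fix k l z z' z'' assume kl: "k \<in> hom XY z z'" "l \<in> hom XY z' z''"
    with homD(1)[OF XY.Comp_in[OF kl]] in1[OF kl(1)] in1[OF kl(2)]
    show "Amap pright (Comp XY l k) = Comp Y (Amap pright l) (Amap pright k)"
      by (elim pair_homE) (auto simp: pair_cat_simps proj_simps)
  qed
qed

end

definition pair_map :: "('u::infinite, 'u) category \<Rightarrow> ('u, 'u, 'u, 'u) func \<Rightarrow> ('u, 'u, 'u, 'u) func \<Rightarrow>
    ('u, 'u, 'u, 'u) func" where
  "pair_map A F G = \<lparr>Omap = \<lambda>z\<in>Obj A. pair (Omap F (pfst z)) (Omap G (psnd z)),
    Amap = \<lambda>k\<in>Arr A. pair (Amap F (pfst k)) (Amap G (psnd k))\<rparr>"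

lemma pair_map_simps:
  "pair x y \<in> Obj A \<Longrightarrow> Omap (pair_map A F G) (pair x y) = pair (Omap F x) (Omap G y)"
  "pair m n \<in> Arr A \<Longrightarrow> Amap (pair_map A F G) (pair m n) = pair (Amap F m) (Amap G n)"
  by (simp_all add: pair_map_def)

lemma pair_map_functor:
  assumes "cospans X Y R" "cospans X' Y' R'" "is_functor X X' F" "is_functor Y Y' G"
    and O: "\<And>x y. pair x y \<in> Obj (pair_cat X Y R) \<Longrightarrow> pair (Omap F x) (Omap G y) \<in> Obj (pair_cat X' Y' R')"
    and A: "\<And>m n. pair m n \<in> Arr (pair_cat X Y R) \<Longrightarrow> pair (Amap F m) (Amap G n) \<in> Arr (pair_cat X' Y' R')"
  shows "is_functor (pair_cat X Y R) (pair_cat X' Y' R') (pair_map (pair_cat X Y R) F G)" (is "is_functor ?D ?D' ?H")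
proof -
  interpret R: cospans X Y R by fact
  interpret R': cospans X' Y' R' by fact
  interpret F: is_functor X X' F by fact
  interpret G: is_functor Y Y' G by fact
  interpret D: category ?D by (rule R.pair_cat_is_category)
  interpret D': category ?D' by (rule R'.pair_cat_is_category)
  have in1: "k \<in> hom ?D z z' \<Longrightarrow> z \<in> Obj ?D \<and> z' \<in> Obj ?D \<and> k \<in> Arr ?D" for k z z'
    using D.hom_objs by (blast dest: homD)
  show ?thesis
  proof
    show "Omap ?H \<in> Obj ?D \<rightarrow>\<^sub>E Obj ?D'"
      using O by (auto simp: pair_map_def) (metis pair_ObjE pfst_pair psnd_pair)
    show "Amap ?H \<in> extensional (Arr ?D)" by (simp add: pair_map_def)
  next
    fix k z z' assume k: "k \<in> hom ?D z z'"
    obtain m n x y x' y' where *: "k = pair m n" "z = pair x y" "z' = pair x' y'"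
      "m \<in> hom X x x'" "n \<in> hom Y y y'" using k by (rule pair_homE) blast
    show "Amap ?H k \<in> hom ?D' (Omap ?H z) (Omap ?H z')"
      using * in1[OF k] A[of m n] F.Amap_in[OF *(4)] G.Amap_in[OF *(5)]
      by (auto simp: pair_map_simps pair_hom pair_Arr)
  next
    fix z assume z: "z \<in> Obj ?D"
    then obtain x y where "z = pair x y" "x \<in> Obj X" "y \<in> Obj Y" by (rule pair_ObjE)
    with z homD(1)[OF D.Ident_in[OF z]] show "Amap ?H (Ident ?D z) = Ident ?D' (Omap ?H z)"
      by (auto simp: pair_cat_simps pair_map_simps F.Amap_Ident G.Amap_Ident)
  next
    fix k l z z' z'' assume kl: "k \<in> hom ?D z z'" "l \<in> hom ?D z' z''"
    with homD(1)[OF D.Comp_in[OF kl]] in1[OF kl(1)] in1[OF kl(2)]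
    show "Amap ?H (Comp ?D l k) = Comp ?D' (Amap ?H l) (Amap ?H k)"
      by (elim pair_homE) (auto simp: pair_cat_simps pair_map_simps F.Amap_Comp G.Amap_Comp)
  qed
qed

section \<open>Pullbacks of categories elementwise\<close>

lemma Cat_pullback_functors:
  assumes "Cat_pullback P A B C p q f g"
  shows "is_functor P A p" "is_functor P B q" "is_functor A C f" "is_functor B C g"
  using assms by (simp_all add: is_pullback_def)

lemma Cat_pullback_comm:
  assumes "Cat_pullback P A B C p q f g"
  shows "x \<in> Obj P \<Longrightarrow> Omap f (Omap p x) = Omap g (Omap q x)"
    "m \<in> Arr P \<Longrightarrow> Amap f (Amap p m) = Amap g (Amap q m)"
  using assms by (simp_all add: is_pullback_def func_comp_eq_iff)

text \<open>The category of matched pairs is a cone over the cospan. The functor \<open>r\<close>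
  that it induces into \<open>P\<close> sends each matched pair to the required element.\<close>

lemma Cat_pullback_ex:
  fixes P :: "('u::infinite, 'u) category"
  assumes pb: "Cat_pullback P A B C p q f g"
  shows "a \<in> Obj A \<Longrightarrow> b \<in> Obj B \<Longrightarrow> Omap f a = Omap g b \<Longrightarrow>
      \<exists>x\<in>Obj P. Omap p x = a \<and> Omap q x = b"
    and "m \<in> Arr A \<Longrightarrow> n \<in> Arr B \<Longrightarrow> Amap f m = Amap g n \<Longrightarrow>
      \<exists>k\<in>Arr P. Amap p k = m \<and> Amap q k = n"
proof -
  interpret p: is_functor P A p using pb by (rule Cat_pullback_functors)
  interpret q: is_functor P B q using pb by (rule Cat_pullback_functors)
  interpret R: cospans A B "{(C, f, g)}"
    by (rule cospans.intro[OF p.B.category_axioms q.B.category_axioms])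
      (use Cat_pullback_functors[OF pb] in \<open>auto simp: cospans_axioms_def\<close>)
  have "func_comp R.XY f R.pleft = func_comp R.XY g R.pright"
    by (auto simp: func_comp_eq_iff R.proj_simps pair_Obj pair_Arr elim!: pair_ObjE pair_ArrE)
  then obtain r where r: "is_functor R.XY P r"
      "func_comp R.XY p r = R.pleft" "func_comp R.XY q r = R.pright"
    using pb R.pair_cat_is_category R.proj_functors unfolding is_pullback_def by metis
  interpret r: is_functor R.XY P r by fact
  { assume "a \<in> Obj A" "b \<in> Obj B" "Omap f a = Omap g b"
    then have ab: "pair a b \<in> Obj R.XY" by (simp add: pair_Obj)
    then show "\<exists>x\<in>Obj P. Omap p x = a \<and> Omap q x = b"
      using func_comp_simps(1)[OF ab, of p r] func_comp_simps(1)[OF ab, of q r] r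
        R.proj_simps(1,3)[OF ab] by (intro bexI[OF _ r.Omap_Obj[OF ab]]) simp }
  { assume "m \<in> Arr A" "n \<in> Arr B" "Amap f m = Amap g n"
    then have mn: "pair m n \<in> Arr R.XY" by (simp add: pair_Arr)
    then show "\<exists>k\<in>Arr P. Amap p k = m \<and> Amap q k = n"
      using func_comp_simps(2)[OF mn, of p r] func_comp_simps(2)[OF mn, of q r] r
        R.proj_simps(2,4)[OF mn] by (intro bexI[OF _ r.Amap_Arr[OF mn]]) simp }
qed

text \<open>The test object is the kernel pair of \<open>(p, q)\<close>: pairs in \<open>P\<close>
  with equal images under both. Its two projections mediate the same cone, so uniqueness identifies
  them.\<close>

lemma Cat_pullback_eq:
  fixes P :: "('u::infinite, 'u) category"
  assumes pb: "Cat_pullback P A B C p q f g"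
  shows "x \<in> Obj P \<Longrightarrow> x' \<in> Obj P \<Longrightarrow> Omap p x = Omap p x' \<Longrightarrow> Omap q x = Omap q x' \<Longrightarrow> x = x'"
    and "m \<in> Arr P \<Longrightarrow> m' \<in> Arr P \<Longrightarrow> Amap p m = Amap p m' \<Longrightarrow> Amap q m = Amap q m' \<Longrightarrow> m = m'"
proof -
  interpret p: is_functor P A p using pb by (rule Cat_pullback_functors)
  interpret q: is_functor P B q using pb by (rule Cat_pullback_functors)
  interpret R: cospans P P "{(A, p, p), (B, q, q)}"
    by (rule cospans.intro[OF p.A.category_axioms p.A.category_axioms])
      (use Cat_pullback_functors[OF pb] in \<open>auto simp: cospans_axioms_def\<close>)
  note fs = Cat_pullback_functors[OF pb] R.proj_functors
  have e: "func_comp R.XY p R.pleft = func_comp R.XY p R.pright"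
    "func_comp R.XY q R.pleft = func_comp R.XY q R.pright"
    by (auto simp: func_comp_eq_iff R.proj_simps pair_Obj pair_Arr elim!: pair_ObjE pair_ArrE)
  have c: "func_comp R.XY f (func_comp R.XY p R.pleft) = func_comp R.XY g (func_comp R.XY q R.pleft)"
    by (auto simp: func_comp_eq_iff func_comp_simps Cat_pullback_comm[OF pb]
      is_functor.Omap_Obj[OF fs(5)] is_functor.Amap_Arr[OF fs(5)])
  have u: "\<exists>!r. is_functor R.XY P r \<and> func_comp R.XY p r = func_comp R.XY p R.pleft \<and>
      func_comp R.XY q r = func_comp R.XY q R.pleft"
    using pb R.pair_cat_is_category func_comp_functor[OF fs(5) fs(1)] func_comp_functor[OF fs(5) fs(2)] c
    unfolding is_pullback_def by blast
  have eq: "R.pleft = R.pright"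
    using u R.proj_functors e by auto
  { assume "x \<in> Obj P" "x' \<in> Obj P" "Omap p x = Omap p x'" "Omap q x = Omap q x'"
    then have ab: "pair x x' \<in> Obj R.XY" by (simp add: pair_Obj)
    then show "x = x'" using R.proj_simps(1,3)[OF ab] eq by simp }
  { assume "m \<in> Arr P" "m' \<in> Arr P" "Amap p m = Amap p m'" "Amap q m = Amap q m'"
    then have ab: "pair m m' \<in> Arr R.XY" by (simp add: pair_Arr)
    then show "m = m'" using R.proj_simps(2,4)[OF ab] eq by simp }
qed

text \<open>The mediating functor is chosen element by element. Joint injectivity of
  \<open>p\<close> and \<open>q\<close> forces these choices to respect ends, identities and
  composites, and makes the functor unique.\<close>

lemma Cat_pullbackI:
  assumes fs: "is_functor P A p" "is_functor P B q" "is_functor A C f" "is_functor B C g"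
    and comm: "\<And>x. x \<in> Obj P \<Longrightarrow> Omap f (Omap p x) = Omap g (Omap q x)"
      "\<And>m. m \<in> Arr P \<Longrightarrow> Amap f (Amap p m) = Amap g (Amap q m)"
    and O: "\<And>a b. a \<in> Obj A \<Longrightarrow> b \<in> Obj B \<Longrightarrow> Omap f a = Omap g b \<Longrightarrow>
      \<exists>x\<in>Obj P. Omap p x = a \<and> Omap q x = b"
      "\<And>x x'. x \<in> Obj P \<Longrightarrow> x' \<in> Obj P \<Longrightarrow> Omap p x = Omap p x' \<Longrightarrow> Omap q x = Omap q x' \<Longrightarrow> x = x'"
    and A: "\<And>m n. m \<in> Arr A \<Longrightarrow> n \<in> Arr B \<Longrightarrow> Amap f m = Amap g n \<Longrightarrow>
      \<exists>k\<in>Arr P. Amap p k = m \<and> Amap q k = n"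
      "\<And>m m'. m \<in> Arr P \<Longrightarrow> m' \<in> Arr P \<Longrightarrow> Amap p m = Amap p m' \<Longrightarrow> Amap q m = Amap q m' \<Longrightarrow> m = m'"
  shows "Cat_pullback P A B C p q f g"
proof -
  interpret p: is_functor P A p by fact
  interpret q: is_functor P B q by fact
  interpret f: is_functor A C f by fact
  interpret g: is_functor B C g by fact
  have "\<exists>!r. is_functor T P r \<and> func_comp T p r = a \<and> func_comp T q r = b"
    if T: "is_functor T A a" "is_functor T B b" and c: "func_comp T f a = func_comp T g b" for T a b
  proof -
    interpret a: is_functor T A a by fact
    interpret b: is_functor T B b by fact
    define ro where "ro x = (SOME z. z \<in> Obj P \<and> Omap p z = Omap a x \<and> Omap q z = Omap b x)" for x
    define ra where "ra m = (SOME k. k \<in> Arr P \<and> Amap p k = Amap a m \<and> Amap q k = Amap b m)" for m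
    have ro: "ro x \<in> Obj P \<and> Omap p (ro x) = Omap a x \<and> Omap q (ro x) = Omap b x" if "x \<in> Obj T" for x
      unfolding ro_def
      by (rule someI_ex) (use O(1)[of "Omap a x" "Omap b x"] that c a.Omap_Obj b.Omap_Obj in
        \<open>auto simp: func_comp_eq_iff\<close>)
    have ra: "ra m \<in> Arr P \<and> Amap p (ra m) = Amap a m \<and> Amap q (ra m) = Amap b m" if "m \<in> Arr T" for m
      unfolding ra_def
      by (rule someI_ex) (use A(1)[of "Amap a m" "Amap b m"] that c a.Amap_Arr b.Amap_Arr in
        \<open>auto simp: func_comp_eq_iff\<close>)
    have ra_hom: "ra m \<in> hom P (ro x) (ro y)" if m: "m \<in> hom T x y" for m x y
    proof -
      have T: "m \<in> Arr T" "x \<in> Obj T" "y \<in> Obj T" using homD[OF m] a.A.hom_objs[OF m] by auto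
      have "Dom P (ra m) = ro x"
        by (rule O(2)) (use T ra[OF T(1)] ro[OF T(2)] p.Dom_Amap[of "ra m"] q.Dom_Amap[of "ra m"]
          a.Amap_in[OF m] b.Amap_in[OF m] p.A.Dom_in in \<open>auto simp: hom_def\<close>)
      moreover have "Cod P (ra m) = ro y"
        by (rule O(2)) (use T ra[OF T(1)] ro[OF T(3)] p.Cod_Amap[of "ra m"] q.Cod_Amap[of "ra m"]
          a.Amap_in[OF m] b.Amap_in[OF m] p.A.Cod_in in \<open>auto simp: hom_def\<close>)
      ultimately show ?thesis using ra[OF T(1)] by (simp add: hom_def)
    qed
    define r where "r = \<lparr>Omap = \<lambda>x\<in>Obj T. ro x, Amap = \<lambda>m\<in>Arr T. ra m\<rparr>"
    have rf: "is_functor T P r"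
    proof
      show "Omap r \<in> Obj T \<rightarrow>\<^sub>E Obj P" using ro by (auto simp: r_def)
      show "Amap r \<in> extensional (Arr T)" by (simp add: r_def)
    next
      fix m x y assume m: "m \<in> hom T x y"
      with ra_hom[OF m] show "Amap r m \<in> hom P (Omap r x) (Omap r y)"
        using a.A.hom_objs[OF m] by (simp add: r_def homD)
    next
      fix x assume x: "x \<in> Obj T"
      have "ra (Ident T x) = Ident P (ro x)"
        by (rule A(2)) (use x ra ro a.A.Ident_in[OF x] homD(1)[OF p.A.Ident_in] in
          \<open>auto simp: homD p.Amap_Ident q.Amap_Ident a.Amap_Ident b.Amap_Ident\<close>)
      with x a.A.Ident_in[OF x] show "Amap r (Ident T x) = Ident P (Omap r x)"
        by (simp add: r_def homD)
    next
      fix m n x y z assume mn: "m \<in> hom T x y" "n \<in> hom T y z"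
      note c = a.A.Comp_in[OF mn]
      have "ra (Comp T n m) = Comp P (ra n) (ra m)"
        by (rule A(2)) (use ra[OF homD(1)[OF mn(1)]] ra[OF homD(1)[OF mn(2)]] ra[OF homD(1)[OF c]]
          homD(1)[OF p.A.Comp_in[OF ra_hom[OF mn(1)] ra_hom[OF mn(2)]]] in
          \<open>auto simp: p.Amap_Comp[OF ra_hom[OF mn(1)] ra_hom[OF mn(2)]]
            q.Amap_Comp[OF ra_hom[OF mn(1)] ra_hom[OF mn(2)]] a.Amap_Comp[OF mn] b.Amap_Comp[OF mn]\<close>)
      then show "Amap r (Comp T n m) = Comp P (Amap r n) (Amap r m)"
        using mn c by (simp add: r_def homD)
    qed
    show ?thesis
    proof (intro ex1I conjI)
      show "is_functor T P r" by (rule rf)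
      show "func_comp T p r = a" using T(1)
        by (rule func_comp_eqI) (use ro ra in \<open>auto simp: r_def\<close>)
      show "func_comp T q r = b" using T(2)
        by (rule func_comp_eqI) (use ro ra in \<open>auto simp: r_def\<close>)
    next
      fix r' assume r': "is_functor T P r' \<and> func_comp T p r' = a \<and> func_comp T q r' = b"
      interpret r': is_functor T P r' using r' by blast
      show "r' = r"
      proof (rule func_eqI[OF _ rf])
        fix x assume x: "x \<in> Obj T"
        show "Omap r' x = Omap r x"
          by (rule O(2)) (use x ro[OF x] r'.Omap_Obj[OF x] r' in
            \<open>auto simp: r_def func_comp_simps(1)[OF x]\<close>)
      next
        fix m assume m: "m \<in> Arr T"
        show "Amap r' m = Amap r m"
          by (rule A(2)) (use m ra[OF m] r'.Amap_Arr[OF m] r' in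
            \<open>auto simp: r_def func_comp_simps(2)[OF m]\<close>)
      qed (use r' in blast)
    qed
  qed
  moreover have "func_comp P f p = func_comp P g q" using comm by (simp add: func_comp_eq_iff)
  ultimately show ?thesis
    using fs p.A.category_axioms p.B.category_axioms q.B.category_axioms f.B.category_axioms
    unfolding is_pullback_def by blast
qed

section \<open>Crossed double categories elementwise\<close>

context simplicial_cat begin

lemma face_is_functor: "i \<le> Suc n \<Longrightarrow> is_functor (lev X (Suc n)) (lev X n) (face X n i)"
  using face_functor[of i n] by simp

lemma degen_is_functor: "i \<le> n \<Longrightarrow> is_functor (lev X n) (lev X (Suc n)) (degen X n i)"
  using degen_functor[of i n] by simp

lemma face_face_elem:
  assumes "i < j" "j \<le> Suc (Suc n)"
  shows "x \<in> Obj (lev X (Suc (Suc n))) \<Longrightarrow> Omap (face X n i) (Omap (face X (Suc n) j) x) =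
      Omap (face X n (j - 1)) (Omap (face X (Suc n) i) x)"
    "m \<in> Arr (lev X (Suc (Suc n))) \<Longrightarrow> Amap (face X n i) (Amap (face X (Suc n) j) m) =
      Amap (face X n (j - 1)) (Amap (face X (Suc n) i) m)"
  using face_face[of i j n] assms by (simp_all add: func_comp_eq_iff)

lemma degen_degen_elem:
  assumes "i \<le> j" "j \<le> n"
  shows "x \<in> Obj (lev X n) \<Longrightarrow> Omap (degen X (Suc n) i) (Omap (degen X n j) x) =
      Omap (degen X (Suc n) (Suc j)) (Omap (degen X n i) x)"
    "m \<in> Arr (lev X n) \<Longrightarrow> Amap (degen X (Suc n) i) (Amap (degen X n j) m) =
      Amap (degen X (Suc n) (Suc j)) (Amap (degen X n i) m)"
  using degen_degen[of i j n] assms by (simp_all add: func_comp_eq_iff)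

lemma face_degen_lt_elem:
  assumes "i < j" "j \<le> Suc n"
  shows "x \<in> Obj (lev X (Suc n)) \<Longrightarrow> Omap (face X (Suc n) i) (Omap (degen X (Suc n) j) x) =
      Omap (degen X n (j - 1)) (Omap (face X n i) x)"
    "m \<in> Arr (lev X (Suc n)) \<Longrightarrow> Amap (face X (Suc n) i) (Amap (degen X (Suc n) j) m) =
      Amap (degen X n (j - 1)) (Amap (face X n i) m)"
  using face_degen_lt[of i j n] assms by (simp_all add: func_comp_eq_iff)

lemma face_degen_id_elem:
  assumes "i = j \<or> i = Suc j" "j \<le> n"
  shows "x \<in> Obj (lev X n) \<Longrightarrow> Omap (face X n i) (Omap (degen X n j) x) = x"
    "m \<in> Arr (lev X n) \<Longrightarrow> Amap (face X n i) (Amap (degen X n j) m) = m"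
  using face_degen_id[of i j n] assms by (simp_all add: func_comp_eq_id_iff)

lemma face_degen_gt_elem:
  assumes "Suc j < i" "i \<le> Suc (Suc n)"
  shows "x \<in> Obj (lev X (Suc n)) \<Longrightarrow> Omap (face X (Suc n) i) (Omap (degen X (Suc n) j) x) =
      Omap (degen X n j) (Omap (face X n (i - 1)) x)"
    "m \<in> Arr (lev X (Suc n)) \<Longrightarrow> Amap (face X (Suc n) i) (Amap (degen X (Suc n) j) m) =
      Amap (degen X n j) (Amap (face X n (i - 1)) m)"
  using face_degen_gt[of j i n] assms by (simp_all add: func_comp_eq_iff)

end

context double_category begin

lemma segal_Suc: "Cat_pullback (lev X (Suc (Suc n))) (lev X (Suc n)) (lev X (Suc n)) (lev X n)
    (face X (Suc n) (Suc (Suc n))) (face X (Suc n) 0) (face X n 0) (face X n (Suc n))"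
  using segal[of n] by simp

end

context double_functor begin

lemma face_elem:
  assumes "i \<le> Suc n"
  shows "x \<in> Obj (lev X (Suc n)) \<Longrightarrow> Omap (f n) (Omap (face X n i) x) = Omap (face Y n i) (Omap (f (Suc n)) x)"
    "m \<in> Arr (lev X (Suc n)) \<Longrightarrow> Amap (f n) (Amap (face X n i) m) = Amap (face Y n i) (Amap (f (Suc n)) m)"
  using commutes_face[of i n] assms by (simp_all add: func_comp_eq_iff)

lemma degen_elem:
  assumes "i \<le> n"
  shows "x \<in> Obj (lev X n) \<Longrightarrow> Omap (f (Suc n)) (Omap (degen X n i) x) = Omap (degen Y n i) (Omap (f n) x)"
    "m \<in> Arr (lev X n) \<Longrightarrow> Amap (f (Suc n)) (Amap (degen X n i) m) = Amap (degen Y n i) (Amap (f n) m)"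
  using commutes_degen[of i n] assms by (simp_all add: func_comp_eq_iff)

end

text \<open>Double categories with a splitting of \<open>d_0\<close> that is not yet known to be
  compatible with \<open>s_0\<close> and \<open>d_1\<close>. The splitting of \<open>d_0^2\<close>
  already makes sense here, and matched pairs are shown to be crossed from this stage.\<close>

locale split_double_category = double_category X for X :: "('o, 'a) crossed_double_cat" +
  assumes splitting: "split_opfibration (lev X 1) (lev X 0) (face X 0 0) (lift X)"
begin

abbreviation "X0 \<equiv> lev X 0"
abbreviation "X1 \<equiv> lev X (Suc 0)"
abbreviation "X2 \<equiv> lev X (Suc (Suc 0))"
abbreviation "X3 \<equiv> lev X (Suc (Suc (Suc 0)))"
abbreviation "t \<equiv> face X 0 0"
abbreviation "s \<equiv> face X 0 (Suc 0)"
abbreviation "e0 \<equiv> face X (Suc 0) 0"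
abbreviation "e1 \<equiv> face X (Suc 0) (Suc 0)"
abbreviation "e2 \<equiv> face X (Suc 0) (Suc (Suc 0))"
abbreviation "i0 \<equiv> degen X 0 0"

sublocale X0: category X0 by (rule lev_category)
sublocale X1: category X1 by (rule lev_category)
sublocale X2: category X2 by (rule lev_category)

sublocale S: split_opfibration X1 X0 t "lift X"
  using splitting by simp

sublocale s: is_functor X1 X0 s by (rule face_is_functor) simp
sublocale e0: is_functor X2 X1 e0 by (rule face_is_functor) simp
sublocale e1: is_functor X2 X1 e1 by (rule face_is_functor) simp
sublocale e2: is_functor X2 X1 e2 by (rule face_is_functor) simp
sublocale i0: is_functor X0 X1 i0 by (rule degen_is_functor) simp

lemma faces_2:
  "x \<in> Obj X2 \<Longrightarrow> Omap t (Omap e1 x) = Omap t (Omap e0 x)"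
  "x \<in> Obj X2 \<Longrightarrow> Omap t (Omap e2 x) = Omap s (Omap e0 x)"
  "x \<in> Obj X2 \<Longrightarrow> Omap s (Omap e2 x) = Omap s (Omap e1 x)"
  "m \<in> Arr X2 \<Longrightarrow> Amap t (Amap e1 m) = Amap t (Amap e0 m)"
  "m \<in> Arr X2 \<Longrightarrow> Amap t (Amap e2 m) = Amap s (Amap e0 m)"
  "m \<in> Arr X2 \<Longrightarrow> Amap s (Amap e2 m) = Amap s (Amap e1 m)"
  using face_face_elem[of 0 "Suc 0" 0] face_face_elem[of 0 "Suc (Suc 0)" 0]
    face_face_elem[of "Suc 0" "Suc (Suc 0)" 0] by simp_all

lemma unit_faces:
  "x \<in> Obj X0 \<Longrightarrow> Omap t (Omap i0 x) = x" "x \<in> Obj X0 \<Longrightarrow> Omap s (Omap i0 x) = x"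
  "m \<in> Arr X0 \<Longrightarrow> Amap t (Amap i0 m) = m" "m \<in> Arr X0 \<Longrightarrow> Amap s (Amap i0 m) = m"
  using face_degen_id_elem[of 0 0 0] face_degen_id_elem[of "Suc 0" 0 0] by simp_all

lemma segal_0: "Cat_pullback X2 X1 X1 X0 e2 e0 t s"
  using segal_Suc[of 0] by simp

lemma lift_simps:
  assumes "h \<in> Obj X1" "u \<in> Arr X0" "Dom X0 u = Omap t h"
  shows "lift X h u \<in> Arr X1" "Dom X1 (lift X h u) = h" "Amap t (lift X h u) = u"
    "Omap t (Cod X1 (lift X h u)) = Cod X0 u" "lift X h u \<in> hom X1 h (Cod X1 (lift X h u))"
proof -
  have u: "u \<in> hom X0 (Omap t h) (Cod X0 u)" using assms by (simp add: hom_def)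
  show *: "lift X h u \<in> Arr X1" "Dom X1 (lift X h u) = h" "Amap t (lift X h u) = u"
    using S.lift_opcartesian[OF assms(1) u] S.lift_Dom[OF assms(1) u] S.lift_over[OF assms(1) u]
    by (simp_all add: opcartesian_def)
  then show "Omap t (Cod X1 (lift X h u)) = Cod X0 u" using S.Cod_Amap by metis
  show "lift X h u \<in> hom X1 h (Cod X1 (lift X h u))" using * by (simp add: hom_def)
qed

lemma lift_factor:
  assumes "h \<in> Obj X1" "u \<in> Arr X0" "Dom X0 u = Omap t h"
    and "m \<in> Arr X1" "Dom X1 m = h" "v \<in> hom X0 (Cod X0 u) (Omap t (Cod X1 m))" "Comp X0 v u = Amap t m"
  shows "\<exists>!n. n \<in> hom X1 (Cod X1 (lift X h u)) (Cod X1 m) \<and> Amap t n = v \<and> Comp X1 n (lift X h u) = m"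
proof -
  have u: "u \<in> hom X0 (Omap t h) (Cod X0 u)" using assms by (simp add: hom_def)
  show ?thesis
    using S.lift_opcartesian[OF assms(1) u] assms(4-7) lift_simps[OF assms(1-3)]
    by (simp add: opcartesian_def)
qed

lemma lift_2_unfold: "lift_2 X x u = (THE w. w \<in> Arr X2 \<and> Amap e0 w = lift X (Omap e0 x) u \<and>
    Amap e2 w = lift X (Omap e2 x) (Amap s (lift X (Omap e0 x) u)))"
  by (simp add: lift_2_def composite_lift_def pullback_lift_def numeral_2_eq_2)

end

locale universal_split_double_category = split_double_category X
  for X :: "('u::infinite, 'u) crossed_double_cat"
begin

lemma segal_ex:
  "x \<in> Obj X1 \<Longrightarrow> y \<in> Obj X1 \<Longrightarrow> Omap t x = Omap s y \<Longrightarrow> \<exists>z\<in>Obj X2. Omap e2 z = x \<and> Omap e0 z = y"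
  "m \<in> Arr X1 \<Longrightarrow> n \<in> Arr X1 \<Longrightarrow> Amap t m = Amap s n \<Longrightarrow> \<exists>k\<in>Arr X2. Amap e2 k = m \<and> Amap e0 k = n"
  using Cat_pullback_ex[OF segal_0] by blast+

lemma segal_eq:
  "z \<in> Obj X2 \<Longrightarrow> z' \<in> Obj X2 \<Longrightarrow> Omap e2 z = Omap e2 z' \<Longrightarrow> Omap e0 z = Omap e0 z' \<Longrightarrow> z = z'"
  "k \<in> Arr X2 \<Longrightarrow> k' \<in> Arr X2 \<Longrightarrow> Amap e2 k = Amap e2 k' \<Longrightarrow> Amap e0 k = Amap e0 k' \<Longrightarrow> k = k'"
  using Cat_pullback_eq[OF segal_0] by blast+

lemma lift_2_eqI:
  assumes "w \<in> Arr X2" "Amap e0 w = lift X (Omap e0 x) u"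
    "Amap e2 w = lift X (Omap e2 x) (Amap s (lift X (Omap e0 x) u))"
  shows "lift_2 X x u = w"
  unfolding lift_2_unfold by (rule the_equality) (use assms segal_eq(2) in auto)

text \<open>The back face \<open>e0 x\<close> is lifted first. The source side of that square is
  then lifted along the front face \<open>e2 x\<close>, so the two squares share a vertical side and
  are glued by the Segal condition.\<close>

lemma lift_2_ex:
  assumes x: "x \<in> Obj X2" and u: "u \<in> Arr X0" "Dom X0 u = Omap t (Omap e0 x)"
  obtains w where "w \<in> Arr X2" "Amap e0 w = lift X (Omap e0 x) u"
    "Amap e2 w = lift X (Omap e2 x) (Amap s (lift X (Omap e0 x) u))"
proof -
  note l = lift_simps[OF e0.Omap_Obj[OF x] u]
  have d: "Dom X0 (Amap s (lift X (Omap e0 x) u)) = Omap t (Omap e2 x)"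
    using l s.Dom_Amap faces_2(2)[OF x] by simp
  note l2 = lift_simps[OF e2.Omap_Obj[OF x] s.Amap_Arr[OF l(1)] d]
  show thesis using segal_ex(2)[OF l2(1) l(1) l2(3)] that by blast
qed

text \<open>The compatibility with \<open>d_1\<close> is asked of every \<open>w\<close> whose two
  outer faces are the prescribed lifts. This avoids the definite description inside
  \<open>lift_2\<close>, whose value is such a \<open>w\<close>.\<close>

lemma crossedI:
  assumes unit: "\<And>u. u \<in> Arr X0 \<Longrightarrow> Amap i0 u = lift X (Omap i0 (Dom X0 u)) u"
    and comp: "\<And>x u w. x \<in> Obj X2 \<Longrightarrow> u \<in> Arr X0 \<Longrightarrow> Dom X0 u = Omap t (Omap e0 x) \<Longrightarrow>
      w \<in> Arr X2 \<Longrightarrow> Amap e0 w = lift X (Omap e0 x) u \<Longrightarrow>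
      Amap e2 w = lift X (Omap e2 x) (Amap s (lift X (Omap e0 x) u)) \<Longrightarrow>
      Amap e1 w = lift X (Omap e1 x) u"
  shows "crossed_double_category X"
proof (intro crossed_double_category.intro crossed_double_category_axioms.intro)
  show "double_category X" by (rule double_category_axioms)
  show "split_opfibration (lev X 1) (lev X 0) (face X 0 0) (lift X)" by (rule splitting)
  show "split_opfibration_morphism (lev X 0) (lev X 0) (id_func (lev X 0)) (\<lambda>x u. u)
      (lev X 1) (lev X 0) (face X 0 0) (lift X) (degen X 0 0) (id_func (lev X 0))"
    using i0.is_functor_axioms id_functor[OF X0.category_axioms]
    by (auto simp: unit[symmetric] split_opfibration_morphism_def func_comp_eq_iff id_func_def unit_faces X0.Dom_in)
  have c: "Amap e1 (lift_2 X x u) = lift X (Omap e1 x) u"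
    if xu: "x \<in> Obj X2" "u \<in> Arr X0" "Dom X0 u = Omap t (Omap e0 x)" for x u
  proof -
    obtain w where "w \<in> Arr X2" "Amap e0 w = lift X (Omap e0 x) u"
      "Amap e2 w = lift X (Omap e2 x) (Amap s (lift X (Omap e0 x) u))"
      using lift_2_ex[OF xu] by blast
    then show ?thesis using comp[OF xu] lift_2_eqI by metis
  qed
  show "split_opfibration_morphism (lev X 2) (lev X 0)
      (func_comp (lev X 2) (face X 0 0) (face X 1 0)) (lift_2 X)
      (lev X 1) (lev X 0) (face X 0 0) (lift X) (face X 1 1) (id_func (lev X 0))"
    using c e1.is_functor_axioms id_functor[OF X0.category_axioms]
    by (auto simp: split_opfibration_morphism_def func_comp_eq_iff id_func_def func_comp_simps
      numeral_2_eq_2 faces_2 S.Omap_Obj e0.Omap_Obj S.Amap_Arr e0.Amap_Arr)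
qed

end

locale universal_crossed_double_category = crossed_double_category X
  for X :: "('u::infinite, 'u) crossed_double_cat"
begin

sublocale universal_split_double_category X
  by (intro universal_split_double_category.intro split_double_category.intro
    split_double_category_axioms.intro double_category_axioms split)

lemma lift_unit: "u \<in> Arr X0 \<Longrightarrow> lift X (Omap i0 (Dom X0 u)) u = Amap i0 u"
  using degen_morphism X0.Dom_in[of u]
  by (auto simp: split_opfibration_morphism_def id_func_def)

lemma lift_e1:
  assumes "x \<in> Obj X2" "u \<in> Arr X0" "Dom X0 u = Omap t (Omap e0 x)"
    "w \<in> Arr X2" "Amap e0 w = lift X (Omap e0 x) u"
    "Amap e2 w = lift X (Omap e2 x) (Amap s (lift X (Omap e0 x) u))"
  shows "lift X (Omap e1 x) u = Amap e1 w"
  using face_morphism assms(1-3) lift_2_eqI[OF assms(4-6)]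
  by (auto simp: split_opfibration_morphism_def id_func_def func_comp_simps numeral_2_eq_2)

end

lemma universal_crossedI: "crossed_double_category X \<Longrightarrow> universal_crossed_double_category X"
  by (simp add: universal_crossed_double_category_def)

text \<open>A double functor already commutes with \<open>d_0\<close>, so being a morphism of split
  opfibrations reduces to preserving the chosen lifts.\<close>

lemma crossed_double_functor_iff:
  "crossed_double_functor X Y f \<longleftrightarrow> crossed_double_category X \<and> crossed_double_category Y \<and>
    double_functor X Y f \<and>
    (\<forall>h\<in>Obj (lev X (Suc 0)). \<forall>u\<in>Arr (lev X 0). Dom (lev X 0) u = Omap (face X 0 0) h \<longrightarrow>
      Amap (f (Suc 0)) (lift X h u) = lift Y (Omap (f (Suc 0)) h) (Amap (f 0) u))" (is "?l \<longleftrightarrow> ?r")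
proof
  assume ?l
  then interpret crossed_double_functor X Y f .
  show ?r
    using X.crossed_double_category_axioms Y.crossed_double_category_axioms double_functor_axioms
      lift_morphism by (simp add: split_opfibration_morphism_def)
next
  assume r: ?r
  interpret double_functor X Y f using r by blast
  show ?l
    using r level_functor[of 0] level_functor[of "Suc 0"] face_elem[of 0 0]
    by (auto simp: crossed_double_functor_def crossed_double_functor_axioms_def
      split_opfibration_morphism_def func_comp_eq_iff)
qed

text \<open>Needed for the uniqueness half of pullbacks, where a projection of the kernel pair
  followed by \<open>p\<close> or \<open>q\<close> has to be a leg of a cone.\<close>

lemma crossed_double_functor_comp:
  assumes "crossed_double_functor X Y f" "crossed_double_functor Y Z g"
  shows "crossed_double_functor X Z (smap_comp X g f)"
proof -
  interpret f: crossed_double_functor X Y f by fact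
  interpret g: crossed_double_functor Y Z g by fact
  interpret X0: category "lev X 0" by (rule f.X.lev_category)
  interpret f0: is_functor "lev X 0" "lev Y 0" "f 0" by (rule f.level_functor)
  interpret f1: is_functor "lev X (Suc 0)" "lev Y (Suc 0)" "f (Suc 0)" by (rule f.level_functor)
  interpret XS: split_opfibration "lev X (Suc 0)" "lev X 0" "face X 0 0" "lift X"
    using f.X.split by simp
  note objs = is_functor.Omap_Obj[OF f.level_functor] is_functor.Amap_Arr[OF f.level_functor]
    is_functor.Omap_Obj[OF f.X.face_is_functor] is_functor.Amap_Arr[OF f.X.face_is_functor]
    is_functor.Omap_Obj[OF f.X.degen_is_functor] is_functor.Amap_Arr[OF f.X.degen_is_functor]
  have "double_functor X Z (smap_comp X g f)"
  proof (intro double_functor.intro double_functor_axioms.intro)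
    show "double_category X" "double_category Z"
      by (rule f.X.double_category_axioms g.Y.double_category_axioms)+
    show "is_functor (lev X n) (lev Z n) (smap_comp X g f n)" for n
      unfolding smap_comp_def by (rule func_comp_functor[OF f.level_functor g.level_functor])
    show "func_comp (lev X (n + 1)) (smap_comp X g f n) (face X n i) =
        func_comp (lev X (n + 1)) (face Z n i) (smap_comp X g f (n + 1))" if "i \<le> n + 1" for i n
      using that by (auto simp: func_comp_eq_iff smap_comp_def func_comp_simps objs f.face_elem g.face_elem)
    show "func_comp (lev X n) (smap_comp X g f (n + 1)) (degen X n i) =
        func_comp (lev X n) (degen Z n i) (smap_comp X g f n)" if "i \<le> n" for i n
      using that by (auto simp: func_comp_eq_iff smap_comp_def func_comp_simps objs f.degen_elem g.degen_elem)
  qed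
  moreover have "Amap (smap_comp X g f (Suc 0)) (lift X h u) =
      lift Z (Omap (smap_comp X g f (Suc 0)) h) (Amap (smap_comp X g f 0) u)"
    if hu: "h \<in> Obj (lev X (Suc 0))" "u \<in> Arr (lev X 0)" "Dom (lev X 0) u = Omap (face X 0 0) h" for h u
  proof -
    have u: "u \<in> hom (lev X 0) (Omap (face X 0 0) h) (Cod (lev X 0) u)" using hu by (simp add: hom_def)
    have "lift X h u \<in> Arr (lev X (Suc 0))"
      using XS.lift_opcartesian[OF hu(1) u] by (simp add: opcartesian_def)
    moreover have "Dom (lev Y 0) (Amap (f 0) u) = Omap (face Y 0 0) (Omap (f (Suc 0)) h)"
      using hu f0.Dom_Amap f.face_elem(1)[of 0 0 h] by simp
    ultimately show ?thesis
      using hu assms f0.Amap_Arr[of u] f1.Omap_Obj[of h]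
      by (simp add: smap_comp_def func_comp_simps crossed_double_functor_iff)
  qed
  ultimately show ?thesis
    using assms by (simp add: crossed_double_functor_iff)
qed

section \<open>Pullbacks of crossed double categories elementwise\<close>

type_synonym ('o, 'a) crossed_cospan =
  "('o, 'a) crossed_double_cat \<times> ('o, 'a) simplicial_map \<times> ('o, 'a) simplicial_map"

text \<open>As for plain categories, one construction serves two tests: a single cospan for
  existence, and the two cospans \<open>(p, p)\<close> and \<open>(q, q)\<close> for
  uniqueness.\<close>

locale crossed_cospans =
  fixes X Y :: "('u::infinite, 'u) crossed_double_cat" and S :: "('u, 'u) crossed_cospan set"
  assumes X_crossed: "crossed_double_category X" and Y_crossed: "crossed_double_category Y"
    and left_functor: "(C, f, g) \<in> S \<Longrightarrow> crossed_double_functor X C f"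
    and right_functor: "(C, f, g) \<in> S \<Longrightarrow> crossed_double_functor Y C g"
begin

sublocale X: universal_crossed_double_category X by (rule universal_crossedI[OF X_crossed])
sublocale Y: universal_crossed_double_category Y by (rule universal_crossedI[OF Y_crossed])

abbreviation "R n \<equiv> (\<lambda>(C, f, g). (lev C n, f n, g n)) ` S"
abbreviation "L n \<equiv> pair_cat (lev X n) (lev Y n) (R n)"

definition XY :: "('u, 'u) crossed_double_cat" where
  "XY = \<lparr>lev = L,
    face = \<lambda>n i. pair_map (L (Suc n)) (face X n i) (face Y n i),
    degen = \<lambda>n i. pair_map (L n) (degen X n i) (degen Y n i),
    lift = \<lambda>z k. pair (lift X (pfst z) (pfst k)) (lift Y (psnd z) (psnd k))\<rparr>"

lemma double_functors:
  assumes "(C, f, g) \<in> S"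
  shows "double_functor X C f" "double_functor Y C g"
  using left_functor[OF assms] right_functor[OF assms] by (simp_all add: crossed_double_functor_iff)

sublocale R: cospans "lev X n" "lev Y n" "R n" for n
  by (intro cospans.intro cospans_axioms.intro X.lev_category Y.lev_category)
    (auto dest: double_functors intro: double_functor.level_functor)

lemma L_Obj: "pair x y \<in> Obj (L n) \<longleftrightarrow>
    x \<in> Obj (lev X n) \<and> y \<in> Obj (lev Y n) \<and> (\<forall>(C, f, g) \<in> S. Omap (f n) x = Omap (g n) y)"
  by (auto simp: pair_Obj)

lemma L_Arr: "pair k l \<in> Arr (L n) \<longleftrightarrow>
    k \<in> Arr (lev X n) \<and> l \<in> Arr (lev Y n) \<and> (\<forall>(C, f, g) \<in> S. Amap (f n) k = Amap (g n) l)"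
  by (auto simp: pair_Arr)

lemma face_closed:
  assumes i: "i \<le> Suc n"
  shows "pair x y \<in> Obj (L (Suc n)) \<Longrightarrow> pair (Omap (face X n i) x) (Omap (face Y n i) y) \<in> Obj (L n)"
    "pair k l \<in> Arr (L (Suc n)) \<Longrightarrow> pair (Amap (face X n i) k) (Amap (face Y n i) l) \<in> Arr (L n)"
proof -
  interpret FX: is_functor "lev X (Suc n)" "lev X n" "face X n i" using i by (rule X.face_is_functor)
  interpret FY: is_functor "lev Y (Suc n)" "lev Y n" "face Y n i" using i by (rule Y.face_is_functor)
  note c = double_functor.face_elem[OF double_functors(1) i] double_functor.face_elem[OF double_functors(2) i]
  show "pair x y \<in> Obj (L (Suc n)) \<Longrightarrow> pair (Omap (face X n i) x) (Omap (face Y n i) y) \<in> Obj (L n)"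
    unfolding L_Obj by (auto simp: FX.Omap_Obj FY.Omap_Obj c split: prod.splits)
  show "pair k l \<in> Arr (L (Suc n)) \<Longrightarrow> pair (Amap (face X n i) k) (Amap (face Y n i) l) \<in> Arr (L n)"
    unfolding L_Arr by (auto simp: FX.Amap_Arr FY.Amap_Arr c split: prod.splits)
qed

lemma degen_closed:
  assumes i: "i \<le> n"
  shows "pair x y \<in> Obj (L n) \<Longrightarrow> pair (Omap (degen X n i) x) (Omap (degen Y n i) y) \<in> Obj (L (Suc n))"
    "pair k l \<in> Arr (L n) \<Longrightarrow> pair (Amap (degen X n i) k) (Amap (degen Y n i) l) \<in> Arr (L (Suc n))"
proof -
  interpret FX: is_functor "lev X n" "lev X (Suc n)" "degen X n i" using i by (rule X.degen_is_functor)
  interpret FY: is_functor "lev Y n" "lev Y (Suc n)" "degen Y n i" using i by (rule Y.degen_is_functor)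
  note c = double_functor.degen_elem[OF double_functors(1) i] double_functor.degen_elem[OF double_functors(2) i]
  show "pair x y \<in> Obj (L n) \<Longrightarrow> pair (Omap (degen X n i) x) (Omap (degen Y n i) y) \<in> Obj (L (Suc n))"
    unfolding L_Obj by (auto simp: FX.Omap_Obj FY.Omap_Obj c split: prod.splits)
  show "pair k l \<in> Arr (L n) \<Longrightarrow> pair (Amap (degen X n i) k) (Amap (degen Y n i) l) \<in> Arr (L (Suc n))"
    unfolding L_Arr by (auto simp: FX.Amap_Arr FY.Amap_Arr c split: prod.splits)
qed

lemma lev_XY: "lev XY n = L n"
  by (simp add: XY_def)

lemma face_XY:
  "pair x y \<in> Obj (L (Suc n)) \<Longrightarrow>
    Omap (face XY n i) (pair x y) = pair (Omap (face X n i) x) (Omap (face Y n i) y)"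
  "pair k l \<in> Arr (L (Suc n)) \<Longrightarrow>
    Amap (face XY n i) (pair k l) = pair (Amap (face X n i) k) (Amap (face Y n i) l)"
  by (simp_all add: XY_def pair_map_simps)

lemma degen_XY:
  "pair x y \<in> Obj (L n) \<Longrightarrow>
    Omap (degen XY n i) (pair x y) = pair (Omap (degen X n i) x) (Omap (degen Y n i) y)"
  "pair k l \<in> Arr (L n) \<Longrightarrow>
    Amap (degen XY n i) (pair k l) = pair (Amap (degen X n i) k) (Amap (degen Y n i) l)"
  by (simp_all add: XY_def pair_map_simps)

lemma lift_XY: "lift XY (pair x y) (pair k l) = pair (lift X x k) (lift Y y l)"
  by (simp add: XY_def)

lemma face_XY_functor: "i \<le> Suc n \<Longrightarrow> is_functor (L (Suc n)) (L n) (face XY n i)"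
  unfolding XY_def by simp (rule pair_map_functor, simp_all add: R.cospans_axioms X.face_is_functor
    Y.face_is_functor face_closed)

lemma degen_XY_functor: "i \<le> n \<Longrightarrow> is_functor (L n) (L (Suc n)) (degen XY n i)"
  unfolding XY_def by simp (rule pair_map_functor, simp_all add: R.cospans_axioms X.degen_is_functor
    Y.degen_is_functor degen_closed)

lemma L_func_comp_eqI:
  assumes "\<And>x y. pair x y \<in> Obj (L n) \<Longrightarrow> Omap G (Omap F (pair x y)) = Omap G' (Omap F' (pair x y))"
    "\<And>k l. pair k l \<in> Arr (L n) \<Longrightarrow> Amap G (Amap F (pair k l)) = Amap G' (Amap F' (pair k l))"
  shows "func_comp (L n) G F = func_comp (L n) G' F'"
  unfolding func_comp_eq_iff
proof (intro conjI ballI)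
  fix z assume z: "z \<in> Obj (L n)"
  then obtain x y where "z = pair x y" by (rule pair_ObjE)
  with z show "Omap G (Omap F z) = Omap G' (Omap F' z)" using assms(1) by simp
next
  fix z assume z: "z \<in> Arr (L n)"
  then obtain k l where "z = pair k l" by (rule pair_ArrE)
  with z show "Amap G (Amap F z) = Amap G' (Amap F' z)" using assms(2) by simp
qed

lemma L_ObjD: "pair x y \<in> Obj (L n) \<Longrightarrow> x \<in> Obj (lev X n) \<and> y \<in> Obj (lev Y n)"
  and L_ArrD: "pair k l \<in> Arr (L n) \<Longrightarrow> k \<in> Arr (lev X n) \<and> l \<in> Arr (lev Y n)"
  by (auto simp: L_Obj L_Arr)

lemma XY_simplicial: "simplicial_cat XY"
proof (rule simplicial_cat.intro)
  show "category (lev XY n)" for n unfolding lev_XY by (rule R.pair_cat_is_category)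
  show "i \<le> n + 1 \<Longrightarrow> is_functor (lev XY (n + 1)) (lev XY n) (face XY n i)" for i n
    using face_XY_functor[of i n] by (simp add: lev_XY)
  show "i \<le> n \<Longrightarrow> is_functor (lev XY n) (lev XY (n + 1)) (degen XY n i)" for i n
    using degen_XY_functor[of i n] by (simp add: lev_XY)
  show "func_comp (lev XY (n + 2)) (face XY n i) (face XY (n + 1) j) =
      func_comp (lev XY (n + 2)) (face XY n (j - 1)) (face XY (n + 1) i)" if "i < j" "j \<le> n + 2" for i j n
    unfolding lev_XY
    by (rule L_func_comp_eqI)
      (use that L_ObjD[of _ _ "Suc (Suc n)"] L_ArrD[of _ _ "Suc (Suc n)"] in \<open>simp_all add: face_XY face_closed X.face_face_elem[of i j n] Y.face_face_elem[of i j n]\<close>)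
  show "func_comp (lev XY n) (degen XY (n + 1) i) (degen XY n j) =
      func_comp (lev XY n) (degen XY (n + 1) (j + 1)) (degen XY n i)" if "i \<le> j" "j \<le> n" for i j n
    unfolding lev_XY
    by (rule L_func_comp_eqI)
      (use that L_ObjD[of _ _ n] L_ArrD[of _ _ n] in \<open>simp_all add: degen_XY degen_closed X.degen_degen_elem[of i j n] Y.degen_degen_elem[of i j n]\<close>)
  show "func_comp (lev XY (n + 1)) (face XY (n + 1) i) (degen XY (n + 1) j) =
      func_comp (lev XY (n + 1)) (degen XY n (j - 1)) (face XY n i)" if "i < j" "j \<le> n + 1" for i j n
    unfolding lev_XY
    by (rule L_func_comp_eqI)
      (use that L_ObjD[of _ _ "Suc n"] L_ArrD[of _ _ "Suc n"] in \<open>simp_all add: face_XY face_closed degen_XY degen_closed X.face_degen_lt_elem Y.face_degen_lt_elem\<close>)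
  show "func_comp (lev XY (n + 1)) (face XY (n + 1) i) (degen XY (n + 1) j) =
      func_comp (lev XY (n + 1)) (degen XY n j) (face XY n (i - 1))" if "j + 1 < i" "i \<le> n + 2" for i j n
    unfolding lev_XY
    by (rule L_func_comp_eqI)
      (use that L_ObjD[of _ _ "Suc n"] L_ArrD[of _ _ "Suc n"] in \<open>simp_all add: face_XY face_closed degen_XY degen_closed X.face_degen_gt_elem Y.face_degen_gt_elem\<close>)
  show "func_comp (lev XY n) (face XY n i) (degen XY n j) = id_func (lev XY n)"
    if "i = j \<or> i = j + 1" "j \<le> n" for i j n
    unfolding lev_XY func_comp_eq_id_iff
  proof (intro conjI ballI)
    fix z assume "z \<in> Obj (L n)"
    moreover from this obtain x y where "z = pair x y" by (rule pair_ObjE)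
    ultimately show "Omap (face XY n i) (Omap (degen XY n j) z) = z"
      using that L_ObjD[of _ _ n]
      by (simp add: face_XY degen_XY degen_closed X.face_degen_id_elem Y.face_degen_id_elem)
  next
    fix z assume "z \<in> Arr (L n)"
    moreover from this obtain x y where "z = pair x y" by (rule pair_ArrE)
    ultimately show "Amap (face XY n i) (Amap (degen XY n j) z) = z"
      using that L_ArrD[of _ _ n]
      by (simp add: face_XY degen_XY degen_closed X.face_degen_id_elem Y.face_degen_id_elem)
  qed
qed

text \<open>Composable pairs are glued in \<open>X\<close> and in \<open>Y\<close> separately. The
  two results match in \<open>C\<close> because their images there have the same outer faces and
  \<open>C\<close> satisfies the Segal condition too.\<close>

lemma XY_segal: "Cat_pullback (L (Suc (Suc n))) (L (Suc n)) (L (Suc n)) (L n)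
    (face XY (Suc n) (Suc (Suc n))) (face XY (Suc n) 0) (face XY n 0) (face XY n (Suc n))"
proof (rule Cat_pullbackI)
  interpret XY: simplicial_cat XY by (rule XY_simplicial)
  note pX = X.segal_Suc[of n] and pY = Y.segal_Suc[of n]
  have pC: "Cat_pullback (lev C (Suc (Suc n))) (lev C (Suc n)) (lev C (Suc n)) (lev C n)
      (face C (Suc n) (Suc (Suc n))) (face C (Suc n) 0) (face C n 0) (face C n (Suc n))"
    if "(C, f, g) \<in> S" for C f g
  proof -
    interpret double_functor X C f using that by (rule double_functors)
    show ?thesis by (rule Y.segal_Suc)
  qed
  show "Omap (face XY n 0) (Omap (face XY (Suc n) (Suc (Suc n))) z) =
      Omap (face XY n (Suc n)) (Omap (face XY (Suc n) 0) z)" if "z \<in> Obj (L (Suc (Suc n)))" for z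
    using XY.face_face_elem(1)[of 0 "Suc (Suc n)" n z] that by (simp add: lev_XY)
  show "Amap (face XY n 0) (Amap (face XY (Suc n) (Suc (Suc n))) z) =
      Amap (face XY n (Suc n)) (Amap (face XY (Suc n) 0) z)" if "z \<in> Arr (L (Suc (Suc n)))" for z
    using XY.face_face_elem(2)[of 0 "Suc (Suc n)" n z] that by (simp add: lev_XY)
  { fix a b assume ab: "a \<in> Obj (L (Suc n))" "b \<in> Obj (L (Suc n))"
      and eq: "Omap (face XY n 0) a = Omap (face XY n (Suc n)) b"
    obtain x y x' y' where *: "a = pair x y" "b = pair x' y'"
      using ab by (elim pair_ObjE) blast
    note D = L_ObjD[OF ab(1)[unfolded *]] L_ObjD[OF ab(2)[unfolded *]]
    have m: "Omap (f (Suc n)) x = Omap (g (Suc n)) y" "Omap (f (Suc n)) x' = Omap (g (Suc n)) y'"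
      if "(C, f, g) \<in> S" for C f g using ab that unfolding * L_Obj by auto
    have "Omap (face X n 0) x = Omap (face X n (Suc n)) x'" "Omap (face Y n 0) y = Omap (face Y n (Suc n)) y'"
      using eq ab unfolding * by (simp_all add: face_XY)
    then obtain u v where u: "u \<in> Obj (lev X (Suc (Suc n)))" "Omap (face X (Suc n) (Suc (Suc n))) u = x"
        "Omap (face X (Suc n) 0) u = x'" and v: "v \<in> Obj (lev Y (Suc (Suc n)))"
        "Omap (face Y (Suc n) (Suc (Suc n))) v = y" "Omap (face Y (Suc n) 0) v = y'"
      using Cat_pullback_ex(1)[OF pX, of x x'] Cat_pullback_ex(1)[OF pY, of y y'] D by blast
    have "Omap (f (Suc (Suc n))) u = Omap (g (Suc (Suc n))) v" if S: "(C, f, g) \<in> S" for C f g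
    proof (rule Cat_pullback_eq(1)[OF pC[OF S]])
      interpret f: double_functor X C f using S by (rule double_functors)
      interpret g: double_functor Y C g using S by (rule double_functors)
      show "Omap (f (Suc (Suc n))) u \<in> Obj (lev C (Suc (Suc n)))"
        "Omap (g (Suc (Suc n))) v \<in> Obj (lev C (Suc (Suc n)))"
        using u v is_functor.Omap_Obj[OF f.level_functor] is_functor.Omap_Obj[OF g.level_functor] by auto
      show "Omap (face C (Suc n) (Suc (Suc n))) (Omap (f (Suc (Suc n))) u) =
          Omap (face C (Suc n) (Suc (Suc n))) (Omap (g (Suc (Suc n))) v)"
        "Omap (face C (Suc n) 0) (Omap (f (Suc (Suc n))) u) = Omap (face C (Suc n) 0) (Omap (g (Suc (Suc n))) v)"
        using u v m[OF S] by (simp_all flip: f.face_elem g.face_elem)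
    qed
    then have "pair u v \<in> Obj (L (Suc (Suc n)))" using u v by (auto simp: L_Obj)
    then show "\<exists>z\<in>Obj (L (Suc (Suc n))). Omap (face XY (Suc n) (Suc (Suc n))) z = a \<and>
        Omap (face XY (Suc n) 0) z = b"
      using u v * by (intro bexI[of _ "pair u v"]) (simp_all add: face_XY) }
  { fix a b assume ab: "a \<in> Arr (L (Suc n))" "b \<in> Arr (L (Suc n))"
      and eq: "Amap (face XY n 0) a = Amap (face XY n (Suc n)) b"
    obtain x y x' y' where *: "a = pair x y" "b = pair x' y'"
      using ab by (elim pair_ArrE) blast
    note D = L_ArrD[OF ab(1)[unfolded *]] L_ArrD[OF ab(2)[unfolded *]]
    have m: "Amap (f (Suc n)) x = Amap (g (Suc n)) y" "Amap (f (Suc n)) x' = Amap (g (Suc n)) y'"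
      if "(C, f, g) \<in> S" for C f g using ab that unfolding * L_Arr by auto
    have "Amap (face X n 0) x = Amap (face X n (Suc n)) x'" "Amap (face Y n 0) y = Amap (face Y n (Suc n)) y'"
      using eq ab unfolding * by (simp_all add: face_XY)
    then obtain u v where u: "u \<in> Arr (lev X (Suc (Suc n)))" "Amap (face X (Suc n) (Suc (Suc n))) u = x"
        "Amap (face X (Suc n) 0) u = x'" and v: "v \<in> Arr (lev Y (Suc (Suc n)))"
        "Amap (face Y (Suc n) (Suc (Suc n))) v = y" "Amap (face Y (Suc n) 0) v = y'"
      using Cat_pullback_ex(2)[OF pX, of x x'] Cat_pullback_ex(2)[OF pY, of y y'] D by blast
    have "Amap (f (Suc (Suc n))) u = Amap (g (Suc (Suc n))) v" if S: "(C, f, g) \<in> S" for C f g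
    proof (rule Cat_pullback_eq(2)[OF pC[OF S]])
      interpret f: double_functor X C f using S by (rule double_functors)
      interpret g: double_functor Y C g using S by (rule double_functors)
      show "Amap (f (Suc (Suc n))) u \<in> Arr (lev C (Suc (Suc n)))"
        "Amap (g (Suc (Suc n))) v \<in> Arr (lev C (Suc (Suc n)))"
        using u v is_functor.Amap_Arr[OF f.level_functor] is_functor.Amap_Arr[OF g.level_functor] by auto
      show "Amap (face C (Suc n) (Suc (Suc n))) (Amap (f (Suc (Suc n))) u) =
          Amap (face C (Suc n) (Suc (Suc n))) (Amap (g (Suc (Suc n))) v)"
        "Amap (face C (Suc n) 0) (Amap (f (Suc (Suc n))) u) = Amap (face C (Suc n) 0) (Amap (g (Suc (Suc n))) v)"
        using u v m[OF S] by (simp_all flip: f.face_elem g.face_elem)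
    qed
    then have "pair u v \<in> Arr (L (Suc (Suc n)))" using u v by (auto simp: L_Arr)
    then show "\<exists>z\<in>Arr (L (Suc (Suc n))). Amap (face XY (Suc n) (Suc (Suc n))) z = a \<and>
        Amap (face XY (Suc n) 0) z = b"
      using u v * by (intro bexI[of _ "pair u v"]) (simp_all add: face_XY) }
  { fix z z' assume z: "z \<in> Obj (L (Suc (Suc n)))" "z' \<in> Obj (L (Suc (Suc n)))"
      and eq: "Omap (face XY (Suc n) (Suc (Suc n))) z = Omap (face XY (Suc n) (Suc (Suc n))) z'"
        "Omap (face XY (Suc n) 0) z = Omap (face XY (Suc n) 0) z'"
    obtain x y x' y' where *: "z = pair x y" "z' = pair x' y'"
      using z by (elim pair_ObjE) blast
    note D = L_ObjD[OF z(1)[unfolded *]] L_ObjD[OF z(2)[unfolded *]]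
    show "z = z'"
      using eq z D Cat_pullback_eq(1)[OF pX, of x x'] Cat_pullback_eq(1)[OF pY, of y y']
      unfolding * by (simp add: face_XY) }
  { fix z z' assume z: "z \<in> Arr (L (Suc (Suc n)))" "z' \<in> Arr (L (Suc (Suc n)))"
      and eq: "Amap (face XY (Suc n) (Suc (Suc n))) z = Amap (face XY (Suc n) (Suc (Suc n))) z'"
        "Amap (face XY (Suc n) 0) z = Amap (face XY (Suc n) 0) z'"
    obtain x y x' y' where *: "z = pair x y" "z' = pair x' y'"
      using z by (elim pair_ArrE) blast
    note D = L_ArrD[OF z(1)[unfolded *]] L_ArrD[OF z(2)[unfolded *]]
    show "z = z'"
      using eq z D Cat_pullback_eq(2)[OF pX, of x x'] Cat_pullback_eq(2)[OF pY, of y y']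
      unfolding * by (simp add: face_XY) }
qed (simp_all add: face_XY_functor)

text \<open>Crossed double functors preserve chosen lifts strictly, so both components go to the
  chosen lift in \<open>C\<close> of the same data.\<close>

lemma lift_closed:
  assumes "pair x y \<in> Obj (L (Suc 0))" "pair k l \<in> Arr (L 0)"
    "Dom X.X0 k = Omap X.t x" "Dom Y.X0 l = Omap Y.t y"
  shows "pair (lift X x k) (lift Y y l) \<in> Arr (L (Suc 0))"
proof -
  note D = L_ObjD[OF assms(1)] L_ArrD[OF assms(2)]
  have "Amap (f (Suc 0)) (lift X x k) = Amap (g (Suc 0)) (lift Y y l)" if S: "(C, f, g) \<in> S" for C f g
  proof -
    have "Omap (f (Suc 0)) x = Omap (g (Suc 0)) y" "Amap (f 0) k = Amap (g 0) l"
      using assms(1,2) S unfolding L_Obj L_Arr by auto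
    then show ?thesis
      using left_functor[OF S] right_functor[OF S] D assms(3,4) by (simp add: crossed_double_functor_iff)
  qed
  then show ?thesis using D assms(3,4) X.lift_simps(1) Y.lift_simps(1) by (auto simp: L_Arr)
qed

text \<open>Factorisations through a lift are found componentwise. They match in \<open>C\<close>
  because their images solve one and the same factorisation problem through a chosen lift of
  \<open>C\<close>, and the solution is unique.\<close>

lemma XY_split: "split_opfibration (L (Suc 0)) (L 0) (face XY 0 0) (lift XY)"
proof -
  interpret t: is_functor "L (Suc 0)" "L 0" "face XY 0 0" by (rule face_XY_functor) simp
  have hom_domE: thesis
    if zu: "z \<in> Obj (L (Suc 0))" "u \<in> hom (L 0) (Omap (face XY 0 0) z) b"
      and th: "\<And>x y k l. z = pair x y \<Longrightarrow> u = pair k l \<Longrightarrow> pair x y \<in> Obj (L (Suc 0)) \<Longrightarrow> pair k l \<in> Arr (L 0) \<Longrightarrow>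
        Dom X.X0 k = Omap X.t x \<Longrightarrow> Dom Y.X0 l = Omap Y.t y \<Longrightarrow>
        b = pair (Cod X.X0 k) (Cod Y.X0 l) \<Longrightarrow> thesis" for z u b thesis
  proof -
    obtain x y where z: "z = pair x y" using zu(1) by (rule pair_ObjE)
    obtain k l where u: "u = pair k l" using homD(1)[OF zu(2)] by (rule pair_ArrE)
    show thesis
      using th[OF z u] zu homD[OF zu(2)] by (auto simp: z u face_XY pair_cat_simps)
  qed
  show ?thesis
  proof (intro split_opfibration.intro split_opfibration_axioms.intro t.is_functor_axioms)
    fix z u b assume zu: "z \<in> Obj (L (Suc 0))" "u \<in> hom (L 0) (Omap (face XY 0 0) z) b"
    obtain x y k l where *: "z = pair x y" "u = pair k l" "pair x y \<in> Obj (L (Suc 0))" "pair k l \<in> Arr (L 0)"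
        "Dom X.X0 k = Omap X.t x" "Dom Y.X0 l = Omap Y.t y"
        "b = pair (Cod X.X0 k) (Cod Y.X0 l)"
      using zu by (rule hom_domE)
    note D = L_ObjD[OF *(3)] L_ArrD[OF *(4)]
    note c = lift_closed[OF *(3-6)]
    note lX = X.lift_simps[OF conjunct1[OF D(1)] conjunct1[OF D(2)] *(5)]
      and lY = Y.lift_simps[OF conjunct2[OF D(1)] conjunct2[OF D(2)] *(6)]
    show "Dom (L (Suc 0)) (lift XY z u) = z" "Amap (face XY 0 0) (lift XY z u) = u"
      using * c lX lY by (simp_all add: lift_XY pair_cat_simps face_XY)
    show "opcartesian (L (Suc 0)) (L 0) (face XY 0 0) (lift XY z u)"
      unfolding opcartesian_def
    proof (intro conjI allI impI)
      show "lift XY z u \<in> Arr (L (Suc 0))" using * c by (simp add: lift_XY)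
      fix n v assume nv: "n \<in> Arr (L (Suc 0)) \<and> Dom (L (Suc 0)) n = Dom (L (Suc 0)) (lift XY z u) \<and>
        v \<in> hom (L 0) (Omap (face XY 0 0) (Cod (L (Suc 0)) (lift XY z u)))
          (Omap (face XY 0 0) (Cod (L (Suc 0)) n)) \<and>
        Comp (L 0) v (Amap (face XY 0 0) (lift XY z u)) = Amap (face XY 0 0) n"
      obtain n1 n2 where n: "n = pair n1 n2" using nv by (blast elim: pair_ArrE)
      have "v \<in> Arr (L 0)" using nv by (auto simp: hom_def)
      then obtain v1 v2 where v: "v = pair v1 v2" by (rule pair_ArrE)
      have nO: "pair n1 n2 \<in> Arr (L (Suc 0))" and vO: "pair v1 v2 \<in> Arr (L 0)"
        using nv n v \<open>v \<in> Arr (L 0)\<close> by auto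
      note Dn = L_ArrD[OF nO] L_ArrD[OF vO]
      have cod: "pair (Cod X.X1 (lift X x k)) (Cod Y.X1 (lift Y y l)) \<in> Obj (L (Suc 0))"
          "pair (Cod X.X1 n1) (Cod Y.X1 n2) \<in> Obj (L (Suc 0))"
        using t.A.Cod_in[OF c] t.A.Cod_in[OF nO] by (simp_all add: pair_cat_simps)
      have X: "Dom X.X1 n1 = x" "v1 \<in> hom X.X0 (Cod X.X0 k) (Omap X.t (Cod X.X1 n1))"
          "Comp X.X0 v1 k = Amap X.t n1"
        and Y: "Dom Y.X1 n2 = y" "v2 \<in> hom Y.X0 (Cod Y.X0 l) (Omap Y.t (Cod Y.X1 n2))"
          "Comp Y.X0 v2 l = Amap Y.t n2"
        using nv lX lY c nO cod
        by (simp_all add: *(1,2) n v lift_XY pair_cat_simps face_XY pair_hom)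
      note fX = X.lift_factor[OF conjunct1[OF D(1)] conjunct1[OF D(2)] *(5) conjunct1[OF Dn(1)] X]
      note fY = Y.lift_factor[OF conjunct2[OF D(1)] conjunct2[OF D(2)] *(6) conjunct2[OF Dn(1)] Y]
      obtain w1 where w1: "w1 \<in> hom X.X1 (Cod X.X1 (lift X x k)) (Cod X.X1 n1)"
          "Amap X.t w1 = v1" "Comp X.X1 w1 (lift X x k) = n1"
        using fX by blast
      obtain w2 where w2: "w2 \<in> hom Y.X1 (Cod Y.X1 (lift Y y l)) (Cod Y.X1 n2)"
          "Amap Y.t w2 = v2" "Comp Y.X1 w2 (lift Y y l) = n2"
        using fY by blast
      have "Amap (f (Suc 0)) w1 = Amap (g (Suc 0)) w2" if S: "(C, f, g) \<in> S" for C f g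
      proof -
        interpret f: crossed_double_functor X C f using S by (rule left_functor)
        interpret g: crossed_double_functor Y C g using S by (rule right_functor)
        interpret C: universal_crossed_double_category C
          by (rule universal_crossedI) (rule f.Y.crossed_double_category_axioms)
        interpret f0: is_functor "lev X 0" "lev C 0" "f 0" by (rule f.level_functor)
        interpret f1: is_functor "lev X (Suc 0)" "lev C (Suc 0)" "f (Suc 0)" by (rule f.level_functor)
        interpret g0: is_functor "lev Y 0" "lev C 0" "g 0" by (rule g.level_functor)
        interpret g1: is_functor "lev Y (Suc 0)" "lev C (Suc 0)" "g (Suc 0)" by (rule g.level_functor)
        have m: "Omap (f (Suc 0)) x = Omap (g (Suc 0)) y" "Amap (f 0) k = Amap (g 0) l"
            "Amap (f 0) v1 = Amap (g 0) v2" "Amap (f (Suc 0)) n1 = Amap (g (Suc 0)) n2"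
            "Amap (f (Suc 0)) (lift X x k) = Amap (g (Suc 0)) (lift Y y l)"
          using *(3,4) c nO vO S unfolding L_Obj L_Arr by auto
        have lf: "Amap (f (Suc 0)) (lift X x k) = lift C (Omap (f (Suc 0)) x) (Amap (f 0) k)"
          using left_functor[OF S] D *(5) by (simp add: crossed_double_functor_iff)
        have lg: "Amap (g (Suc 0)) (lift Y y l) = lift C (Omap (f (Suc 0)) x) (Amap (f 0) k)"
          using lf m(5) by simp
        let ?h = "Omap (f (Suc 0)) x" let ?u = "Amap (f 0) k" let ?m = "Amap (f (Suc 0)) n1"
        have "\<exists>!w. w \<in> hom C.X1 (Cod C.X1 (lift C ?h ?u)) (Cod C.X1 ?m) \<and>
            Amap C.t w = Amap (f 0) v1 \<and> Comp C.X1 w (lift C ?h ?u) = ?m"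
        proof (rule C.lift_factor)
          show "?h \<in> Obj C.X1" "?u \<in> Arr C.X0" "?m \<in> Arr C.X1"
            using D Dn by (simp_all add: f1.Omap_Obj f0.Amap_Arr f1.Amap_Arr)
          show "Dom C.X0 ?u = Omap C.t ?h"
            using D *(5) f0.Dom_Amap[of k] f.face_elem(1)[of 0 0 x] by simp
          show "Dom C.X1 ?m = ?h" using Dn X(1) f1.Dom_Amap by simp
          show "Amap (f 0) v1 \<in> hom C.X0 (Cod C.X0 ?u) (Omap C.t (Cod C.X1 ?m))"
            using f0.Amap_in[OF X(2)] D Dn f.face_elem(1)[of 0 0 "Cod X.X1 n1"]
            by (simp add: f0.Cod_Amap f1.Cod_Amap X.X1.Cod_in)
          have k: "k \<in> hom X.X0 (Omap X.t x) (Cod X.X0 k)"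
            using D *(5) by (simp add: hom_def)
          show "Comp C.X0 (Amap (f 0) v1) ?u = Amap C.t ?m"
            using f0.Amap_Comp[OF k X(2)] X(3) Dn f.face_elem(2)[of 0 0 n1] by simp
        qed
        moreover have "Amap (f (Suc 0)) w1 \<in> hom C.X1 (Cod C.X1 (lift C ?h ?u)) (Cod C.X1 ?m)"
          using f1.Amap_in[OF w1(1)] lX(1) Dn by (simp add: f1.Cod_Amap flip: lf)
        moreover have "Amap C.t (Amap (f (Suc 0)) w1) = Amap (f 0) v1"
          using f.face_elem(2)[of 0 0 w1] w1 by (simp add: hom_def)
        moreover have "Comp C.X1 (Amap (f (Suc 0)) w1) (lift C ?h ?u) = ?m"
          using f1.Amap_Comp[OF lX(5) w1(1)] w1(3) by (simp add: lf)
        moreover have "Amap (g (Suc 0)) w2 \<in> hom C.X1 (Cod C.X1 (lift C ?h ?u)) (Cod C.X1 ?m)"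
          using g1.Amap_in[OF w2(1)] lY(1) Dn g1.Cod_Amap[of "lift Y y l"] g1.Cod_Amap[of n2]
          by (simp add: lg m(4))
        moreover have "Amap C.t (Amap (g (Suc 0)) w2) = Amap (f 0) v1"
          using g.face_elem(2)[of 0 0 w2] w2 m by (simp add: hom_def)
        moreover have "Comp C.X1 (Amap (g (Suc 0)) w2) (lift C ?h ?u) = ?m"
          using g1.Amap_Comp[OF lY(5) w2(1)] w2(3) by (simp add: lg m(4))
        ultimately show ?thesis by blast
      qed
      then have w: "pair w1 w2 \<in> Arr (L (Suc 0))"
        using w1(1) w2(1) by (auto simp: L_Arr hom_def)
      show "\<exists>!w. w \<in> hom (L (Suc 0)) (Cod (L (Suc 0)) (lift XY z u)) (Cod (L (Suc 0)) n) \<and>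
          Amap (face XY 0 0) w = v \<and> Comp (L (Suc 0)) w (lift XY z u) = n"
      proof (intro ex1I[of _ "pair w1 w2"] conjI)
        show "pair w1 w2 \<in> hom (L (Suc 0)) (Cod (L (Suc 0)) (lift XY z u)) (Cod (L (Suc 0)) n)"
          using w w1 w2 by (simp add: *(1,2) n lift_XY pair_cat_simps hom_def)
        show "Amap (face XY 0 0) (pair w1 w2) = v" using w w1 w2 by (simp add: v face_XY)
        show "Comp (L (Suc 0)) (pair w1 w2) (lift XY z u) = n"
          using w w1 w2 by (simp add: *(1,2) n lift_XY pair_cat_simps)
      next
        fix w' assume w': "w' \<in> hom (L (Suc 0)) (Cod (L (Suc 0)) (lift XY z u)) (Cod (L (Suc 0)) n) \<and>
          Amap (face XY 0 0) w' = v \<and> Comp (L (Suc 0)) w' (lift XY z u) = n"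
        then have A: "w' \<in> Arr (L (Suc 0))" by (auto dest: homD)
        then obtain a b where w'_eq: "w' = pair a b" by (rule pair_ArrE)
        have "a = w1" using fX w' w1 A
          by (auto simp: w'_eq *(1,2) n v lift_XY pair_cat_simps pair_hom face_XY)
        moreover have "b = w2" using fY w' w2 A
          by (auto simp: w'_eq *(1,2) n v lift_XY pair_cat_simps pair_hom face_XY)
        ultimately show "w' = pair w1 w2" by (simp add: w'_eq)
      qed
    qed
    fix v c assume v: "v \<in> hom (L 0) b c"
    obtain v1 v2 where v_eq: "v = pair v1 v2" using homD(1)[OF v] by (rule pair_ArrE)
    obtain c1 c2 where vh: "v1 \<in> hom X.X0 (Cod X.X0 k) c1" "v2 \<in> hom Y.X0 (Cod Y.X0 l) c2"
      using v by (auto simp: v_eq *(7) elim: pair_homE)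
    have kh: "k \<in> hom X.X0 (Omap X.t x) (Cod X.X0 k)"
        "l \<in> hom Y.X0 (Omap Y.t y) (Cod Y.X0 l)"
      using D * by (simp_all add: hom_def)
    show "lift XY z (Comp (L 0) v u) = Comp (L (Suc 0)) (lift XY (Cod (L (Suc 0)) (lift XY z u)) v) (lift XY z u)"
      using X.S.lift_Comp[OF conjunct1[OF D(1)] kh(1) vh(1)] Y.S.lift_Comp[OF conjunct2[OF D(1)] kh(2) vh(2)]
      by (simp add: *(1,2) v_eq lift_XY pair_cat_simps)
  next
    fix z assume z: "z \<in> Obj (L (Suc 0))"
    then obtain x y where "z = pair x y" by (rule pair_ObjE)
    with z show "lift XY z (Ident (L 0) (Omap (face XY 0 0) z)) = Ident (L (Suc 0)) z"
      using L_ObjD[of x y "Suc 0"]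
      by (simp add: face_XY pair_cat_simps lift_XY X.S.lift_Ident Y.S.lift_Ident)
  qed
qed

lemma XY_crossed: "crossed_double_category XY"
proof -
  interpret simplicial_cat XY by (rule XY_simplicial)
  interpret U: universal_split_double_category XY
  proof (intro universal_split_double_category.intro split_double_category.intro
      split_double_category_axioms.intro double_category.intro double_category_axioms.intro XY_simplicial)
    show "Cat_pullback (lev XY (n + 2)) (lev XY (n + 1)) (lev XY (n + 1)) (lev XY n)
      (face XY (n + 1) (n + 2)) (face XY (n + 1) 0) (face XY n 0) (face XY n (n + 1))" for n
      using XY_segal[of n] by (simp add: lev_XY)
    show "split_opfibration (lev XY 1) (lev XY 0) (face XY 0 0) (lift XY)"
      using XY_split by (simp add: lev_XY)
  qed
  show ?thesis
  proof (rule U.crossedI)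
    fix u assume u: "u \<in> Arr (lev XY 0)"
    then obtain k l where kl: "u = pair k l" unfolding lev_XY by (rule pair_ArrE)
    have A: "pair k l \<in> Arr (L 0)" using u by (simp add: kl lev_XY)
    have O: "pair (Dom X.X0 k) (Dom Y.X0 l) \<in> Obj (L 0)"
      using U.X0.Dom_in[OF u] by (simp add: kl lev_XY pair_cat_simps)
    show "Amap (degen XY 0 0) u = lift XY (Omap (degen XY 0 0) (Dom (lev XY 0) u)) u"
      using A O L_ArrD[OF A]
      by (simp add: kl lev_XY pair_cat_simps degen_XY lift_XY X.lift_unit Y.lift_unit)
  next
    fix z u w assume a: "z \<in> Obj (lev XY (Suc (Suc 0)))" "u \<in> Arr (lev XY 0)"
      "Dom (lev XY 0) u = Omap (face XY 0 0) (Omap (face XY (Suc 0) 0) z)" "w \<in> Arr (lev XY (Suc (Suc 0)))"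
      "Amap (face XY (Suc 0) 0) w = lift XY (Omap (face XY (Suc 0) 0) z) u"
      "Amap (face XY (Suc 0) (Suc (Suc 0))) w = lift XY (Omap (face XY (Suc 0) (Suc (Suc 0))) z)
        (Amap (face XY 0 (Suc 0)) (lift XY (Omap (face XY (Suc 0) 0) z) u))"
    obtain x y where z: "z = pair x y" using a(1) unfolding lev_XY by (rule pair_ObjE)
    obtain k l where u: "u = pair k l" using a(2) unfolding lev_XY by (rule pair_ArrE)
    obtain m n where w: "w = pair m n" using a(4) unfolding lev_XY by (rule pair_ArrE)
    have A: "pair x y \<in> Obj (L (Suc (Suc 0)))" "pair k l \<in> Arr (L 0)" "pair m n \<in> Arr (L (Suc (Suc 0)))"
      using a by (simp_all add: z u w lev_XY)
    have d: "Dom X.X0 k = Omap X.t (Omap X.e0 x)"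
      "Dom Y.X0 l = Omap Y.t (Omap Y.e0 y)"
      using a(3) A by (simp_all add: z u lev_XY pair_cat_simps face_XY face_closed)
    have "pair (lift X (Omap X.e0 x) k) (lift Y (Omap Y.e0 y) l) \<in> Arr (L (Suc 0))"
      by (rule lift_closed) (use A d face_closed(1)[OF _ A(1)] in auto)
    then show "Amap (face XY (Suc 0) (Suc 0)) w = lift XY (Omap (face XY (Suc 0) (Suc 0)) z) u"
      using a(5,6) A d L_ObjD[OF A(1)] L_ArrD[OF A(2)] L_ArrD[OF A(3)] X.lift_e1[of x k m] Y.lift_e1[of y l n]
      by (simp add: z u w face_XY lift_XY)
  qed
qed

lemma proj_crossed_functors:
  "crossed_double_functor XY X (\<lambda>n. R.pleft n)" "crossed_double_functor XY Y (\<lambda>n. R.pright n)"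
proof -
  interpret XY: universal_crossed_double_category XY by (rule universal_crossedI) (rule XY_crossed)
  have "double_functor XY X (\<lambda>n. R.pleft n)"
  proof (intro double_functor.intro double_functor_axioms.intro XY.double_category_axioms X.double_category_axioms)
    show "is_functor (lev XY n) (lev X n) (R.pleft n)" for n unfolding lev_XY by (rule R.proj_functors)
    show "i \<le> n + 1 \<Longrightarrow> func_comp (lev XY (n + 1)) (R.pleft n) (face XY n i) =
        func_comp (lev XY (n + 1)) (face X n i) (R.pleft (n + 1))" for i n
      unfolding lev_XY by (rule L_func_comp_eqI) (simp_all add: face_XY face_closed R.proj_simps)
    show "i \<le> n \<Longrightarrow> func_comp (lev XY n) (R.pleft (n + 1)) (degen XY n i) =
        func_comp (lev XY n) (degen X n i) (R.pleft n)" for i n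
      unfolding lev_XY by (rule L_func_comp_eqI) (simp_all add: degen_XY degen_closed R.proj_simps)
  qed
  moreover have "double_functor XY Y (\<lambda>n. R.pright n)"
  proof (intro double_functor.intro double_functor_axioms.intro XY.double_category_axioms Y.double_category_axioms)
    show "is_functor (lev XY n) (lev Y n) (R.pright n)" for n unfolding lev_XY by (rule R.proj_functors)
    show "i \<le> n + 1 \<Longrightarrow> func_comp (lev XY (n + 1)) (R.pright n) (face XY n i) =
        func_comp (lev XY (n + 1)) (face Y n i) (R.pright (n + 1))" for i n
      unfolding lev_XY by (rule L_func_comp_eqI) (simp_all add: face_XY face_closed R.proj_simps)
    show "i \<le> n \<Longrightarrow> func_comp (lev XY n) (R.pright (n + 1)) (degen XY n i) =
        func_comp (lev XY n) (degen Y n i) (R.pright n)" for i n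
      unfolding lev_XY by (rule L_func_comp_eqI) (simp_all add: degen_XY degen_closed R.proj_simps)
  qed
  moreover have "Amap (R.pleft (Suc 0)) (lift XY z u) = lift X (Omap (R.pleft (Suc 0)) z) (Amap (R.pleft 0) u) \<and>
      Amap (R.pright (Suc 0)) (lift XY z u) = lift Y (Omap (R.pright (Suc 0)) z) (Amap (R.pright 0) u)"
    if a: "z \<in> Obj (L (Suc 0))" "u \<in> Arr (L 0)" "Dom (L 0) u = Omap (face XY 0 0) z" for z u
  proof -
    obtain x y where z: "z = pair x y" using a(1) by (rule pair_ObjE)
    obtain k l where u: "u = pair k l" using a(2) by (rule pair_ArrE)
    have A: "pair x y \<in> Obj (L (Suc 0))" "pair k l \<in> Arr (L 0)" using a by (simp_all add: z u)
    have "pair (lift X x k) (lift Y y l) \<in> Arr (L (Suc 0))"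
      by (rule lift_closed) (use a A in \<open>simp_all add: z u pair_cat_simps face_XY\<close>)
    then show ?thesis using A by (simp add: z u lift_XY R.proj_simps)
  qed
  ultimately show "crossed_double_functor XY X (\<lambda>n. R.pleft n)" "crossed_double_functor XY Y (\<lambda>n. R.pright n)"
    using XY_crossed X_crossed Y_crossed by (simp_all add: crossed_double_functor_iff lev_XY)
qed

lemma smap_comp_proj:
  assumes "(C, f, g) \<in> S"
  shows "smap_comp XY f (\<lambda>n. R.pleft n) = smap_comp XY g (\<lambda>n. R.pright n)"
  unfolding smap_comp_def lev_XY
  by (intro ext L_func_comp_eqI) (use assms in \<open>auto simp: R.proj_simps L_Obj L_Arr\<close>)

end

text \<open>Matched pairs at all levels form a crossed double category over the cospan, so the
  crossed double functor \<open>r\<close> into \<open>P\<close> exists and supplies the preimages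
  level by level.\<close>

lemma crossed_pullback_ex:
  fixes P :: "('u::infinite, 'u) crossed_double_cat"
  assumes pb: "crossed_pullback P A B C p q f g"
  shows "a \<in> Obj (lev A n) \<Longrightarrow> b \<in> Obj (lev B n) \<Longrightarrow> Omap (f n) a = Omap (g n) b \<Longrightarrow>
      \<exists>x\<in>Obj (lev P n). Omap (p n) x = a \<and> Omap (q n) x = b"
    and "k \<in> Arr (lev A n) \<Longrightarrow> l \<in> Arr (lev B n) \<Longrightarrow> Amap (f n) k = Amap (g n) l \<Longrightarrow>
      \<exists>m\<in>Arr (lev P n). Amap (p n) m = k \<and> Amap (q n) m = l"
proof -
  interpret S: crossed_cospans A B "{(C, f, g)}"
    by (rule crossed_cospans.intro) (use pb in \<open>auto simp: is_pullback_def\<close>)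
  have "smap_comp S.XY f (\<lambda>n. S.R.pleft n) = smap_comp S.XY g (\<lambda>n. S.R.pright n)"
    by (rule S.smap_comp_proj) simp
  then have "\<exists>!r. crossed_double_functor S.XY P r \<and> smap_comp S.XY p r = (\<lambda>n. S.R.pleft n) \<and>
      smap_comp S.XY q r = (\<lambda>n. S.R.pright n)"
    using pb S.XY_crossed S.proj_crossed_functors unfolding is_pullback_def by blast
  then obtain r where r: "crossed_double_functor S.XY P r"
      "smap_comp S.XY p r = (\<lambda>n. S.R.pleft n)" "smap_comp S.XY q r = (\<lambda>n. S.R.pright n)"
    by blast
  interpret r: crossed_double_functor S.XY P r by (rule r)
  interpret rn: is_functor "S.L n" "lev P n" "r n" using r.level_functor[of n] by (simp add: S.lev_XY)
  have rp: "func_comp (S.L n) (p n) (r n) = S.R.pleft n" "func_comp (S.L n) (q n) (r n) = S.R.pright n"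
    using fun_cong[OF r(2), of n] fun_cong[OF r(3), of n] by (simp_all add: smap_comp_def S.lev_XY)
  { assume "a \<in> Obj (lev A n)" "b \<in> Obj (lev B n)" "Omap (f n) a = Omap (g n) b"
    then have ab: "pair a b \<in> Obj (S.L n)" unfolding S.L_Obj by simp
    have "Omap (p n) (Omap (r n) (pair a b)) = a" "Omap (q n) (Omap (r n) (pair a b)) = b"
      using func_comp_simps(1)[OF ab, of "p n" "r n"] func_comp_simps(1)[OF ab, of "q n" "r n"]
        S.R.proj_simps(1,3)[OF ab] unfolding rp by simp_all
    then show "\<exists>x\<in>Obj (lev P n). Omap (p n) x = a \<and> Omap (q n) x = b"
      using rn.Omap_Obj[OF ab] by blast }
  { assume "k \<in> Arr (lev A n)" "l \<in> Arr (lev B n)" "Amap (f n) k = Amap (g n) l"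
    then have kl: "pair k l \<in> Arr (S.L n)" unfolding S.L_Arr by simp
    have "Amap (p n) (Amap (r n) (pair k l)) = k" "Amap (q n) (Amap (r n) (pair k l)) = l"
      using func_comp_simps(2)[OF kl, of "p n" "r n"] func_comp_simps(2)[OF kl, of "q n" "r n"]
        S.R.proj_simps(2,4)[OF kl] unfolding rp by simp_all
    then show "\<exists>m\<in>Arr (lev P n). Amap (p n) m = k \<and> Amap (q n) m = l"
      using rn.Amap_Arr[OF kl] by blast }
qed

text \<open>The levelwise kernel pair of \<open>(p, q)\<close> is itself a crossed double category.
  Its two projections to \<open>P\<close> mediate the same cone, hence coincide.\<close>

lemma crossed_pullback_eq:
  fixes P :: "('u::infinite, 'u) crossed_double_cat"
  assumes pb: "crossed_pullback P A B C p q f g"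
    and x: "x \<in> Obj (lev P n)" "x' \<in> Obj (lev P n)" "Omap (p n) x = Omap (p n) x'" "Omap (q n) x = Omap (q n) x'"
  shows "x = x'"
proof -
  interpret S: crossed_cospans P P "{(A, p, p), (B, q, q)}"
    by (rule crossed_cospans.intro) (use pb in \<open>auto simp: is_pullback_def\<close>)
  let ?l = "\<lambda>n. S.R.pleft n" and ?r = "\<lambda>n. S.R.pright n"
  have pq: "crossed_double_functor P A p" "crossed_double_functor P B q" "smap_comp P f p = smap_comp P g q"
    using pb by (simp_all add: is_pullback_def)
  have e: "smap_comp S.XY p ?l = smap_comp S.XY p ?r" "smap_comp S.XY q ?l = smap_comp S.XY q ?r"
    by (rule S.smap_comp_proj[of A p p] S.smap_comp_proj[of B q q], simp)+
  have "smap_comp S.XY f (smap_comp S.XY p ?l) n = smap_comp S.XY g (smap_comp S.XY q ?l) n" for n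
  proof -
    have "func_comp (lev P n) (f n) (p n) = func_comp (lev P n) (g n) (q n)"
      using fun_cong[OF pq(3), of n] by (simp add: smap_comp_def)
    then show ?thesis
      unfolding smap_comp_def S.lev_XY
      by (simp add: func_comp_simps func_comp_eq_iff is_functor.Omap_Obj[OF S.R.proj_functors(1)]
        is_functor.Amap_Arr[OF S.R.proj_functors(1)] del: image_insert)
  qed
  then have c: "smap_comp S.XY f (smap_comp S.XY p ?l) = smap_comp S.XY g (smap_comp S.XY q ?l)" by blast
  have "\<exists>!r. crossed_double_functor S.XY P r \<and> smap_comp S.XY p r = smap_comp S.XY p ?l \<and>
      smap_comp S.XY q r = smap_comp S.XY q ?l"
    using pb S.XY_crossed c crossed_double_functor_comp[OF S.proj_crossed_functors(1) pq(1)]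
      crossed_double_functor_comp[OF S.proj_crossed_functors(1) pq(2)]
    unfolding is_pullback_def by blast
  then obtain r where r: "\<And>r'. crossed_double_functor S.XY P r' \<and> smap_comp S.XY p r' = smap_comp S.XY p ?l \<and>
      smap_comp S.XY q r' = smap_comp S.XY q ?l \<Longrightarrow> r' = r"
    by blast
  have "?l = r" by (rule r) (intro conjI refl S.proj_crossed_functors)
  moreover have "?r = r" by (rule r) (intro conjI e[symmetric] S.proj_crossed_functors)
  ultimately have "?l = ?r" by (rule trans[OF _ sym])
  then have eq: "S.R.pleft n = S.R.pright n" by (rule fun_cong)
  have xx: "pair x x' \<in> Obj (S.L n)" unfolding S.L_Obj using x by simp
  show ?thesis using S.R.proj_simps(1,3)[OF xx] unfolding eq by simp
qed

section \<open>Corners\<close>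

context universal_crossed_double_category begin

text \<open>Diagrammatic order, opposite to that of \<open>Comp\<close>: \<open>x\<close> comes
  first, since \<open>d_2\<close> is the front edge of a 2-simplex and \<open>d_0\<close> the back
  edge.\<close>

definition hcomp :: "'u \<Rightarrow> 'u \<Rightarrow> 'u" where
  "hcomp x y = Omap e1 (THE z. z \<in> Obj X2 \<and> Omap e2 z = x \<and> Omap e0 z = y)"

lemma e1_hcomp:
  assumes "z \<in> Obj X2" shows "Omap e1 z = hcomp (Omap e2 z) (Omap e0 z)"
proof -
  have "(THE z'. z' \<in> Obj X2 \<and> Omap e2 z' = Omap e2 z \<and> Omap e0 z' = Omap e0 z) = z"
    by (rule the_equality) (use assms segal_eq(1) in auto)
  then show ?thesis by (simp add: hcomp_def)
qed

lemma hcomp_in: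
  assumes "x \<in> Obj X1" "y \<in> Obj X1" "Omap t x = Omap s y"
  shows "hcomp x y \<in> Obj X1" "Omap s (hcomp x y) = Omap s x" "Omap t (hcomp x y) = Omap t y"
proof -
  obtain z where z: "z \<in> Obj X2" "Omap e2 z = x" "Omap e0 z = y" using segal_ex(1)[OF assms] by blast
  then show "hcomp x y \<in> Obj X1" "Omap s (hcomp x y) = Omap s x" "Omap t (hcomp x y) = Omap t y"
    using e1_hcomp[OF z(1)] e1.Omap_Obj[OF z(1)] faces_2(1,3)[OF z(1)] by simp_all
qed

text \<open>Pasting of two squares along a common vertical side. Only the outer sides of the result
  are recorded, because \<open>corner_step\<close> refers to nothing else.\<close>

lemma hcomp_cell:
  assumes "m \<in> hom X1 x x'" "n \<in> hom X1 y y'" "Amap t m = Amap s n"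
  obtains k where "k \<in> hom X1 (hcomp x y) (hcomp x' y')" "Amap s k = Amap s m" "Amap t k = Amap t n"
proof -
  obtain w where w: "w \<in> Arr X2" "Amap e2 w = m" "Amap e0 w = n"
    using segal_ex(2)[of m n] assms by (auto dest: homD)
  have "Omap e2 (Dom X2 w) = x" "Omap e0 (Dom X2 w) = y" "Omap e2 (Cod X2 w) = x'" "Omap e0 (Cod X2 w) = y'"
    using w assms e2.Dom_Amap e0.Dom_Amap e2.Cod_Amap e0.Cod_Amap by (auto simp: hom_def)
  then have "Amap e1 w \<in> hom X1 (hcomp x y) (hcomp x' y')"
    using e1.Amap_in[OF X2.arr_hom[OF w(1)]] e1_hcomp[OF X2.Dom_in[OF w(1)]] e1_hcomp[OF X2.Cod_in[OF w(1)]]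
    by simp
  then show thesis using that faces_2(4,6)[OF w(1)] w(2,3) by simp
qed

text \<open>The degenerate 2-simplex \<open>s_0 h\<close> has front edge \<open>s_0 d_1 h\<close>,
  and its other two edges are \<open>h\<close>. The right unit law uses \<open>s_1 h\<close> in the
  same way.\<close>

lemma hcomp_unit_left:
  assumes h: "h \<in> Obj X1" shows "hcomp (Omap i0 (Omap s h)) h = h"
proof -
  interpret is_functor X1 X2 "degen X (Suc 0) 0" by (rule degen_is_functor) simp
  show ?thesis
    using e1_hcomp[OF Omap_Obj[OF h]] face_degen_id_elem(1)[of 0 0 "Suc 0" h]
      face_degen_id_elem(1)[of "Suc 0" 0 "Suc 0" h] face_degen_gt_elem(1)[of 0 "Suc (Suc 0)" 0 h] h by simp
qed

lemma hcomp_unit_right: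
  assumes h: "h \<in> Obj X1" shows "hcomp h (Omap i0 (Omap t h)) = h"
proof -
  interpret is_functor X1 X2 "degen X (Suc 0) (Suc 0)" by (rule degen_is_functor) simp
  show ?thesis
    using e1_hcomp[OF Omap_Obj[OF h]] face_degen_id_elem(1)[of "Suc 0" "Suc 0" "Suc 0" h]
      face_degen_id_elem(1)[of "Suc (Suc 0)" "Suc 0" "Suc 0" h] face_degen_lt_elem(1)[of 0 "Suc 0" 0 h] h by simp
qed

text \<open>A 3-simplex \<open>c\<close> is glued from the 2-simplices of \<open>(x, y)\<close> and
  \<open>(y, z)\<close>. Its faces \<open>d_1 c\<close> and \<open>d_2 c\<close> compute the two
  bracketings and share their long edge.\<close>

lemma hcomp_assoc:
  assumes x: "x \<in> Obj X1" and y: "y \<in> Obj X1" and z: "z \<in> Obj X1"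
    and "Omap t x = Omap s y" "Omap t y = Omap s z"
  shows "hcomp (hcomp x y) z = hcomp x (hcomp y z)"
proof -
  obtain a where a: "a \<in> Obj X2" "Omap e2 a = x" "Omap e0 a = y" using segal_ex(1) assms by blast
  obtain b where b: "b \<in> Obj X2" "Omap e2 b = y" "Omap e0 b = z" using segal_ex(1) assms by blast
  note pb = segal_Suc[of "Suc 0"]
  obtain c where c: "c \<in> Obj X3" "Omap (face X (Suc (Suc 0)) (Suc (Suc (Suc 0)))) c = a"
      "Omap (face X (Suc (Suc 0)) 0) c = b"
    using Cat_pullback_ex(1)[OF pb, of a b] a b by auto
  interpret f1: is_functor X3 X2 "face X (Suc (Suc 0)) (Suc 0)" by (rule face_is_functor) simp
  interpret f2: is_functor X3 X2 "face X (Suc (Suc 0)) (Suc (Suc 0))" by (rule face_is_functor) simp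
  let ?p = "Omap (face X (Suc (Suc 0)) (Suc 0)) c" and ?q = "Omap (face X (Suc (Suc 0)) (Suc (Suc 0))) c"
  note p = f1.Omap_Obj[OF c(1)] and q = f2.Omap_Obj[OF c(1)]
  have "Omap e2 ?p = hcomp x y" "Omap e0 ?p = z"
    using c a b e1_hcomp[OF a(1)] face_face_elem(1)[of "Suc 0" "Suc (Suc (Suc 0))" "Suc 0" c]
      face_face_elem(1)[of 0 "Suc 0" "Suc 0" c] by simp_all
  moreover have "Omap e2 ?q = x" "Omap e0 ?q = hcomp y z"
    using c a b e1_hcomp[OF b(1)] face_face_elem(1)[of "Suc (Suc 0)" "Suc (Suc (Suc 0))" "Suc 0" c]
      face_face_elem(1)[of 0 "Suc (Suc 0)" "Suc 0" c] by simp_all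
  moreover have "Omap e1 ?p = Omap e1 ?q"
    using c face_face_elem(1)[of "Suc 0" "Suc (Suc 0)" "Suc 0" c] by simp
  ultimately show ?thesis using e1_hcomp[OF p] e1_hcomp[OF q] by simp
qed

text \<open>This is the compatibility of \<open>d_1 : X_2 -> X_1\<close> with the splittings,
  expressed on composites: \<open>u\<close> is slid across \<open>y\<close>, and the vertical arrow
  obtained is slid across \<open>x\<close>.\<close>

lemma lift_hcomp:
  assumes xy: "x \<in> Obj X1" "y \<in> Obj X1" "Omap t x = Omap s y"
    and u: "u \<in> Arr X0" "Dom X0 u = Omap t y"
  shows "Cod X1 (lift X (hcomp x y) u) =
      hcomp (Cod X1 (lift X x (Amap s (lift X y u)))) (Cod X1 (lift X y u))"
    "Amap s (lift X (hcomp x y) u) = Amap s (lift X x (Amap s (lift X y u)))"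
proof -
  obtain z where z: "z \<in> Obj X2" "Omap e2 z = x" "Omap e0 z = y" using segal_ex(1)[OF xy] by blast
  obtain w where w: "w \<in> Arr X2" "Amap e0 w = lift X (Omap e0 z) u"
    "Amap e2 w = lift X (Omap e2 z) (Amap s (lift X (Omap e0 z) u))"
    using lift_2_ex[OF z(1), of u] u z by auto
  have *: "lift X (hcomp x y) u = Amap e1 w"
    using lift_e1[OF z(1) u(1) _ w] u z e1_hcomp[OF z(1)] by simp
  have "Cod X1 (Amap e1 w) = hcomp (Cod X1 (Amap e2 w)) (Cod X1 (Amap e0 w))"
    using e1_hcomp[OF X2.Cod_in[OF w(1)]] w(1) by (simp add: e0.Cod_Amap e1.Cod_Amap e2.Cod_Amap)
  then show "Cod X1 (lift X (hcomp x y) u) =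
      hcomp (Cod X1 (lift X x (Amap s (lift X y u)))) (Cod X1 (lift X y u))"
    using * w z by simp
  show "Amap s (lift X (hcomp x y) u) = Amap s (lift X x (Amap s (lift X y u)))"
    using * w z faces_2(6)[OF w(1)] by simp
qed

text \<open>
  A corner \<open>(v, h)\<close> is a vertical arrow \<open>v\<close> followed by a horizontal arrow \<open>h\<close>; composition moves
  the second vertical arrow across the first horizontal one by the chosen lift.
\<close>

definition corner_cat :: "('u, 'u \<times> 'u) category" where
  "corner_cat = \<lparr>Obj = Obj X0, Arr = {(v, h). v \<in> Arr X0 \<and> h \<in> Obj X1 \<and> Cod X0 v = Omap s h},
    Dom = (\<lambda>(v, h). Dom X0 v), Cod = (\<lambda>(v, h). Omap t h), Ident = (\<lambda>x. (Ident X0 x, Omap i0 x)),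
    Comp = (\<lambda>(v', h') (v, h). (Comp X0 (Amap s (lift X h v')) v, hcomp (Cod X1 (lift X h v')) h'))\<rparr>"

lemma corner_simps:
  "Obj corner_cat = Obj X0" "Dom corner_cat (v, h) = Dom X0 v" "Cod corner_cat (v, h) = Omap t h"
  "Ident corner_cat x = (Ident X0 x, Omap i0 x)"
  "Comp corner_cat (v', h') (v, h) =
    (Comp X0 (Amap s (lift X h v')) v, hcomp (Cod X1 (lift X h v')) h')"
  "(v, h) \<in> Arr corner_cat \<longleftrightarrow> v \<in> Arr X0 \<and> h \<in> Obj X1 \<and> Cod X0 v = Omap s h"
  "(v, h) \<in> hom corner_cat x y \<longleftrightarrow> v \<in> hom X0 x (Omap s h) \<and> h \<in> Obj X1 \<and> Omap t h = y"
  by (auto simp: corner_cat_def hom_def)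

lemma corner_homE:
  assumes "c \<in> hom corner_cat x y"
  obtains v h where "c = (v, h)" "v \<in> hom X0 x (Omap s h)" "h \<in> Obj X1" "Omap t h = y"
  using assms by (cases c) (simp add: corner_simps)

lemma lift_s:
  assumes "h \<in> Obj X1" "u \<in> hom X0 (Omap t h) z"
  shows "lift X h u \<in> hom X1 h (Cod X1 (lift X h u))" "Cod X1 (lift X h u) \<in> Obj X1"
    "Omap t (Cod X1 (lift X h u)) = z" "Amap t (lift X h u) = u"
    "Amap s (lift X h u) \<in> hom X0 (Omap s h) (Omap s (Cod X1 (lift X h u)))"
  using lift_simps[of h u] assms X1.Cod_in s.Amap_in[of "lift X h u" h] by (auto simp: hom_def)

text \<open>Each law has its own source. Lifts of identities and the compatibility with
  \<open>s_0\<close> give the unit laws; associativity combines vertical functoriality of lifts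
  (\<open>S.lift_Comp\<close>) with horizontal functoriality (\<open>lift_hcomp\<close>). Strictness
  of the splitting is what makes the laws hold before any quotient is taken.\<close>

lemma corner_cat_is_category: "category corner_cat"
proof
  fix c assume "c \<in> Arr corner_cat"
  then show "Dom corner_cat c \<in> Obj corner_cat" "Cod corner_cat c \<in> Obj corner_cat"
    by (cases c, simp add: corner_simps X0.Dom_in S.Omap_Obj)+
next
  fix x assume "x \<in> Obj corner_cat"
  then show "Ident corner_cat x \<in> hom corner_cat x x"
    by (simp add: corner_simps X0.Ident_in unit_faces i0.Omap_Obj)
next
  fix c c' x y z assume "c \<in> hom corner_cat x y" "c' \<in> hom corner_cat y z"
  then obtain v h v' h' where *: "c = (v, h)" "c' = (v', h')" "v \<in> hom X0 x (Omap s h)" "h \<in> Obj X1"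
      "Omap t h = y" "v' \<in> hom X0 y (Omap s h')" "h' \<in> Obj X1" "Omap t h' = z"
    by (elim corner_homE) blast
  have v': "v' \<in> hom X0 (Omap t h) (Omap s h')" using * by simp
  note l = lift_s[OF *(4) v']
  show "Comp corner_cat c' c \<in> hom corner_cat x z"
    using * l hcomp_in[OF l(2) *(7) l(3)] X0.Comp_in[OF *(3) l(5)] by (simp add: corner_simps)
next
  fix c x y assume "c \<in> hom corner_cat x y"
  then obtain v h where *: "c = (v, h)" "v \<in> hom X0 x (Omap s h)" "h \<in> Obj X1" "Omap t h = y"
    by (elim corner_homE) blast
  have "Comp X0 (Amap s (Ident X1 h)) v = v"
    using *(2,3) by (simp add: s.Amap_Ident X0.Ident_left)
  then show "Comp corner_cat (Ident corner_cat y) c = c"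
    using * homD[OF X1.Ident_in[OF *(3)]] by (simp add: corner_simps S.lift_Ident[OF *(3)] hcomp_unit_right flip: *(4))
  have "lift X (Omap i0 x) v = Amap i0 v" using lift_unit[of v] *(2) by (simp add: hom_def)
  then show "Comp corner_cat c (Ident corner_cat x) = c"
    using *(2,3) i0.Cod_Amap[of v] homD[OF *(2)]
    by (simp add: *(1) corner_simps unit_faces X0.Ident_right[OF *(2)] hcomp_unit_left)
next
  fix c c' c'' w x y z
  assume "c \<in> hom corner_cat w x" "c' \<in> hom corner_cat x y" "c'' \<in> hom corner_cat y z"
  then obtain v h v' h' v'' h'' where *: "c = (v, h)" "c' = (v', h')" "c'' = (v'', h'')"
      "v \<in> hom X0 w (Omap s h)" "h \<in> Obj X1" "Omap t h = x" "v' \<in> hom X0 x (Omap s h')" "h' \<in> Obj X1"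
      "Omap t h' = y" "v'' \<in> hom X0 y (Omap s h'')" "h'' \<in> Obj X1" "Omap t h'' = z"
    by (elim corner_homE) blast
  have v': "v' \<in> hom X0 (Omap t h) (Omap s h')" and v'': "v'' \<in> hom X0 (Omap t h') (Omap s h'')"
    using * by simp_all
  define k where "k = Cod X1 (lift X h v')"
  note l = lift_s[OF *(5) v', folded k_def]
  note m = lift_s[OF *(8) v'']
  define k' where "k' = Cod X1 (lift X h' v'')"
  have sm: "Amap s (lift X h' v'') \<in> hom X0 (Omap t k) (Omap s k')" using m l by (simp add: k'_def)
  note n = lift_s[OF l(2) sm]
  have comp: "lift X h (Comp X0 (Amap s (lift X h' v'')) v') =
      Comp X1 (lift X k (Amap s (lift X h' v''))) (lift X h v')"
    using S.lift_Comp[OF *(5) v' m(5)] by (simp add: k_def)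
  have cod: "Cod X1 (Comp X1 (lift X k (Amap s (lift X h' v''))) (lift X h v')) =
      Cod X1 (lift X k (Amap s (lift X h' v'')))"
    using X1.Comp_in[OF l(1) n(1)] by (simp add: hom_def)
  note lh = lift_hcomp[OF l(2) *(8) l(3) homD(1)[OF v''] homD(2)[OF v'']]
  show "Comp corner_cat c'' (Comp corner_cat c' c) = Comp corner_cat (Comp corner_cat c'' c') c"
    using *(1-3) comp cod lh s.Amap_Comp[OF l(1) n(1)] X0.Comp_assoc[OF *(4) l(5) n(5)]
      hcomp_assoc[OF n(2) m(2) *(11)] n(3) m(3) sm
    by (simp add: corner_simps k_def[symmetric] k'_def[symmetric])
qed

section \<open>The congruence generated by squares over identities\<close>

sublocale K: category corner_cat by (rule corner_cat_is_category)

text \<open>The identification is forced in every codescent cocone by naturality of its cell at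
  \<open>a\<close>. An arbitrary square factors as a chosen lift followed by a square over an
  identity, and the chosen lift is already accounted for by the composition of corners.\<close>

definition corner_step :: "'u \<times> 'u \<Rightarrow> 'u \<times> 'u \<Rightarrow> bool" where
  "corner_step c c' \<longleftrightarrow> c \<in> Arr corner_cat \<and> (\<exists>a. a \<in> hom X1 (snd c) (snd c') \<and>
    Amap t a = Ident X0 (Omap t (snd c)) \<and> fst c' = Comp X0 (Amap s a) (fst c))"

lemma corner_step_hom:
  assumes "corner_step (v, h) (v', h')" "(v, h) \<in> hom corner_cat x y"
  obtains a where "a \<in> hom X1 h h'" "Amap t a = Ident X0 y" "v' = Comp X0 (Amap s a) v"
    "(v', h') \<in> hom corner_cat x y"
proof -
  obtain a where a: "a \<in> hom X1 h h'" "Amap t a = Ident X0 (Omap t h)" "v' = Comp X0 (Amap s a) v"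
    using assms(1) by (auto simp: corner_step_def)
  have v: "v \<in> hom X0 x (Omap s h)" "h \<in> Obj X1" "Omap t h = y" using assms(2) by (simp_all add: corner_simps)
  have "Omap t h' = y" using S.Amap_in[OF a(1)] a(2) v X0.Ident_in[of y] S.Omap_Obj[of h] by (auto simp: hom_def)
  then show thesis
    using that[OF a(1) _ a(3)] a(2) v X0.Comp_in[OF v(1) s.Amap_in[OF a(1)]] a(3) X1.hom_objs[OF a(1)]
    by (simp add: corner_simps)
qed

lemma corner_step_parallel:
  assumes "corner_step c c'"
  shows "c \<in> Arr corner_cat" "c' \<in> Arr corner_cat" "Dom corner_cat c' = Dom corner_cat c"
    "Cod corner_cat c' = Cod corner_cat c"
proof -
  show c: "c \<in> Arr corner_cat" using assms by (simp add: corner_step_def)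
  obtain v h v' h' where "c = (v, h)" "c' = (v', h')" by (cases c, cases c')
  then show "c' \<in> Arr corner_cat" "Dom corner_cat c' = Dom corner_cat c" "Cod corner_cat c' = Cod corner_cat c"
    using corner_step_hom[of v h v' h'] assms K.arr_hom[OF c] by (auto simp: hom_def)
qed

lemma equiv_corners_parallel:
  "equivclp corner_step c c' \<Longrightarrow> c \<in> hom corner_cat x y \<longleftrightarrow> c' \<in> hom corner_cat x y"
  by (induction rule: equivclp_induct) (auto simp: hom_def dest: corner_step_parallel)

text \<open>After \<open>a\<close>, the lift of \<open>w\<close> along \<open>h'\<close> is again a
  square over \<open>w\<close>, so it factors through the lift of \<open>w\<close> along
  \<open>h\<close> by a square \<open>b\<close> over an identity. Pasting \<open>b\<close> with the
  identity square on \<open>k\<close> gives the witness.\<close>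

lemma corner_step_comp_left:
  assumes "corner_step c c'" "c \<in> hom corner_cat x y" "d \<in> hom corner_cat y z"
  shows "corner_step (Comp corner_cat d c) (Comp corner_cat d c')"
proof -
  obtain v h v' h' w k where *: "c = (v, h)" "c' = (v', h')" "d = (w, k)" by (cases c, cases c', cases d)
  obtain a where a: "a \<in> hom X1 h h'" "Amap t a = Ident X0 y" "v' = Comp X0 (Amap s a) v"
    "(v', h') \<in> hom corner_cat x y"
    using assms(1,2) unfolding * by (rule corner_step_hom)
  have v: "v \<in> hom X0 x (Omap s h)" "h \<in> Obj X1" "Omap t h = y" "h' \<in> Obj X1" "Omap t h' = y"
      "w \<in> hom X0 y (Omap s k)" "k \<in> Obj X1" "Omap t k = z"
    using assms a(4) by (simp_all add: * corner_simps)
  have w: "w \<in> hom X0 (Omap t h) (Omap s k)" "w \<in> hom X0 (Omap t h') (Omap s k)" using v by simp_all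
  note l = lift_s[OF v(2) w(1)] and l' = lift_s[OF v(4) w(2)]
  let ?m = "Comp X1 (lift X h' w) a"
  have m: "?m \<in> hom X1 h (Cod X1 (lift X h' w))" using X1.Comp_in[OF a(1) l'(1)] .
  have tm: "Amap t ?m = w" using S.Amap_Comp[OF a(1) l'(1)] a(2) l' X0.Ident_right v by simp
  have Id: "Ident X0 (Cod X0 w) \<in> hom X0 (Cod X0 w) (Omap t (Cod X1 ?m))" "Comp X0 (Ident X0 (Cod X0 w)) w = w"
    using X0.Ident_in[OF X0.Cod_in[OF homD(1)[OF w(1)]]] m l' homD[OF w(1)] X0.Ident_left[OF w(1)]
    by (simp_all add: hom_def)
  obtain b where b: "b \<in> hom X1 (Cod X1 (lift X h w)) (Cod X1 (lift X h' w))" "Amap t b = Ident X0 (Cod X0 w)"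
      "Comp X1 b (lift X h w) = ?m"
    using lift_factor[OF v(2) homD(1)[OF w(1)] _ homD(1)[OF m] homD(2)[OF m] Id(1)] Id(2) tm homD[OF m] homD[OF w(1)]
    by auto
  have kid: "Ident X1 k \<in> hom X1 k k" using X1.Ident_in v by simp
  have "Amap t b = Amap s (Ident X1 k)" using b(2) homD[OF w(1)] v by (simp add: s.Amap_Ident)
  then obtain g where g: "g \<in> hom X1 (hcomp (Cod X1 (lift X h w)) k) (hcomp (Cod X1 (lift X h' w)) k)"
      "Amap s g = Amap s b" "Amap t g = Amap t (Ident X1 k)"
    using hcomp_cell[OF b(1) kid] by blast
  have "Comp X0 (Amap s b) (Comp X0 (Amap s (lift X h w)) v) = Comp X0 (Amap s (lift X h' w)) v'"
    using s.Amap_Comp[OF l(1) b(1)] s.Amap_Comp[OF a(1) l'(1)] b(3) a(3)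
      X0.Comp_assoc[OF v(1) s.Amap_in[OF l(1)] s.Amap_in[OF b(1)]]
      X0.Comp_assoc[OF v(1) s.Amap_in[OF a(1)] s.Amap_in[OF l'(1)]] by simp
  moreover have "Omap t (hcomp (Cod X1 (lift X h w)) k) = Omap t k" using hcomp_in[OF l(2) v(7) l(3)] by simp
  ultimately show ?thesis
    unfolding corner_step_def using homD(1)[OF K.Comp_in[OF assms(2,3)]] g v
    by (auto simp: * corner_simps S.Amap_Ident)
qed

text \<open>Lifts compose, so the lift of \<open>w'\<close> along \<open>h\<close> is the lift of
  \<open>w\<close> followed by a lift of \<open>d_1 a\<close>. Pasting this second lift with
  \<open>a\<close> gives the witness.\<close>

lemma corner_step_comp_right:
  assumes "corner_step d d'" "c \<in> hom corner_cat x y" "d \<in> hom corner_cat y z"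
  shows "corner_step (Comp corner_cat d c) (Comp corner_cat d' c)"
proof -
  obtain v h w k w' k' where *: "c = (v, h)" "d = (w, k)" "d' = (w', k')" by (cases c, cases d, cases d')
  obtain a where a: "a \<in> hom X1 k k'" "Amap t a = Ident X0 z" "w' = Comp X0 (Amap s a) w"
    "(w', k') \<in> hom corner_cat y z"
    using assms(1,3) unfolding * by (rule corner_step_hom)
  have v: "v \<in> hom X0 x (Omap s h)" "h \<in> Obj X1" "Omap t h = y" "w \<in> hom X0 (Omap t h) (Omap s k)"
      "k \<in> Obj X1" "Omap t k = z" "k' \<in> Obj X1"
    using assms a(4) by (auto simp add: * corner_simps)
  define j where "j = Cod X1 (lift X h w)"
  note l = lift_s[OF v(2,4), folded j_def]
  have sa: "Amap s a \<in> hom X0 (Omap t j) (Omap s k')" using s.Amap_in[OF a(1)] l by simp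
  note n = lift_s[OF l(2) sa]
  have comp: "lift X h w' = Comp X1 (lift X j (Amap s a)) (lift X h w)"
    using S.lift_Comp[OF v(2,4), of "Amap s a"] s.Amap_in[OF a(1)] a(3) by (simp add: j_def)
  obtain g where g: "g \<in> hom X1 (hcomp j k) (hcomp (Cod X1 (lift X j (Amap s a))) k')"
      "Amap s g = Amap s (lift X j (Amap s a))" "Amap t g = Amap t a"
    using hcomp_cell[OF n(1) a(1) n(4)] by blast
  have cod: "Cod X1 (lift X h w') = Cod X1 (lift X j (Amap s a))"
    using X1.Comp_in[OF l(1) n(1)] comp by (simp add: hom_def)
  have "Comp X0 (Amap s (lift X h w')) v = Comp X0 (Amap s g) (Comp X0 (Amap s (lift X h w)) v)"
    using s.Amap_Comp[OF l(1) n(1)] comp g(2) X0.Comp_assoc[OF v(1) l(5) n(5)] by simp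
  moreover have "Omap t (hcomp j k) = z" using hcomp_in[OF l(2) v(5) l(3)] v by simp
  ultimately show ?thesis
    unfolding corner_step_def using homD(1)[OF K.Comp_in[OF assms(2,3)]] g a(2)
    by (auto simp: * corner_simps cod j_def[symmetric])
qed

lemma equiv_corners_comp:
  assumes "equivclp corner_step c c'" "equivclp corner_step d d'"
    and "c \<in> hom corner_cat x y" "d \<in> hom corner_cat y z"
  shows "equivclp corner_step (Comp corner_cat d c) (Comp corner_cat d' c')"
proof -
  have "equivclp corner_step (Comp corner_cat d c) (Comp corner_cat d c')"
    using assms(1)
  proof (induction rule: equivclp_induct)
    case (step c' c'')
    then have "c' \<in> hom corner_cat x y" "c'' \<in> hom corner_cat x y"
      using equiv_corners_parallel[OF step(1)] corner_step_parallel[of c' c''] corner_step_parallel[of c'' c']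
        assms(3) by (auto simp: hom_def)
    then have "equivclp corner_step (Comp corner_cat d c') (Comp corner_cat d c'')"
      using step(2) corner_step_comp_left[OF _ _ assms(4)] by blast
    with step.IH show ?case by (rule equivclp_trans)
  qed simp
  also have "equivclp corner_step (Comp corner_cat d c') (Comp corner_cat d' c')"
    using assms(2)
  proof (induction rule: equivclp_induct)
    case (step d' d'')
    have c': "c' \<in> hom corner_cat x y" using equiv_corners_parallel[OF assms(1)] assms(3) by blast
    have "d' \<in> hom corner_cat y z" "d'' \<in> hom corner_cat y z"
      using step equiv_corners_parallel[OF step(1)] corner_step_parallel[of d' d''] corner_step_parallel[of d'' d']
        assms(4) by (auto simp: hom_def)
    then have "equivclp corner_step (Comp corner_cat d' c') (Comp corner_cat d'' c')"
      using step(2) corner_step_comp_right[OF _ c'] by blast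
    with step.IH show ?case by (rule equivclp_trans)
  qed simp
  finally show ?thesis .
qed

text \<open>
  Codes of equivalence classes of corners in \<open>'u\<close>: the universal property of a codescent object only
  tests against vertices on that type.
\<close>

definition corner_code :: "'u \<times> 'u \<Rightarrow> 'u" where
  "corner_code c = (let r = (SOME r. equivclp corner_step c r) in pair (fst r) (snd r))"

lemma corner_code_eq_iff: "corner_code c = corner_code c' \<longleftrightarrow> equivclp corner_step c c'"
proof
  have *: "equivclp corner_step c (SOME r. equivclp corner_step c r)" for c
    by (rule someI[of _ c]) simp
  assume "corner_code c = corner_code c'"
  then have "(SOME r. equivclp corner_step c r) = (SOME r. equivclp corner_step c' r)"
    by (simp add: corner_code_def Let_def prod_eq_iff)
  then show "equivclp corner_step c c'" using *[of c] *[of c'] by (metis equivclp_sym equivclp_trans)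
next
  assume "equivclp corner_step c c'"
  then have "equivclp corner_step c = equivclp corner_step c'"
    by (intro ext) (blast intro: equivclp_sym equivclp_trans)
  then show "corner_code c = corner_code c'" by (simp add: corner_code_def)
qed

sublocale M: arrow_congruence corner_cat corner_code
proof
  fix m m' assume "m \<in> Arr corner_cat" "m' \<in> Arr corner_cat" "corner_code m = corner_code m'"
  then show "Dom corner_cat m = Dom corner_cat m' \<and> Cod corner_cat m = Cod corner_cat m'"
    using equiv_corners_parallel[of m m' "Dom corner_cat m" "Cod corner_cat m"]
    by (auto simp: corner_code_eq_iff hom_def)
next
  fix m m' n n' x y z
  assume "m \<in> hom corner_cat x y" "n \<in> hom corner_cat y z" "corner_code m = corner_code m'" "corner_code n = corner_code n'"
  then show "corner_code (Comp corner_cat n m) = corner_code (Comp corner_cat n' m')"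
    using equiv_corners_comp by (simp add: corner_code_eq_iff)
qed

end

section \<open>Codescent objects of crossed double categories\<close>

context universal_crossed_double_category begin

text \<open>By the Segal condition the objects of \<open>X2\<close> are exactly the composable
  pairs, so the condition indexed by \<open>X2\<close> becomes multiplicativity over
  \<open>hcomp\<close>.\<close>

lemma codescent_cocone_iff:
  "codescent_cocone X W g0 g1 \<longleftrightarrow> is_functor X0 W g0 \<and> g1 \<in> extensional (Obj X1) \<and>
    (\<forall>h\<in>Obj X1. g1 h \<in> hom W (Omap g0 (Omap s h)) (Omap g0 (Omap t h))) \<and>
    (\<forall>h h' m. m \<in> hom X1 h h' \<longrightarrow> Comp W (g1 h') (Amap g0 (Amap s m)) = Comp W (Amap g0 (Amap t m)) (g1 h)) \<and>
    (\<forall>x\<in>Obj X0. g1 (Omap i0 x) = Ident W (Omap g0 x)) \<and>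
    (\<forall>x\<in>Obj X1. \<forall>y\<in>Obj X1. Omap t x = Omap s y \<longrightarrow> Comp W (g1 y) (g1 x) = g1 (hcomp x y))"
    (is "?l \<longleftrightarrow> ?r")
proof -
  have nt: "nat_trans X1 W (func_comp X1 g0 s) (func_comp X1 g0 t) g1 \<longleftrightarrow>
      g1 \<in> extensional (Obj X1) \<and>
      (\<forall>h\<in>Obj X1. g1 h \<in> hom W (Omap g0 (Omap s h)) (Omap g0 (Omap t h))) \<and>
      (\<forall>h h' m. m \<in> hom X1 h h' \<longrightarrow>
        Comp W (g1 h') (Amap g0 (Amap s m)) = Comp W (Amap g0 (Amap t m)) (g1 h))" if "is_functor X0 W g0"
    using func_comp_functor[OF s.is_functor_axioms that] func_comp_functor[OF S.is_functor_axioms that]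
    by (auto simp: nat_trans_def nat_trans_axioms_def func_comp_simps homD)
  have hc: "(\<forall>z\<in>Obj X2. Comp W (g1 (Omap e0 z)) (g1 (Omap e2 z)) = g1 (Omap e1 z)) \<longleftrightarrow>
      (\<forall>x\<in>Obj X1. \<forall>y\<in>Obj X1. Omap t x = Omap s y \<longrightarrow> Comp W (g1 y) (g1 x) = g1 (hcomp x y))"
  proof (intro iffI ballI impI)
    fix x y assume a: "\<forall>z\<in>Obj X2. Comp W (g1 (Omap e0 z)) (g1 (Omap e2 z)) = g1 (Omap e1 z)"
      "x \<in> Obj X1" "y \<in> Obj X1" "Omap t x = Omap s y"
    then obtain z where "z \<in> Obj X2" "Omap e2 z = x" "Omap e0 z = y" using segal_ex(1) by blast
    with a e1_hcomp show "Comp W (g1 y) (g1 x) = g1 (hcomp x y)" by auto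
  next
    fix z assume a: "\<forall>x\<in>Obj X1. \<forall>y\<in>Obj X1. Omap t x = Omap s y \<longrightarrow> Comp W (g1 y) (g1 x) = g1 (hcomp x y)"
      "z \<in> Obj X2"
    then show "Comp W (g1 (Omap e0 z)) (g1 (Omap e2 z)) = g1 (Omap e1 z)"
      using e1_hcomp[OF a(2)] e0.Omap_Obj[OF a(2)] e2.Omap_Obj[OF a(2)] faces_2(2)[OF a(2)] by simp
  qed
  show ?thesis
    using nt hc simplicial_cat_axioms
    by (auto simp: codescent_cocone_def codescent_cocone_axioms_def numeral_2_eq_2)
qed

definition corner_vertical :: "('u, 'u, 'u, 'u) func" where
  "corner_vertical = \<lparr>Omap = \<lambda>x\<in>Obj X0. x, Amap = \<lambda>v\<in>Arr X0. corner_code (v, Omap i0 (Cod X0 v))\<rparr>"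

definition corner_horizontal :: "'u \<Rightarrow> 'u" where
  "corner_horizontal = (\<lambda>h\<in>Obj X1. corner_code (Ident X0 (Omap s h), h))"

lemma vertical_in: "v \<in> hom X0 x y \<Longrightarrow> (v, Omap i0 y) \<in> hom corner_cat x y"
  using X0.hom_objs[of v x y] i0.Omap_Obj[of y] by (simp add: corner_simps unit_faces)

lemma horizontal_in: "h \<in> Obj X1 \<Longrightarrow> (Ident X0 (Omap s h), h) \<in> hom corner_cat (Omap s h) (Omap t h)"
  using X0.Ident_in s.Omap_Obj by (simp add: corner_simps)

text \<open>Along a unit the chosen lift is the degenerate square, so sliding across it changes
  nothing.\<close>

lemma comp_verticals:
  assumes "v \<in> hom X0 x y" "w \<in> hom X0 y z"
  shows "Comp corner_cat (w, Omap i0 z) (v, Omap i0 y) = (Comp X0 w v, Omap i0 z)"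
proof -
  have "lift X (Omap i0 y) w = Amap i0 w" using lift_unit[of w] assms(2) by (simp add: hom_def)
  moreover have "hcomp (Omap i0 z) (Omap i0 z) = Omap i0 z"
    using hcomp_unit_left[of "Omap i0 z"] X0.hom_objs[OF assms(2)] i0.Omap_Obj unit_faces by simp
  ultimately show ?thesis
    using assms(2) i0.Cod_Amap[of w] unit_faces by (auto simp: corner_simps hom_def)
qed

text \<open>The decomposition of corners into vertical and horizontal ones. It makes the value of a
  functor on a corner computable from a cocone.\<close>

lemma vertical_horizontal:
  assumes "v \<in> Arr X0" "h \<in> Obj X1" "Cod X0 v = Omap s h"
  shows "Comp corner_cat (Ident X0 (Omap s h), h) (v, Omap i0 (Omap s h)) = (v, h)"
proof -
  have o: "Omap s h \<in> Obj X0" using s.Omap_Obj assms(2) .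
  have l: "lift X (Omap i0 (Omap s h)) (Ident X0 (Omap s h)) = Ident X1 (Omap i0 (Omap s h))"
    using lift_unit[of "Ident X0 (Omap s h)"] X0.Ident_in[OF o] o by (auto simp: hom_def i0.Amap_Ident)
  have v: "v \<in> hom X0 (Dom X0 v) (Omap s h)" using assms by (simp add: hom_def)
  show ?thesis
    using l homD[OF X1.Ident_in[OF i0.Omap_Obj[OF o]]] s.Amap_Ident[OF i0.Omap_Obj[OF o]]
    by (simp add: corner_simps unit_faces o X0.Ident_left[OF v] hcomp_unit_left[OF assms(2)])
qed

text \<open>The vertical arrow to be slid is an identity, and its chosen lift is an identity
  square.\<close>

lemma comp_horizontals:
  assumes "x \<in> Obj X1" "y \<in> Obj X1" "Omap t x = Omap s y"
  shows "Comp corner_cat (Ident X0 (Omap s y), y) (Ident X0 (Omap s x), x) =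
    (Ident X0 (Omap s (hcomp x y)), hcomp x y)"
  using S.lift_Ident[OF assms(1)] assms homD[OF X1.Ident_in[OF assms(1)]] hcomp_in[OF assms]
    X0.Ident_left[OF X0.Ident_in[OF s.Omap_Obj[OF assms(1)]]]
  by (simp add: corner_simps s.Amap_Ident)

lemma corner_vertical_functor: "is_functor X0 M.Q corner_vertical"
proof -
  interpret Q: category M.Q by (rule M.image_is_category)
  show ?thesis
  proof
    show "Omap corner_vertical \<in> Obj X0 \<rightarrow>\<^sub>E Obj M.Q"
      by (auto simp: corner_vertical_def M.Obj_image corner_simps)
    show "Amap corner_vertical \<in> extensional (Arr X0)" by (simp add: corner_vertical_def)
  next
    fix v x y assume v: "v \<in> hom X0 x y"
    then show "Amap corner_vertical v \<in> hom M.Q (Omap corner_vertical x) (Omap corner_vertical y)"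
      using M.hom_image[OF vertical_in[OF v]] X0.hom_objs[OF v] homD[OF v] by (simp add: corner_vertical_def)
  next
    fix x assume x: "x \<in> Obj X0"
    then show "Amap corner_vertical (Ident X0 x) = Ident M.Q (Omap corner_vertical x)"
      using homD[OF X0.Ident_in[OF x]] by (simp add: corner_vertical_def M.Ident_image corner_simps)
  next
    fix v w x y z assume vw: "v \<in> hom X0 x y" "w \<in> hom X0 y z"
    then show "Amap corner_vertical (Comp X0 w v) = Comp M.Q (Amap corner_vertical w) (Amap corner_vertical v)"
      using homD[OF vw(1)] homD[OF vw(2)] homD[OF X0.Comp_in[OF vw]]
      by (simp add: corner_vertical_def M.Comp_image[OF vertical_in[OF vw(1)] vertical_in[OF vw(2)]] comp_verticals[OF vw])
  qed
qed

lemma corner_cocone: "codescent_cocone X M.Q corner_vertical corner_horizontal"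
  unfolding codescent_cocone_iff
proof (intro conjI ballI allI impI)
  show "is_functor X0 M.Q corner_vertical" by (rule corner_vertical_functor)
  show "corner_horizontal \<in> extensional (Obj X1)" by (simp add: corner_horizontal_def)
next
  fix h assume "h \<in> Obj X1"
  then show "corner_horizontal h \<in> hom M.Q (Omap corner_vertical (Omap s h)) (Omap corner_vertical (Omap t h))"
    using M.hom_image[OF horizontal_in] s.Omap_Obj S.Omap_Obj
    by (simp add: corner_horizontal_def corner_vertical_def)
next
  fix h h' a assume a: "a \<in> hom X1 h h'"
  note o = X1.hom_objs[OF a]
  have sa: "Amap s a \<in> hom X0 (Omap s h) (Omap s h')" and ta: "Amap t a \<in> hom X0 (Omap t h) (Omap t h')"
    using s.Amap_in[OF a] S.Amap_in[OF a] by simp_all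
  note l = lift_s[OF o(1) ta]
  have Id: "Ident X0 (Cod X0 (Amap t a)) \<in> hom X0 (Cod X0 (Amap t a)) (Omap t (Cod X1 a))"
    using homD[OF ta] homD[OF a] X0.Ident_in[OF X0.hom_objs(2)[OF ta]] by simp
  \<comment> \<open>Naturality is required at every square, not only over identities. Splitting off
    the lift of the target side of \<open>a\<close> leaves \<open>b\<close> over an identity, so the
    two sides of the equation differ by a single \<open>corner_step\<close>.\<close>
  obtain b where b: "b \<in> hom X1 (Cod X1 (lift X h (Amap t a))) h'" "Amap t b = Ident X0 (Omap t h')"
      "Comp X1 b (lift X h (Amap t a)) = a"
    using lift_factor[OF o(1) homD(1)[OF ta] homD(2)[OF ta] homD(1)[OF a] homD(2)[OF a] Id]
      X0.Ident_left[OF ta] homD[OF ta] homD[OF a] by auto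
  have 1: "Comp corner_cat (Ident X0 (Omap s h'), h') (Amap s a, Omap i0 (Omap s h')) = (Amap s a, h')"
    by (rule vertical_horizontal) (use sa o in \<open>simp_all add: hom_def\<close>)
  have 2: "Comp corner_cat (Amap t a, Omap i0 (Omap t h')) (Ident X0 (Omap s h), h) =
      (Amap s (lift X h (Amap t a)), Cod X1 (lift X h (Amap t a)))"
    using l hcomp_unit_right[OF l(2)] X0.Ident_right[OF l(5)] by (simp add: corner_simps)
  have "corner_step (Amap s (lift X h (Amap t a)), Cod X1 (lift X h (Amap t a))) (Amap s a, h')"
    unfolding corner_step_def using b l s.Amap_Comp[OF l(1) b(1)] by (auto simp: corner_simps hom_def)
  then have "corner_code (Amap s (lift X h (Amap t a)), Cod X1 (lift X h (Amap t a))) = corner_code (Amap s a, h')"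
    by (auto simp: corner_code_eq_iff)
  then have "Comp M.Q (corner_code (Ident X0 (Omap s h'), h')) (corner_code (Amap s a, Omap i0 (Omap s h'))) =
      Comp M.Q (corner_code (Amap t a, Omap i0 (Omap t h'))) (corner_code (Ident X0 (Omap s h), h))"
    by (simp add: M.Comp_image[OF vertical_in[OF sa] horizontal_in[OF o(2)]] 1
      M.Comp_image[OF horizontal_in[OF o(1)] vertical_in[OF ta]] 2)
  then show "Comp M.Q (corner_horizontal h') (Amap corner_vertical (Amap s a)) =
      Comp M.Q (Amap corner_vertical (Amap t a)) (corner_horizontal h)"
    using o homD[OF sa] homD[OF ta] by (simp add: corner_horizontal_def corner_vertical_def)
next
  fix x assume "x \<in> Obj X0"
  then show "corner_horizontal (Omap i0 x) = Ident M.Q (Omap corner_vertical x)"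
    using i0.Omap_Obj by (simp add: corner_horizontal_def corner_vertical_def M.Ident_image corner_simps unit_faces)
next
  fix x y assume xy: "x \<in> Obj X1" "y \<in> Obj X1" "Omap t x = Omap s y"
  have y: "(Ident X0 (Omap s y), y) \<in> hom corner_cat (Omap t x) (Omap t y)" using horizontal_in xy by simp
  show "Comp M.Q (corner_horizontal y) (corner_horizontal x) = corner_horizontal (hcomp x y)"
    using xy hcomp_in[OF xy] comp_horizontals[OF xy]
    by (simp add: corner_horizontal_def M.Comp_image[OF horizontal_in[OF xy(1)] y])
qed

end

section \<open>Arrows of a codescent object as classes of corners\<close>

locale universal_codescent = universal_crossed_double_category X
  for X :: "('u::infinite, 'u) crossed_double_cat" +
  fixes Z :: "('u, 'u) category" and k0 :: "('u, 'u, 'u, 'u) func" and k1 :: "'u \<Rightarrow> 'u"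
  assumes codescent: "codescent_object X Z k0 k1"
begin

lemma cocone: "codescent_cocone X Z k0 k1"
  using codescent by (simp add: codescent_object_def)

sublocale k0: is_functor X0 Z k0
  using cocone unfolding codescent_cocone_iff by blast

lemma k1_hom: "h \<in> Obj X1 \<Longrightarrow> k1 h \<in> hom Z (Omap k0 (Omap s h)) (Omap k0 (Omap t h))"
  and k1_natural: "m \<in> hom X1 h h' \<Longrightarrow>
    Comp Z (k1 h') (Amap k0 (Amap s m)) = Comp Z (Amap k0 (Amap t m)) (k1 h)"
  and k1_unit: "x \<in> Obj X0 \<Longrightarrow> k1 (Omap i0 x) = Ident Z (Omap k0 x)"
  and k1_hcomp: "x \<in> Obj X1 \<Longrightarrow> y \<in> Obj X1 \<Longrightarrow> Omap t x = Omap s y \<Longrightarrow> Comp Z (k1 y) (k1 x) = k1 (hcomp x y)"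
  and k1_ext: "k1 \<in> extensional (Obj X1)"
  using cocone unfolding codescent_cocone_iff by blast+

text \<open>The arrow part of the canonical functor from corners to the codescent object.\<close>

definition edge :: "'u \<times> 'u \<Rightarrow> 'u" where
  "edge c = Comp Z (k1 (snd c)) (Amap k0 (fst c))"

lemma edge_in: "c \<in> hom corner_cat x y \<Longrightarrow> edge c \<in> hom Z (Omap k0 x) (Omap k0 y)"
  using k0.B.Comp_in[OF k0.Amap_in k1_hom] by (auto simp: edge_def elim!: corner_homE)

text \<open>Composing corners slides \<open>w\<close> across \<open>h\<close>; in \<open>Z\<close>
  this is naturality of \<open>k1\<close> at the square \<open>lift X h w\<close>.\<close>

lemma edge_Comp:
  assumes "c \<in> hom corner_cat x y" "d \<in> hom corner_cat y z"
  shows "edge (Comp corner_cat d c) = Comp Z (edge d) (edge c)"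
proof -
  obtain v h where c: "c = (v, h)" "v \<in> hom X0 x (Omap s h)" "h \<in> Obj X1" "Omap t h = y"
    using assms(1) by (rule corner_homE)
  obtain w k where d: "d = (w, k)" "w \<in> hom X0 y (Omap s k)" "k \<in> Obj X1" "Omap t k = z"
    using assms(2) by (rule corner_homE)
  have w: "w \<in> hom X0 (Omap t h) (Omap s k)" using c d by simp
  define j where "j = Cod X1 (lift X h w)"
  note l = lift_s[OF c(3) w, folded j_def]
  have n: "Comp Z (k1 j) (Amap k0 (Amap s (lift X h w))) = Comp Z (Amap k0 w) (k1 h)"
    using k1_natural[OF l(1)] l(4) by simp
  note v0 = k0.Amap_in[OF c(2)] and w0 = k0.Amap_in[OF w] and l0 = k0.Amap_in[OF l(5)]
  note h1 = k1_hom[OF c(3)] and k1' = k1_hom[OF d(3)]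
  have j1: "k1 j \<in> hom Z (Omap k0 (Omap s j)) (Omap k0 (Omap s k))" using k1_hom[OF l(2)] l(3) by simp
  have "edge (Comp corner_cat d c) = Comp Z (k1 (hcomp j k)) (Amap k0 (Comp X0 (Amap s (lift X h w)) v))"
    by (simp add: edge_def c d corner_simps j_def)
  also have "\<dots> = Comp Z (Comp Z (k1 k) (k1 j)) (Comp Z (Amap k0 (Amap s (lift X h w))) (Amap k0 v))"
    using k1_hcomp[OF l(2) d(3) l(3)] k0.Amap_Comp[OF c(2) l(5)] by simp
  also have "\<dots> = Comp Z (k1 k) (Comp Z (Comp Z (k1 j) (Amap k0 (Amap s (lift X h w)))) (Amap k0 v))"
    using k0.B.Comp_assoc[OF v0 l0 j1] k0.B.Comp_assoc[OF k0.B.Comp_in[OF v0 l0] j1 k1'] by simp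
  also have "\<dots> = Comp Z (k1 k) (Comp Z (Amap k0 w) (Comp Z (k1 h) (Amap k0 v)))"
    using n k0.B.Comp_assoc[OF v0 h1 w0] by simp
  also have "\<dots> = Comp Z (edge d) (edge c)"
    using k0.B.Comp_assoc[OF k0.B.Comp_in[OF v0 h1] w0 k1'] by (simp add: edge_def c d)
  finally show ?thesis .
qed

lemma edge_vertical: "v \<in> hom X0 x y \<Longrightarrow> edge (v, Omap i0 y) = Amap k0 v"
  using X0.hom_objs[of v x y] k0.Amap_in[of v x y] k0.B.Ident_left by (auto simp: edge_def k1_unit)

lemma edge_horizontal: "h \<in> Obj X1 \<Longrightarrow> edge (Ident X0 (Omap s h), h) = k1 h"
  using k1_hom[of h] k0.B.Ident_right s.Omap_Obj by (auto simp: edge_def k0.Amap_Ident)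

text \<open>
  The arrows \<open>edge c\<close> form a subcategory of \<open>Z\<close> through which the universal cocone factors,
  hence they are all arrows of \<open>Z\<close>.
\<close>

lemma Z_generated:
  shows "Obj Z = Omap k0 ` Obj X0" and "Arr Z = edge ` Arr corner_cat"
proof -
  let ?W = "Z\<lparr>Obj := Omap k0 ` Obj X0, Arr := edge ` Arr corner_cat\<rparr>"
  \<comment> \<open>Closure of the edges under composition needs composable edges to come from
    composable corners, hence injectivity of \<open>k0\<close> on objects. The cocone of corners is
    the identity on objects and therefore detects this.\<close>
  obtain G where G: "is_functor Z M.Q G" "func_comp X0 G k0 = corner_vertical"
    using codescent corner_cocone unfolding codescent_object_def by blast
  have inj: "x = y" if "x \<in> Obj X0" "y \<in> Obj X0" "Omap k0 x = Omap k0 y" for x y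
    using that func_comp_simps(1)[of x X0 G k0] func_comp_simps(1)[of y X0 G k0]
    by (simp add: G(2) corner_vertical_def)
  have Whom: "hom ?W (Omap k0 x) (Omap k0 y) = edge ` hom corner_cat x y" if "x \<in> Obj X0" "y \<in> Obj X0" for x y
  proof -
    have "c \<in> hom corner_cat x y" if c: "c \<in> Arr corner_cat" "Dom Z (edge c) = Omap k0 x" "Cod Z (edge c) = Omap k0 y" for c
      using edge_in[OF K.arr_hom[OF c(1)]] K.Dom_in[OF c(1)] K.Cod_in[OF c(1)] c \<open>x \<in> Obj X0\<close> \<open>y \<in> Obj X0\<close> inj
      by (auto simp: hom_def corner_simps)
    then show ?thesis using edge_in by (auto simp: hom_def)
  qed
  have Wobj: "\<exists>x y. x \<in> Obj X0 \<and> y \<in> Obj X0 \<and> a = Omap k0 x \<and> b = Omap k0 y \<and> m \<in> edge ` hom corner_cat x y"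
    if "m \<in> hom ?W a b" for m a b
  proof -
    have "m \<in> edge ` Arr corner_cat" using that by (simp add: hom_def)
    then obtain c where c: "c \<in> Arr corner_cat" "m = edge c" by blast
    show ?thesis
      using edge_in[OF K.arr_hom[OF c(1)]] K.Dom_in[OF c(1)] K.Cod_in[OF c(1)] K.arr_hom[OF c(1)] that c
      by (auto simp: hom_def corner_simps)
  qed
  have sub: "hom ?W a b \<subseteq> hom Z a b" for a b
    using edge_in K.arr_hom by (auto simp: hom_def) 
  have Wcat: "category ?W"
  proof
    fix m assume "m \<in> Arr ?W"
    then show "Dom ?W m \<in> Obj ?W" "Cod ?W m \<in> Obj ?W" using Wobj[of m "Dom Z m" "Cod Z m"] by (auto simp: hom_def)
  next
    fix a assume "a \<in> Obj ?W"
    then obtain x where x: "x \<in> Obj X0" "a = Omap k0 x" by auto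
    have "edge (Ident corner_cat x) = Ident Z a"
      using edge_vertical[OF X0.Ident_in[OF x(1)]] x by (simp add: corner_simps k0.Amap_Ident)
    moreover have "edge (Ident corner_cat x) \<in> hom ?W a a"
      unfolding x(2) Whom[OF x(1) x(1)] using K.Ident_in[of x] x(1) by (intro imageI) (simp add: corner_simps(1))
    ultimately show "Ident ?W a \<in> hom ?W a a" by simp
  next
    fix m n a b c assume mn: "m \<in> hom ?W a b" "n \<in> hom ?W b c"
    obtain x y d where m: "x \<in> Obj X0" "y \<in> Obj X0" "a = Omap k0 x" "b = Omap k0 y" "d \<in> hom corner_cat x y" "m = edge d"
      using Wobj[OF mn(1)] by blast
    obtain y' z d' where n: "y' \<in> Obj X0" "z \<in> Obj X0" "b = Omap k0 y'" "c = Omap k0 z" "d' \<in> hom corner_cat y' z" "n = edge d'"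
      using Wobj[OF mn(2)] by blast
    have "y' = y" using inj m n by simp
    then have "Comp Z n m = edge (Comp corner_cat d' d)" "Comp corner_cat d' d \<in> hom corner_cat x z"
      using edge_Comp[OF m(5)] K.Comp_in[OF m(5)] m n by simp_all
    then show "Comp ?W n m \<in> hom ?W a c" using Whom m n by auto
  next
    fix m a b assume "m \<in> hom ?W a b"
    then have "m \<in> hom Z a b" using sub by blast
    then show "Comp ?W (Ident ?W b) m = m" "Comp ?W m (Ident ?W a) = m"
      using k0.B.Ident_left k0.B.Ident_right by auto
  next
    fix l m n a b c d assume "l \<in> hom ?W a b" "m \<in> hom ?W b c" "n \<in> hom ?W c d"
    then have "l \<in> hom Z a b" "m \<in> hom Z b c" "n \<in> hom Z c d" using sub by blast+
    then show "Comp ?W n (Comp ?W m l) = Comp ?W (Comp ?W n m) l" using k0.B.Comp_assoc by simp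
  qed
  have k0W: "is_functor X0 ?W k0"
  proof (intro is_functor.intro is_functor_axioms.intro X0.category_axioms Wcat)
    show "Omap k0 \<in> Obj X0 \<rightarrow>\<^sub>E Obj ?W" using k0.Omap_in by auto
    show "Amap k0 \<in> extensional (Arr X0)" by (rule k0.Amap_ext)
  next
    fix m x y assume m: "m \<in> hom X0 x y"
    then show "Amap k0 m \<in> hom ?W (Omap k0 x) (Omap k0 y)"
      using Whom[OF X0.hom_objs[OF m]] vertical_in[OF m] edge_vertical[OF m] by (metis image_eqI)
  qed (simp_all add: k0.Amap_Ident k0.Amap_Comp)
  have "codescent_cocone X ?W k0 k1"
    unfolding codescent_cocone_iff
  proof (intro conjI ballI allI impI k0W k1_ext)
    fix h assume h: "h \<in> Obj X1"
    then show "k1 h \<in> hom ?W (Omap k0 (Omap s h)) (Omap k0 (Omap t h))"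
      using Whom[OF s.Omap_Obj[OF h] S.Omap_Obj[OF h]] horizontal_in[OF h] edge_horizontal[OF h] by (metis image_eqI)
  qed (simp_all add: k1_natural k1_unit k1_hcomp)
  then obtain H where H: "is_functor Z ?W H" "func_comp X0 H k0 = k0" "compose (Obj X1) (Amap H) k1 = k1"
    using codescent unfolding codescent_object_def One_nat_def by blast
  interpret H: is_functor Z ?W H by fact
  have HZ: "is_functor Z Z H"
  proof (intro is_functor.intro is_functor_axioms.intro k0.B.category_axioms)
    show "Omap H \<in> Obj Z \<rightarrow>\<^sub>E Obj Z" by (rule subsetD[OF PiE_mono H.Omap_in]) (use k0.Omap_Obj in auto)
    show "Amap H \<in> extensional (Arr Z)" by (rule H.Amap_ext)
    show "Amap H m \<in> hom Z (Omap H x) (Omap H y)" if "m \<in> hom Z x y" for m x y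
      using H.Amap_in[OF that] sub by blast
  qed (use H.Amap_Ident H.Amap_Comp in auto)
  \<comment> \<open>Regarded as an endofunctor of \<open>Z\<close>, \<open>H\<close> restricts to
    the universal cocone, and so does the identity. Uniqueness makes them equal, and the image of
    \<open>H\<close> lies in the subcategory.\<close>
  have u: "\<exists>!G. is_functor Z Z G \<and> func_comp X0 G k0 = k0 \<and> compose (Obj X1) (Amap G) k1 = k1"
    using codescent unfolding codescent_object_def One_nat_def by blast
  have idk: "func_comp X0 (id_func Z) k0 = k0"
    by (rule func_comp_eqI[OF k0.is_functor_axioms]) (simp_all add: id_func_def k0.Omap_Obj k0.Amap_Arr)
  have idk1: "compose (Obj X1) (Amap (id_func Z)) k1 = k1"
    by (rule extensionalityI[OF _ k1_ext])
      (use homD(1)[OF k1_hom] in \<open>auto simp: compose_def id_func_def\<close>)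
  have eq: "H = id_func Z"
    using u HZ H idk idk1 id_functor[OF k0.B.category_axioms] by blast
  have "z \<in> Omap k0 ` Obj X0" if "z \<in> Obj Z" for z
    using H.Omap_Obj[OF that] that by (simp add: eq id_func_def)
  then show "Obj Z = Omap k0 ` Obj X0" using k0.Omap_Obj by blast
  have "m \<in> edge ` Arr corner_cat" if "m \<in> Arr Z" for m
    using H.Amap_Arr[OF that] that by (simp add: eq id_func_def)
  then show "Arr Z = edge ` Arr corner_cat" using edge_in[OF K.arr_hom] by (auto dest: homD)
qed

text \<open>This functor recovers the class of a corner from its image in \<open>Z\<close>.
  Injectivity of \<open>k0\<close> on objects and the description of equality between edges both
  follow from it.\<close>

lemma corner_functor:
  obtains G where "is_functor Z M.Q G" "\<And>x. x \<in> Obj X0 \<Longrightarrow> Omap G (Omap k0 x) = x"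
    "\<And>c. c \<in> Arr corner_cat \<Longrightarrow> Amap G (edge c) = corner_code c"
proof -
  obtain G where G: "is_functor Z M.Q G" "func_comp X0 G k0 = corner_vertical"
      "compose (Obj X1) (Amap G) k1 = corner_horizontal"
    using codescent corner_cocone unfolding codescent_object_def One_nat_def by blast
  interpret G: is_functor Z M.Q G by fact
  show thesis
  proof (rule that[OF G(1)])
    show "Omap G (Omap k0 x) = x" if "x \<in> Obj X0" for x
      using that func_comp_simps(1)[OF that, of G k0] by (simp add: G(2) corner_vertical_def)
  next
    fix c assume c: "c \<in> Arr corner_cat"
    obtain v h where *: "c = (v, h)" "v \<in> Arr X0" "h \<in> Obj X1" "Cod X0 v = Omap s h"
      using c by (cases c) (simp add: corner_simps)
    have v: "v \<in> hom X0 (Dom X0 v) (Omap s h)" using * by (simp add: hom_def)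
    have "Amap G (k1 h) = corner_code (Ident X0 (Omap s h), h)"
      using fun_cong[OF G(3), of h] * by (simp add: compose_def corner_horizontal_def)
    moreover have "Amap G (Amap k0 v) = corner_code (v, Omap i0 (Omap s h))"
      using func_comp_simps(2)[OF *(2), of G k0] * by (simp add: G(2) corner_vertical_def)
    ultimately show "Amap G (edge c) = corner_code c"
      using G.Amap_Comp[OF k0.Amap_in[OF v] k1_hom[OF *(3)]] vertical_horizontal[OF *(2-4)]
        M.Comp_image[OF vertical_in[OF v] horizontal_in[OF *(3)]] by (simp add: edge_def *(1))
  qed
qed

lemma k0_inj: "x \<in> Obj X0 \<Longrightarrow> y \<in> Obj X0 \<Longrightarrow> Omap k0 x = Omap k0 y \<Longrightarrow> x = y"
  by (rule corner_functor) metis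

lemma edge_eqD:
  assumes "c \<in> Arr corner_cat" "c' \<in> Arr corner_cat" "edge c = edge c'"
  shows "equivclp corner_step c c'"
  by (rule corner_functor) (metis assms corner_code_eq_iff)

lemma edgeE:
  assumes "m \<in> hom Z (Omap k0 x) (Omap k0 y)" "x \<in> Obj X0" "y \<in> Obj X0"
  obtains v h where "v \<in> hom X0 x (Omap s h)" "h \<in> Obj X1" "Omap t h = y" "m = Comp Z (k1 h) (Amap k0 v)"
proof -
  obtain c where c: "c \<in> Arr corner_cat" "m = edge c" using homD(1)[OF assms(1)] Z_generated(2) by blast
  have "c \<in> hom corner_cat x y"
    using edge_in[OF K.arr_hom[OF c(1)]] assms c k0_inj K.Dom_in[OF c(1)] K.Cod_in[OF c(1)]
    by (auto simp: hom_def corner_simps)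
  then obtain v h where "c = (v, h)" "v \<in> hom X0 x (Omap s h)" "h \<in> Obj X1" "Omap t h = y"
    by (rule corner_homE)
  then show thesis using that[of v h] c by (simp add: edge_def)
qed

end

section \<open>Exact squares\<close>

text \<open>For fixed \<open>a\<close> and \<open>b\<close> these triples are the elements of the
  coproduct over \<open>x\<close> of \<open>B(qx,b) \<times> A(a,px)\<close>. The relation generated
  by \<open>factorisation_step\<close> is the one that turns this coproduct into the coend of the
  exactness criterion.\<close>

definition factorisation ::
  "('o1, 'a1) category \<Rightarrow> ('o2, 'a2) category \<Rightarrow> ('o3, 'a3) category \<Rightarrow>
   ('o1, 'a1, 'o2, 'a2) func \<Rightarrow> ('o1, 'a1, 'o3, 'a3) func \<Rightarrow> 'o2 \<Rightarrow> 'o3 \<Rightarrow> 'o1 \<times> 'a3 \<times> 'a2 \<Rightarrow> bool" where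
  "factorisation P A B p q a b = (\<lambda>(x, u, m). x \<in> Obj P \<and> u \<in> hom B (Omap q x) b \<and> m \<in> hom A a (Omap p x))"

definition factorisation_step ::
  "('o1, 'a1) category \<Rightarrow> ('o2, 'a2) category \<Rightarrow> ('o3, 'a3) category \<Rightarrow>
   ('o1, 'a1, 'o2, 'a2) func \<Rightarrow> ('o1, 'a1, 'o3, 'a3) func \<Rightarrow> 'o2 \<Rightarrow> 'o3 \<Rightarrow>
   'o1 \<times> 'a3 \<times> 'a2 \<Rightarrow> 'o1 \<times> 'a3 \<times> 'a2 \<Rightarrow> bool" where
  "factorisation_step P A B p q a b = (\<lambda>(x, u, m) (x', u', m').
     factorisation P A B p q a b (x, u, m) \<and> factorisation P A B p q a b (x', u', m') \<and>
     (\<exists>n \<in> hom P x x'. Comp B u' (Amap q n) = u \<and> Comp A (Amap p n) m = m'))"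

text \<open>
  The two hypotheses say that \<open>\<integral>\<^sup>x B(qx,b) \<times> A(a,px) \<rightarrow> C(fa,gb)\<close> is surjective and injective.
\<close>

lemma exact_squareI:
  fixes P :: "('o1, 'a1) category" and A :: "('o2, 'a2) category"
    and B :: "('o3, 'a3) category" and C :: "('o4, 'a4) category"
  assumes fs: "is_functor P A p" "is_functor P B q" "is_functor A C f" "is_functor B C g"
    and comm: "func_comp P f p = func_comp P g q"
    and ex: "\<And>a b w. a \<in> Obj A \<Longrightarrow> b \<in> Obj B \<Longrightarrow> w \<in> hom C (Omap f a) (Omap g b) \<Longrightarrow>
      \<exists>x u m. factorisation P A B p q a b (x, u, m) \<and> Comp C (Amap g u) (Amap f m) = w"
    and conn: "\<And>a b x u m x' u' m'. a \<in> Obj A \<Longrightarrow> b \<in> Obj B \<Longrightarrow>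
      factorisation P A B p q a b (x, u, m) \<Longrightarrow> factorisation P A B p q a b (x', u', m') \<Longrightarrow>
      Comp C (Amap g u) (Amap f m) = Comp C (Amap g u') (Amap f m') \<Longrightarrow>
      equivclp (factorisation_step P A B p q a b) (x, u, m) (x', u', m')"
  shows "exact_square TYPE(('q, 'd) category) P A B C p q f g (id_trans P C (func_comp P f p))"
proof -
  interpret p: is_functor P A p by fact
  interpret q: is_functor P B q by fact
  interpret f: is_functor A C f by fact
  interpret g: is_functor B C g by fact
  have fp: "is_functor P C (func_comp P f p)" by (rule func_comp_functor) fact+
  interpret fp: is_functor P C "func_comp P f p" by (rule fp)
  have co: "Omap f (Omap p x) = Omap g (Omap q x)" if "x \<in> Obj P" for x
    using comm that by (simp add: func_comp_eq_iff)
  have ca: "Amap f (Amap p m) = Amap g (Amap q m)" if "m \<in> Arr P" for m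
    using comm that by (simp add: func_comp_eq_iff)
  have id_nt: "nat_trans P C (func_comp P f p) (func_comp P g q) (id_trans P C (func_comp P f p))"
    unfolding comm[symmetric]
  proof (intro nat_trans.intro nat_trans_axioms.intro fp)
    fix m x y assume m: "m \<in> hom P x y"
    show "Comp C (id_trans P C (func_comp P f p) y) (Amap (func_comp P f p) m) =
        Comp C (Amap (func_comp P f p) m) (id_trans P C (func_comp P f p) x)"
      using fp.Amap_in[OF m] f.B.Ident_left f.B.Ident_right p.A.hom_objs[OF m] by (simp add: id_trans_def)
  qed (use f.B.Ident_in fp.Omap_Obj in \<open>simp_all add: id_trans_def\<close>)
  have "pointwise_lan P B D q (func_comp P h p) (func_comp B l g)
      (\<lambda>x\<in>Obj P. Comp D (Amap l (id_trans P C (func_comp P f p) x)) (\<psi> (Omap p x)))"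
    if lan: "pointwise_lan A C D f h l \<psi>" for D :: "('q, 'd) category" and h l \<psi>
  proof -
    interpret h: is_functor A D h using lan by (simp add: pointwise_lan_def)
    interpret l: is_functor C D l using lan by (simp add: pointwise_lan_def)
    interpret \<psi>: nat_trans A D h "func_comp A l f" \<psi> using lan by (simp add: pointwise_lan_def)
    have col: "is_colimit (comma A C f c) D (func_comp (comma A C f c) h (comma_proj A C f c))
        (Omap l c) (\<lambda>(a, u). Comp D (Amap l u) (\<psi> a))" if "c \<in> Obj C" for c
      using lan that by (simp add: pointwise_lan_def)
    have hp: "is_functor P D (func_comp P h p)" and lg: "is_functor B D (func_comp B l g)"
      by (rule func_comp_functor[OF fs(1) h.is_functor_axioms] func_comp_functor[OF fs(4) l.is_functor_axioms])+
    have lgq: "is_functor P D (func_comp P (func_comp B l g) q)"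
      by (rule func_comp_functor[OF q.is_functor_axioms lg])
    interpret hp: is_functor P D "func_comp P h p" by (rule hp)
    have \<psi>_in: "\<psi> a \<in> hom D (Omap h a) (Omap l (Omap f a))" if "a \<in> Obj A" for a
      using \<psi>.component_in[OF that] that by (simp add: func_comp_simps)
    have \<psi>_nat: "Comp D (\<psi> a') (Amap h m) = Comp D (Amap l (Amap f m)) (\<psi> a)" if "m \<in> hom A a a'" for m a a'
      using \<psi>.naturality[OF that] homD[OF that] by (simp add: func_comp_simps)
    let ?\<psi> = "\<lambda>x\<in>Obj P. Comp D (Amap l (id_trans P C (func_comp P f p) x)) (\<psi> (Omap p x))"
    \<comment> \<open>The 2-cell of the square is an identity, so pasting only restricts
      \<open>\<psi>\<close> along \<open>p\<close>.\<close>
    have \<psi>': "?\<psi> x = \<psi> (Omap p x)" if "x \<in> Obj P" for x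
      using that \<psi>_in[OF p.Omap_Obj[OF that]] h.B.Ident_left f.Omap_Obj[OF p.Omap_Obj[OF that]]
      by (simp add: id_trans_def l.Amap_Ident func_comp_simps)
    have nt: "nat_trans P D (func_comp P h p) (func_comp P (func_comp B l g) q) ?\<psi>"
    proof (intro nat_trans.intro nat_trans_axioms.intro hp lgq)
      show "?\<psi> \<in> extensional (Obj P)" by simp
      show "?\<psi> x \<in> hom D (Omap (func_comp P h p) x) (Omap (func_comp P (func_comp B l g) q) x)" if "x \<in> Obj P" for x
        using \<psi>'[OF that] \<psi>_in[OF p.Omap_Obj[OF that]] co[OF that] that q.Omap_Obj[OF that]
        by (simp add: func_comp_simps)
      show "Comp D (?\<psi> y) (Amap (func_comp P h p) m) = Comp D (Amap (func_comp P (func_comp B l g) q) m) (?\<psi> x)"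
        if m: "m \<in> hom P x y" for m x y
      proof -
        have xy: "x \<in> Obj P" "y \<in> Obj P" "m \<in> Arr P" using p.A.hom_objs[OF m] homD[OF m] by auto
        show ?thesis
          unfolding \<psi>'[OF xy(1)] \<psi>'[OF xy(2)]
          using \<psi>_nat[OF p.Amap_in[OF m]] ca[OF xy(3)] xy q.Amap_Arr[OF xy(3)] by (simp add: func_comp_simps)
      qed
    qed
    have "is_colimit (comma P B q b) D (func_comp (comma P B q b) (func_comp P h p) (comma_proj P B q b))
        (Omap (func_comp B l g) b) (\<lambda>(x, u). Comp D (Amap (func_comp B l g) u) (?\<psi> x))" if b: "b \<in> Obj B" for b
    proof -
      let ?J = "comma P B q b" and ?K = "comma A C f (Omap g b)"
      let ?F = "func_comp ?J (func_comp P h p) (comma_proj P B q b)"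
      let ?G = "func_comp ?K h (comma_proj A C f (Omap g b))"
      let ?\<sigma> = "\<lambda>(x, u). Comp D (Amap (func_comp B l g) u) (?\<psi> x)"
      note colb = col[OF g.Omap_Obj[OF b]]
      interpret J: category ?J by (rule comma_category) fact
      interpret K: category ?K by (rule comma_category) fact
      have F: "is_functor ?J D ?F"
        by (rule func_comp_functor[OF comma_proj_functor[OF fs(2)] hp])
      have J_Obj: "(x, u) \<in> Obj ?J \<longleftrightarrow> x \<in> Obj P \<and> u \<in> hom B (Omap q x) b" for x u
        by (simp add: comma_def)
      have K_Obj: "(a, w) \<in> Obj ?K \<longleftrightarrow> a \<in> Obj A \<and> w \<in> hom C (Omap f a) (Omap g b)" for a w
        by (simp add: comma_def)
      have FO: "Omap ?F (x, u) = Omap h (Omap p x)" if "(x, u) \<in> Obj ?J" for x u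
        using that J_Obj by (simp add: func_comp_simps comma_proj_def)
      have GO: "Omap ?G (a, w) = Omap h a" if "(a, w) \<in> Obj ?K" for a w
        using that by (simp add: func_comp_simps comma_proj_def)
      have J_ArrE: thesis if "k \<in> Arr ?J" and "\<And>x u n x' u'. k = ((x, u), n, (x', u')) \<Longrightarrow> n \<in> hom P x x' \<Longrightarrow>
          u \<in> hom B (Omap q x) b \<Longrightarrow> u' \<in> hom B (Omap q x') b \<Longrightarrow> Comp B u' (Amap q n) = u \<Longrightarrow>
          Dom ?J k = (x, u) \<Longrightarrow> Cod ?J k = (x', u') \<Longrightarrow> Amap ?F k = Amap h (Amap p n) \<Longrightarrow> thesis" for k thesis
      proof -
        obtain x u n x' u' where k: "k = ((x, u), n, (x', u'))" by (cases k) auto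
        have "Amap ?F k = Amap h (Amap p n)"
          using that(1) k by (auto simp: func_comp_simps comma_proj_def comma_def hom_def)
        then show thesis using that(2)[OF k] that(1) k by (auto simp: comma_def)
      qed
      have K_ArrI: "((a, w), m, (a', w')) \<in> Arr ?K" "Amap ?G ((a, w), m, (a', w')) = Amap h m"
        if "m \<in> hom A a a'" "w' \<in> hom C (Omap f a') (Omap g b)" "Comp C w' (Amap f m) = w" for a w m a' w'
      proof -
        show "((a, w), m, (a', w')) \<in> Arr ?K"
          using that f.B.Comp_in[OF f.Amap_in[OF that(1)] that(2)] by (simp add: comma_def)
        then show "Amap ?G ((a, w), m, (a', w')) = Amap h m" by (simp add: func_comp_simps comma_proj_def)
      qed
      have \<sigma>: "?\<sigma> (x, u) = Comp D (Amap l (Amap g u)) (\<psi> (Omap p x))" if "(x, u) \<in> Obj ?J" for x u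
        using that \<psi>'[of x] by (auto simp: J_Obj hom_def func_comp_simps simp del: restrict_apply)
      have \<sigma>_in: "?\<sigma> (x, u) \<in> hom D (Omap h (Omap p x)) (Omap l (Omap g b))" if xu: "(x, u) \<in> Obj ?J" for x u
      proof -
        have x: "x \<in> Obj P" and u: "u \<in> hom B (Omap q x) b" using xu by (simp_all add: J_Obj)
        show ?thesis
          unfolding \<sigma>[OF xu] using h.B.Comp_in[OF \<psi>_in[OF p.Omap_Obj[OF x]]] l.Amap_in[OF g.Amap_in[OF u]] co[OF x]
          by simp
      qed
      have cocone: "cocone ?J D ?F (Omap (func_comp B l g) b) ?\<sigma>"
        unfolding cocone_def
      proof (intro conjI ballI)
        show "Omap (func_comp B l g) b \<in> Obj D" using b by (simp add: func_comp_simps g.Omap_Obj l.Omap_Obj)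
        show "?\<sigma> j \<in> hom D (Omap ?F j) (Omap (func_comp B l g) b)" if "j \<in> Obj ?J" for j
          using that \<sigma>_in FO b by (cases j) (simp add: func_comp_simps)
        fix k assume k: "k \<in> Arr ?J"
        obtain x u n x' u' where *: "k = ((x, u), n, (x', u'))" "n \<in> hom P x x'"
          "u \<in> hom B (Omap q x) b" "u' \<in> hom B (Omap q x') b" "Comp B u' (Amap q n) = u"
          "Dom ?J k = (x, u)" "Cod ?J k = (x', u')" "Amap ?F k = Amap h (Amap p n)"
          using k by (rule J_ArrE)
        have o: "x \<in> Obj P" "x' \<in> Obj P" "n \<in> Arr P" using p.A.hom_objs[OF *(2)] homD[OF *(2)] by auto
        note pn = p.Amap_in[OF *(2)]
        have u'g: "Amap g u' \<in> hom C (Omap f (Omap p x')) (Omap g b)" using g.Amap_in[OF *(4)] co[OF o(2)] by simp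
        have gu: "Comp C (Amap g u') (Amap f (Amap p n)) = Amap g u"
          using g.Amap_Comp[OF q.Amap_in[OF *(2)] *(4)] *(5) ca[OF o(3)] by simp
        have "Comp D (Comp D (Amap l (Amap g u')) (\<psi> (Omap p x'))) (Amap h (Amap p n)) =
            Comp D (Amap l (Amap g u')) (Comp D (Amap l (Amap f (Amap p n))) (\<psi> (Omap p x)))"
          using h.B.Comp_assoc[OF h.Amap_in[OF pn] \<psi>_in[OF p.Omap_Obj[OF o(2)]] l.Amap_in[OF u'g]] \<psi>_nat[OF pn] by simp
        also have "\<dots> = Comp D (Amap l (Amap g u)) (\<psi> (Omap p x))"
          using h.B.Comp_assoc[OF \<psi>_in[OF p.Omap_Obj[OF o(1)]] l.Amap_in[OF f.Amap_in[OF pn]] l.Amap_in[OF u'g]]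
            l.Amap_Comp[OF f.Amap_in[OF pn] u'g] gu by simp
        finally show "Comp D (?\<sigma> (Cod ?J k)) (Amap ?F k) = ?\<sigma> (Dom ?J k)"
          unfolding *(6-8) using \<sigma>[of x u] \<sigma>[of x' u'] * o by (simp add: J_Obj del: split_conv restrict_apply)
      qed
      have "\<exists>!k. k \<in> hom D (Omap (func_comp B l g) b) w' \<and> (\<forall>j\<in>Obj ?J. Comp D k (?\<sigma> j) = \<tau> j)"
        if \<tau>: "cocone ?J D ?F w' \<tau>" for w' \<tau>
      proof -
        have w': "w' \<in> Obj D" using \<tau> by (simp add: cocone_def)
        have \<tau>_in: "\<tau> (x, u) \<in> hom D (Omap h (Omap p x)) w'" if "(x, u) \<in> Obj ?J" for x u
          using \<tau> that FO[OF that] by (auto simp: cocone_def)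
        have \<tau>_nat: "Comp D (\<tau> (x', u')) (Amap h (Amap p n)) = \<tau> (x, u)"
          if n: "n \<in> hom P x x'" "u' \<in> hom B (Omap q x') b" "Comp B u' (Amap q n) = u" for n x x' u u'
        proof -
          have "((x, u), n, (x', u')) \<in> Arr ?J"
            using n q.B.Comp_in[OF q.Amap_in[OF n(1)] n(2)] by (simp add: comma_def)
          then have "Comp D (\<tau> (Cod ?J ((x, u), n, (x', u')))) (Amap ?F ((x, u), n, (x', u'))) =
              \<tau> (Dom ?J ((x, u), n, (x', u')))" and "Amap ?F ((x, u), n, (x', u')) = Amap h (Amap p n)"
            using \<tau> homD(1)[OF n(1)] unfolding cocone_def by (blast, simp add: func_comp_simps comma_proj_def)
          then show ?thesis by (simp add: comma_def)
        qed
        \<comment> \<open>A cocone \<open>\<tau>\<close> over the comma category of \<open>q\<close>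
          at \<open>b\<close> is extended to the comma category of \<open>f\<close> at
          \<open>g b\<close>: the object \<open>w : f a -> g b\<close> receives the value of any
          factorisation of \<open>w\<close>. Connectedness of factorisations makes the value
          independent of the choice, and the given colimit then applies.\<close>
        define val where "val = (\<lambda>(x, u, m). Comp D (\<tau> (x, u)) (Amap h m))"
        let ?fac = "factorisation P A B p q" and ?step = "factorisation_step P A B p q"
        have val_in: "val (x, u, m) \<in> hom D (Omap h a) w'" if "?fac a b (x, u, m)" for a x u m
          using that h.B.Comp_in[OF h.Amap_in \<tau>_in] by (simp add: factorisation_def val_def J_Obj)
        have val_step: "val c = val c'" if st: "?step a b c c'" for a c c'
        proof -
          obtain x u m x' u' m' where c: "c = (x, u, m)" "c' = (x', u', m')" by (cases c, cases c')
          then obtain n where n: "?fac a b (x, u, m)" "?fac a b (x', u', m')" "n \<in> hom P x x'"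
              "Comp B u' (Amap q n) = u" "Comp A (Amap p n) m = m'"
            using st by (auto simp: factorisation_step_def)
          have ty: "x' \<in> Obj P" "u' \<in> hom B (Omap q x') b" "m \<in> hom A a (Omap p x)" using n by (auto simp: factorisation_def)
          have "val c = Comp D (Comp D (\<tau> (x', u')) (Amap h (Amap p n))) (Amap h m)"
            using \<tau>_nat[OF n(3) ty(2) n(4)] by (simp add: val_def c)
          also have "\<dots> = Comp D (\<tau> (x', u')) (Amap h m')"
            using h.B.Comp_assoc[OF h.Amap_in[OF ty(3)] h.Amap_in[OF p.Amap_in[OF n(3)]] \<tau>_in[of x' u']] ty
              h.Amap_Comp[OF ty(3) p.Amap_in[OF n(3)]] n(5) by (simp add: J_Obj)
          finally show ?thesis by (simp add: val_def c)
        qed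
        have val_equiv: "val c = val c'" if "equivclp (?step a b) c c'" for a c c'
          using that by (induction rule: equivclp_induct) (auto dest: val_step)
        define fac where "fac = (\<lambda>(a, w). SOME c. ?fac a b c \<and> Comp C (Amap g (fst (snd c))) (Amap f (snd (snd c))) = w)"
        have fac: "?fac a b (fac (a, w)) \<and> Comp C (Amap g (fst (snd (fac (a, w))))) (Amap f (snd (snd (fac (a, w))))) = w"
          if aw: "(a, w) \<in> Obj ?K" for a w
        proof -
          obtain x u m where "?fac a b (x, u, m)" "Comp C (Amap g u) (Amap f m) = w"
            using ex[of a b w] aw b K_Obj by blast
          then have "?fac a b (x, u, m) \<and> Comp C (Amap g (fst (snd (x, u, m)))) (Amap f (snd (snd (x, u, m)))) = w" by simp
          then show ?thesis unfolding fac_def split_conv by (rule someI)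
        qed
        have fac_val: "val (fac (a, w)) = val (x, u, m)"
          if aw: "(a, w) \<in> Obj ?K" and xum: "?fac a b (x, u, m)" "Comp C (Amap g u) (Amap f m) = w" for a w x u m
        proof -
          obtain x' u' m' where fe: "fac (a, w) = (x', u', m')" by (cases "fac (a, w)")
          show ?thesis
            unfolding fe by (rule val_equiv, rule conn) (use fac[OF aw] fe aw K_Obj b xum in auto)
        qed
        have \<tau>K: "cocone ?K D ?G w' (\<lambda>j. val (fac j))"
          unfolding cocone_def
        proof (intro conjI ballI w')
          fix j assume j: "j \<in> Obj ?K"
          obtain a w x u m where "j = (a, w)" "fac (a, w) = (x, u, m)" by (cases j, cases "fac j") auto
          then show "val (fac j) \<in> hom D (Omap ?G j) w'"
            using j fac[of a w] val_in[of a x u m] GO[of a w] by simp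
        next
          fix k assume k: "k \<in> Arr ?K"
          obtain a w m a' w' where ke: "k = ((a, w), m, (a', w'))" by (cases k) auto
          have *: "m \<in> hom A a a'" "w \<in> hom C (Omap f a) (Omap g b)" "w' \<in> hom C (Omap f a') (Omap g b)"
            "Comp C w' (Amap f m) = w" using k by (simp_all add: ke comma_def)
          have o: "(a, w) \<in> Obj ?K" "(a', w') \<in> Obj ?K" using p.B.hom_objs[OF *(1)] * by (simp_all add: K_Obj)
          obtain x u n where fe: "fac (a', w') = (x, u, n)" by (cases "fac (a', w')")
          have fx: "?fac a' b (x, u, n)" "Comp C (Amap g u) (Amap f n) = w'" using fac[OF o(2)] fe by auto
          have ty: "x \<in> Obj P" "u \<in> hom B (Omap q x) b" "n \<in> hom A a' (Omap p x)" using fx by (auto simp: factorisation_def)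
          have ug: "Amap g u \<in> hom C (Omap f (Omap p x)) (Omap g b)" using g.Amap_in[OF ty(2)] co[OF ty(1)] by simp
          have "Comp C (Amap g u) (Amap f (Comp A n m)) = w"
            using f.Amap_Comp[OF *(1) ty(3)] f.B.Comp_assoc[OF f.Amap_in[OF *(1)] f.Amap_in[OF ty(3)] ug] fx(2) *(4) by simp
          moreover have "?fac a b (x, u, Comp A n m)" using ty p.B.Comp_in[OF *(1) ty(3)] by (simp add: factorisation_def)
          ultimately have "val (fac (a, w)) = val (x, u, Comp A n m)" using fac_val[OF o(1)] by simp
          also have "\<dots> = Comp D (val (x, u, n)) (Amap h m)"
            using h.Amap_Comp[OF *(1) ty(3)] h.B.Comp_assoc[OF h.Amap_in[OF *(1)] h.Amap_in[OF ty(3)] \<tau>_in[of x u]] ty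
            by (simp add: val_def J_Obj)
          finally show "Comp D (val (fac (Cod ?K k))) (Amap ?G k) = val (fac (Dom ?K k))"
            using K_ArrI(2)[OF *(1,3,4)] fe by (simp add: ke comma_def)
        qed
        have "\<exists>!k. k \<in> hom D (Omap l (Omap g b)) w' \<and>
            (\<forall>j\<in>Obj ?K. Comp D k (case j of (a, w) \<Rightarrow> Comp D (Amap l w) (\<psi> a)) = val (fac j))"
          using colb \<tau>K unfolding is_colimit_def by blast
        then obtain k where k_all: "k \<in> hom D (Omap l (Omap g b)) w' \<and>
            (\<forall>j\<in>Obj ?K. Comp D k (case j of (a, w) \<Rightarrow> Comp D (Amap l w) (\<psi> a)) = val (fac j))"
          and k_only: "\<And>k'. k' \<in> hom D (Omap l (Omap g b)) w' \<and>
            (\<forall>j\<in>Obj ?K. Comp D k' (case j of (a, w) \<Rightarrow> Comp D (Amap l w) (\<psi> a)) = val (fac j)) \<Longrightarrow> k' = k"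
          by (elim ex1E) blast
        have k: "k \<in> hom D (Omap l (Omap g b)) w'"
            "\<And>a w. (a, w) \<in> Obj ?K \<Longrightarrow> Comp D k (Comp D (Amap l w) (\<psi> a)) = val (fac (a, w))"
          using k_all by auto
        have k_unique: "k' = k" if "k' \<in> hom D (Omap l (Omap g b)) w'"
            "\<And>a w. (a, w) \<in> Obj ?K \<Longrightarrow> Comp D k' (Comp D (Amap l w) (\<psi> a)) = val (fac (a, w))" for k'
          by (rule k_only) (use that in auto)
        show ?thesis
        proof (intro ex1I[of _ k] conjI ballI)
          show "k \<in> hom D (Omap (func_comp B l g) b) w'" using k(1) b by (simp add: func_comp_simps)
          fix j assume j: "j \<in> Obj ?J"
          obtain x u where je: "j = (x, u)" by (cases j)
          have xu: "x \<in> Obj P" "u \<in> hom B (Omap q x) b" "(x, u) \<in> Obj ?J" using j by (simp_all add: je J_Obj)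
          have K: "(Omap p x, Amap g u) \<in> Obj ?K" using xu g.Amap_in[OF xu(2)] co by (simp add: K_Obj p.Omap_Obj)
          have Id: "Ident A (Omap p x) \<in> hom A (Omap p x) (Omap p x)" using p.B.Ident_in p.Omap_Obj xu by simp
          \<comment> \<open>The extension restricts to \<open>\<tau>\<close>: at the object
            \<open>(p x, g u)\<close> the factorisation with first part the identity of
            \<open>p x\<close> has value \<open>\<tau> (x, u)\<close>.\<close>
          have "val (fac (Omap p x, Amap g u)) = val (x, u, Ident A (Omap p x))"
          proof (rule fac_val[OF K])
            show "?fac (Omap p x) b (x, u, Ident A (Omap p x))" using xu Id by (simp add: factorisation_def)
            show "Comp C (Amap g u) (Amap f (Ident A (Omap p x))) = Amap g u"
              using g.Amap_in[OF xu(2)] co[OF xu(1)] p.Omap_Obj[OF xu(1)] f.B.Ident_right by (simp add: f.Amap_Ident)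
          qed
          also have "\<dots> = \<tau> (x, u)"
            using h.B.Ident_right[OF \<tau>_in[OF xu(3)]] p.Omap_Obj[OF xu(1)] by (simp add: val_def h.Amap_Ident)
          finally show "Comp D k (?\<sigma> j) = \<tau> j" unfolding je \<sigma>[OF xu(3)] using k(2)[OF K] by simp
        next
          \<comment> \<open>For uniqueness, the leg of the larger cocone at \<open>w\<close> is the
            leg at \<open>(x, u)\<close> preceded by \<open>h m\<close>, for any factorisation
            \<open>(x, u, m)\<close> of \<open>w\<close>. So \<open>k'\<close> is also a mediating
            arrow for the larger cocone.\<close>
          fix k' assume k': "k' \<in> hom D (Omap (func_comp B l g) b) w' \<and> (\<forall>j\<in>Obj ?J. Comp D k' (?\<sigma> j) = \<tau> j)"
          have kh: "k' \<in> hom D (Omap l (Omap g b)) w'" using k' b by (simp add: func_comp_simps)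
          show "k' = k"
          proof (rule k_unique[OF kh])
            fix a w assume aw: "(a, w) \<in> Obj ?K"
            obtain x u m where fe: "fac (a, w) = (x, u, m)" by (cases "fac (a, w)")
            have fx: "?fac a b (x, u, m)" "Comp C (Amap g u) (Amap f m) = w" using fac[OF aw] fe by auto
            have ty: "x \<in> Obj P" "u \<in> hom B (Omap q x) b" "m \<in> hom A a (Omap p x)" using fx by (auto simp: factorisation_def)
            have xu: "(x, u) \<in> Obj ?J" using ty by (simp add: J_Obj)
            have ug: "Amap g u \<in> hom C (Omap f (Omap p x)) (Omap g b)" using g.Amap_in[OF ty(2)] co[OF ty(1)] by simp
            have a: "a \<in> Obj A" using aw by (simp add: K_Obj)
            note px = p.Omap_Obj[OF ty(1)]
            have "Comp D (Amap l w) (\<psi> a) = Comp D (Amap l (Amap g u)) (Comp D (Amap l (Amap f m)) (\<psi> a))"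
              using l.Amap_Comp[OF f.Amap_in[OF ty(3)] ug] fx(2)
                h.B.Comp_assoc[OF \<psi>_in[OF a] l.Amap_in[OF f.Amap_in[OF ty(3)]] l.Amap_in[OF ug]] by simp
            also have "\<dots> = Comp D (?\<sigma> (x, u)) (Amap h m)"
              unfolding \<sigma>[OF xu] using \<psi>_nat[OF ty(3)]
                h.B.Comp_assoc[OF h.Amap_in[OF ty(3)] \<psi>_in[OF px] l.Amap_in[OF ug]] by simp
            finally have "Comp D k' (Comp D (Amap l w) (\<psi> a)) = Comp D (Comp D k' (?\<sigma> (x, u))) (Amap h m)"
              using h.B.Comp_assoc[OF h.Amap_in[OF ty(3)] \<sigma>_in[OF xu] kh] by simp
            also have "Comp D k' (?\<sigma> (x, u)) = \<tau> (x, u)" using k' xu by blast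
            also have "Comp D (\<tau> (x, u)) (Amap h m) = val (fac (a, w))" by (simp add: fe val_def)
            finally show "Comp D k' (Comp D (Amap l w) (\<psi> a)) = val (fac (a, w))" .
          qed
        qed
      qed
      then show ?thesis using F cocone unfolding is_colimit_def by blast
    qed
    then show ?thesis
      unfolding pointwise_lan_def using fs hp lg nt by blast
  qed
  then show ?thesis unfolding exact_square_def using fs id_nt by blast
qed

section \<open>Functors between codescent objects\<close>

lemma codescent_map_elem:
  assumes "codescent_map X f Z k0 k1 Z' k0' k1' G"
  shows "is_functor Z Z' G"
    "x \<in> Obj (lev X 0) \<Longrightarrow> Omap G (Omap k0 x) = Omap k0' (Omap (f 0) x)"
    "m \<in> Arr (lev X 0) \<Longrightarrow> Amap G (Amap k0 m) = Amap k0' (Amap (f 0) m)"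
    "h \<in> Obj (lev X (Suc 0)) \<Longrightarrow> Amap G (k1 h) = k1' (Omap (f (Suc 0)) h)"
proof -
  show "is_functor Z Z' G" using assms by (simp add: codescent_map_def)
  show "x \<in> Obj (lev X 0) \<Longrightarrow> Omap G (Omap k0 x) = Omap k0' (Omap (f 0) x)"
    "m \<in> Arr (lev X 0) \<Longrightarrow> Amap G (Amap k0 m) = Amap k0' (Amap (f 0) m)"
    using assms by (simp_all add: codescent_map_def func_comp_eq_iff)
  have "compose (Obj (lev X (Suc 0))) (Amap G) k1 h = compose (Obj (lev X (Suc 0))) k1' (Omap (f (Suc 0))) h"
    using assms by (simp add: codescent_map_def)
  then show "h \<in> Obj (lev X (Suc 0)) \<Longrightarrow> Amap G (k1 h) = k1' (Omap (f (Suc 0)) h)"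
    by (simp add: compose_def)
qed

text \<open>By \<open>Z_generated\<close> every arrow of \<open>Z\<close> is the image of a vertical
  arrow followed by a component of \<open>k1\<close>, so agreement on these suffices.\<close>

lemma (in universal_codescent) functor_eqI:
  assumes "is_functor Z W F" "is_functor Z W G"
    and O: "\<And>x. x \<in> Obj X0 \<Longrightarrow> Omap F (Omap k0 x) = Omap G (Omap k0 x)"
    and A: "\<And>m. m \<in> Arr X0 \<Longrightarrow> Amap F (Amap k0 m) = Amap G (Amap k0 m)"
    and H: "\<And>h. h \<in> Obj X1 \<Longrightarrow> Amap F (k1 h) = Amap G (k1 h)"
  shows "F = G"
proof (rule func_eqI[OF assms(1,2)])
  interpret F: is_functor Z W F by fact
  interpret G: is_functor Z W G by fact
  show "Omap F z = Omap G z" if z: "z \<in> Obj Z" for z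
  proof -
    obtain x where "x \<in> Obj X0" "z = Omap k0 x" using z Z_generated(1) by blast
    then show ?thesis using O by simp
  qed
  show "Amap F m = Amap G m" if m: "m \<in> Arr Z" for m
  proof -
    obtain c where "c \<in> Arr corner_cat" "m = edge c" using m Z_generated(2) by blast
    moreover obtain v h where "c = (v, h)" by (cases c)
    ultimately have *: "v \<in> hom X0 (Dom X0 v) (Omap s h)" "h \<in> Obj X1" "m = Comp Z (k1 h) (Amap k0 v)"
      by (simp_all add: corner_simps edge_def hom_def)
    note c = k0.Amap_in[OF *(1)] k1_hom[OF *(2)]
    show ?thesis
      using F.Amap_Comp[OF c] G.Amap_Comp[OF c] A[OF homD(1)[OF *(1)]] H[OF *(2)] *(3) by simp
  qed
qed

section \<open>The codescent square\<close>

locale crossed_square =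
  P: universal_codescent P ZP kP0 kP1 + A: universal_codescent A ZA kA0 kA1 +
  B: universal_codescent B ZB kB0 kB1 + C: universal_codescent C ZC kC0 kC1
  for P :: "('u::infinite, 'u) crossed_double_cat" and ZP kP0 kP1
    and A :: "('u, 'u) crossed_double_cat" and ZA kA0 kA1
    and B :: "('u, 'u) crossed_double_cat" and ZB kB0 kB1
    and C :: "('u, 'u) crossed_double_cat" and ZC kC0 kC1 +
  fixes p q f g :: "('u, 'u) simplicial_map" and p' q' f' g' :: "('u, 'u, 'u, 'u) func"
  assumes pullback: "crossed_pullback P A B C p q f g"
    and g_fibration: "discrete_fibration B C g"
    and f_opfibration: "objectwise_opfibration A C f"
    and p_map: "codescent_map P p ZP kP0 kP1 ZA kA0 kA1 p'"
    and q_map: "codescent_map P q ZP kP0 kP1 ZB kB0 kB1 q'"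
    and f_map: "codescent_map A f ZA kA0 kA1 ZC kC0 kC1 f'"
    and g_map: "codescent_map B g ZB kB0 kB1 ZC kC0 kC1 g'"
begin

lemma double_functors: "double_functor P A p" "double_functor P B q" "double_functor A C f" "double_functor B C g"
  using pullback by (simp_all add: is_pullback_def crossed_double_functor_iff)

sublocale p: double_functor P A p by (rule double_functors)
sublocale q: double_functor P B q by (rule double_functors)
sublocale f: double_functor A C f by (rule double_functors)
sublocale g: double_functor B C g by (rule double_functors)

sublocale p0: is_functor P.X0 A.X0 "p 0" by (rule p.level_functor)
sublocale q0: is_functor P.X0 B.X0 "q 0" by (rule q.level_functor)
sublocale f0: is_functor A.X0 C.X0 "f 0" by (rule f.level_functor)
sublocale g0: is_functor B.X0 C.X0 "g 0" by (rule g.level_functor)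
sublocale f1: is_functor A.X1 C.X1 "f (Suc 0)" by (rule f.level_functor)
sublocale g1: is_functor B.X1 C.X1 "g (Suc 0)" by (rule g.level_functor)

sublocale p': is_functor ZP ZA p' by (rule codescent_map_elem[OF p_map])
sublocale q': is_functor ZP ZB q' by (rule codescent_map_elem[OF q_map])
sublocale f': is_functor ZA ZC f' by (rule codescent_map_elem[OF f_map])
sublocale g': is_functor ZB ZC g' by (rule codescent_map_elem[OF g_map])

lemmas p'_simps = codescent_map_elem(2-4)[OF p_map]
lemmas q'_simps = codescent_map_elem(2-4)[OF q_map]
lemmas f'_simps = codescent_map_elem(2-4)[OF f_map]
lemmas g'_simps = codescent_map_elem(2-4)[OF g_map]

lemma level_comm:
  "x \<in> Obj (lev P n) \<Longrightarrow> Omap (f n) (Omap (p n) x) = Omap (g n) (Omap (q n) x)"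
  "m \<in> Arr (lev P n) \<Longrightarrow> Amap (f n) (Amap (p n) m) = Amap (g n) (Amap (q n) m)"
proof -
  have "smap_comp P f p = smap_comp P g q" using pullback by (simp add: is_pullback_def)
  then have "func_comp (lev P n) (f n) (p n) = func_comp (lev P n) (g n) (q n)"
    unfolding smap_comp_def by (rule fun_cong)
  then show "x \<in> Obj (lev P n) \<Longrightarrow> Omap (f n) (Omap (p n) x) = Omap (g n) (Omap (q n) x)"
    "m \<in> Arr (lev P n) \<Longrightarrow> Amap (f n) (Amap (p n) m) = Amap (g n) (Amap (q n) m)"
    by (simp_all add: func_comp_eq_iff)
qed

lemma square_comm: "func_comp ZP f' p' = func_comp ZP g' q'"
proof (rule P.functor_eqI)
  show "is_functor ZP ZC (func_comp ZP f' p')" "is_functor ZP ZC (func_comp ZP g' q')"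
    by (rule func_comp_functor[OF p'.is_functor_axioms f'.is_functor_axioms]
      func_comp_functor[OF q'.is_functor_axioms g'.is_functor_axioms])+
  interpret p1: is_functor P.X1 A.X1 "p (Suc 0)" by (rule p.level_functor)
  interpret q1: is_functor P.X1 B.X1 "q (Suc 0)" by (rule q.level_functor)
  show "Omap (func_comp ZP f' p') (Omap kP0 x) = Omap (func_comp ZP g' q') (Omap kP0 x)" if "x \<in> Obj P.X0" for x
    using that by (simp add: func_comp_simps P.k0.Omap_Obj p'_simps q'_simps f'_simps g'_simps
      p0.Omap_Obj q0.Omap_Obj level_comm)
  show "Amap (func_comp ZP f' p') (Amap kP0 m) = Amap (func_comp ZP g' q') (Amap kP0 m)" if "m \<in> Arr P.X0" for m
    using that by (simp add: func_comp_simps P.k0.Amap_Arr p'_simps q'_simps f'_simps g'_simps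
      p0.Amap_Arr q0.Amap_Arr level_comm)
  show "Amap (func_comp ZP f' p') (kP1 h) = Amap (func_comp ZP g' q') (kP1 h)" if "h \<in> Obj P.X1" for h
    using that homD(1)[OF P.k1_hom[OF that]]
    by (simp add: func_comp_simps p'_simps q'_simps f'_simps g'_simps p1.Omap_Obj q1.Omap_Obj level_comm)
qed

section \<open>Lifting along the discrete fibration, the opfibration and the pullback\<close>

lemma fibration_pullback: "Cat_pullback B.X1 C.X1 B.X0 C.X0 (g (Suc 0)) B.t C.t (g 0)"
  using g_fibration by (simp add: discrete_fibration_def)

lemma horizontal_lift:
  assumes "h \<in> Obj C.X1" "b \<in> Obj B.X0" "Omap C.t h = Omap (g 0) b"
  obtains j where "j \<in> Obj B.X1" "Omap (g (Suc 0)) j = h" "Omap B.t j = b"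
  using Cat_pullback_ex(1)[OF fibration_pullback assms] by blast

lemma horizontal_lift_eq:
  assumes "j \<in> Obj B.X1" "j' \<in> Obj B.X1" "Omap (g (Suc 0)) j = Omap (g (Suc 0)) j'" "Omap B.t j = Omap B.t j'"
  shows "j = j'"
  using Cat_pullback_eq(1)[OF fibration_pullback assms] .

lemma vertical_lift:
  assumes "a \<in> Obj A.X0" "u \<in> hom C.X0 (Omap (f 0) a) c"
  obtains k where "opcartesian A.X0 C.X0 (f 0) k" "k \<in> hom A.X0 a (Cod A.X0 k)" "Amap (f 0) k = u"
  using f_opfibration assms that unfolding objectwise_opfibration_def opfibration_def
  by (force simp: hom_def opcartesian_def)

lemma P0_object:
  assumes "a \<in> Obj A.X0" "b \<in> Obj B.X0" "Omap (f 0) a = Omap (g 0) b"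
  obtains x where "x \<in> Obj P.X0" "Omap (p 0) x = a" "Omap (q 0) x = b"
  using crossed_pullback_ex(1)[OF pullback assms] by blast

text \<open>The pullback supplies an arrow over \<open>(m, n)\<close>. It starts at the prescribed
  \<open>x\<close> because an object of \<open>P\<close> is determined by its two images.\<close>

lemma P0_arrow:
  assumes x: "x \<in> Obj P.X0" and m: "m \<in> hom A.X0 (Omap (p 0) x) a" and n: "n \<in> hom B.X0 (Omap (q 0) x) b"
    and eq: "Amap (f 0) m = Amap (g 0) n"
  obtains x' k where "k \<in> hom P.X0 x x'" "Amap (p 0) k = m" "Amap (q 0) k = n"
    "Omap (p 0) x' = a" "Omap (q 0) x' = b"
proof -
  obtain k where k: "k \<in> Arr P.X0" "Amap (p 0) k = m" "Amap (q 0) k = n"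
    using crossed_pullback_ex(2)[OF pullback homD(1)[OF m] homD(1)[OF n] eq] by blast
  have "Dom P.X0 k = x"
    by (rule crossed_pullback_eq[OF pullback P.X0.Dom_in[OF k(1)] x])
      (use k m n p0.Dom_Amap[OF k(1)] q0.Dom_Amap[OF k(1)] in \<open>auto simp: hom_def\<close>)
  then show thesis
    using that[of k "Cod P.X0 k"] k m n p0.Cod_Amap[OF k(1)] q0.Cod_Amap[OF k(1)] by (auto simp: hom_def)
qed

section \<open>Factorisations and their zigzags\<close>

abbreviation "factors \<equiv> factorisation ZP ZA ZB p' q'"
abbreviation "connected_by a b \<equiv> equivclp (factorisation_step ZP ZA ZB p' q' a b)"
abbreviation "linked a b \<equiv> connected_by (Omap kA0 a) (Omap kB0 b)"
abbreviation "triple x v j \<equiv> (Omap kP0 x, kB1 j, Amap kA0 v)"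

text \<open>The coend relation in the form in which it is applied: the arrow \<open>n\<close> passes
  from the second part of a factorisation to the first.\<close>

lemma fact_step:
  assumes "n \<in> hom ZP z z'" "u \<in> hom ZB (Omap q' z') b" "m \<in> hom ZA a (Omap p' z)"
  shows "connected_by a b (z, Comp ZB u (Amap q' n), m) (z', u, Comp ZA (Amap p' n) m)"
proof (rule r_into_equivclp)
  show "factorisation_step ZP ZA ZB p' q' a b (z, Comp ZB u (Amap q' n), m) (z', u, Comp ZA (Amap p' n) m)"
    using assms P.k0.B.hom_objs[OF assms(1)] B.k0.B.Comp_in[OF q'.Amap_in[OF assms(1)] assms(2)]
      A.k0.B.Comp_in[OF assms(3) p'.Amap_in[OF assms(1)]]
    by (auto simp: factorisation_step_def factorisation_def)
qed

lemma fact_step_composite: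
  assumes "factorisation_step ZP ZA ZB p' q' a b (z, u, m) (z', u', m')"
  shows "Comp ZC (Amap g' u) (Amap f' m) = Comp ZC (Amap g' u') (Amap f' m')"
proof -
  obtain n where n: "n \<in> hom ZP z z'" "Comp ZB u' (Amap q' n) = u" "Comp ZA (Amap p' n) m = m'"
      "u' \<in> hom ZB (Omap q' z') b" "m \<in> hom ZA a (Omap p' z)"
    using assms by (auto simp: factorisation_step_def factorisation_def)
  have c: "Amap f' (Amap p' n) = Amap g' (Amap q' n)"
    using square_comm homD(1)[OF n(1)] by (simp add: func_comp_eq_iff)
  note qn = q'.Amap_in[OF n(1)] and pn = p'.Amap_in[OF n(1)]
  have gq: "Amap f' (Amap p' n) \<in> hom ZC (Omap f' (Omap p' z)) (Omap g' (Omap q' z'))"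
    using g'.Amap_in[OF qn] f'.Amap_in[OF pn] c by (auto simp: hom_def)
  show ?thesis
    using g'.Amap_Comp[OF qn n(4)] f'.Amap_Comp[OF n(5) pn] n(2,3) c
      C.k0.B.Comp_assoc[OF f'.Amap_in[OF n(5)] gq g'.Amap_in[OF n(4)]] by simp
qed

lemma connected_composite:
  assumes "connected_by a b (z, u, m) (z', u', m')"
  shows "Comp ZC (Amap g' u) (Amap f' m) = Comp ZC (Amap g' u') (Amap f' m')"
proof -
  have "Comp ZC (Amap g' (fst (snd c))) (Amap f' (snd (snd c))) =
      Comp ZC (Amap g' (fst (snd c'))) (Amap f' (snd (snd c')))" if "connected_by a b c c'" for c c'
    using that
  proof (induction rule: equivclp_induct)
    case (step c' c'')
    then show ?case
      using fact_step_composite[of a b "fst c'" "fst (snd c')" "snd (snd c')" "fst c''" "fst (snd c'')" "snd (snd c'')"]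
        fact_step_composite[of a b "fst c''" "fst (snd c'')" "snd (snd c'')" "fst c'" "fst (snd c')" "snd (snd c')"]
      by auto
  qed simp
  from this[OF assms] show ?thesis by simp
qed

text \<open>
  Standard factorisations have a vertical first part \<open>v : a \<rightarrow> px\<close> and a horizontal second part
  \<open>j : qx \<rightarrow> b\<close>; their image in \<open>C\<close> is a corner.
\<close>

definition standard :: "'u \<Rightarrow> 'u \<Rightarrow> 'u \<Rightarrow> 'u \<Rightarrow> 'u \<Rightarrow> bool" where
  "standard a b x v j \<longleftrightarrow> x \<in> Obj P.X0 \<and> v \<in> hom A.X0 a (Omap (p 0) x) \<and>
    j \<in> Obj B.X1 \<and> Omap B.s j = Omap (q 0) x \<and> Omap B.t j = b"

lemma standard_fact:
  assumes "standard a b x v j"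
  shows "factors (Omap kA0 a) (Omap kB0 b) (triple x v j)"
    "Comp ZC (Amap g' (kB1 j)) (Amap f' (Amap kA0 v)) = C.edge (Amap (f 0) v, Omap (g (Suc 0)) j)"
    "(Amap (f 0) v, Omap (g (Suc 0)) j) \<in> hom C.corner_cat (Omap (f 0) a) (Omap (g 0) b)"
proof -
  have *: "x \<in> Obj P.X0" "v \<in> hom A.X0 a (Omap (p 0) x)" "j \<in> Obj B.X1" "Omap B.s j = Omap (q 0) x" "Omap B.t j = b"
    using assms by (auto simp: standard_def)
  show "factors (Omap kA0 a) (Omap kB0 b) (triple x v j)"
    using * A.k0.Amap_in[OF *(2)] B.k1_hom[OF *(3)] by (simp add: factorisation_def P.k0.Omap_Obj p'_simps q'_simps)
  show "Comp ZC (Amap g' (kB1 j)) (Amap f' (Amap kA0 v)) = C.edge (Amap (f 0) v, Omap (g (Suc 0)) j)"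
    using *(3) homD(1)[OF *(2)] by (simp add: f'_simps g'_simps C.edge_def)
  show "(Amap (f 0) v, Omap (g (Suc 0)) j) \<in> hom C.corner_cat (Omap (f 0) a) (Omap (g 0) b)"
    using * f0.Amap_in[OF *(2)] g1.Omap_Obj[OF *(3)] g.face_elem(1)[of 0 0 j] g.face_elem(1)[of "Suc 0" 0 j] level_comm(1)[of x 0]
    by (simp add: C.corner_simps)
qed

text \<open>The lift \<open>j\<close> of \<open>h0\<close> is taken with target \<open>b\<close> and
  the lift \<open>v\<close> of \<open>v0\<close> with source \<open>a\<close>. Where they meet, both
  lie over the source of \<open>h0\<close>, so the pullback contains an object joining them.\<close>

lemma standard_ex:
  assumes a: "a \<in> Obj A.X0" and b: "b \<in> Obj B.X0"
    and c: "(v0, h0) \<in> hom C.corner_cat (Omap (f 0) a) (Omap (g 0) b)"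
  obtains x v j where "standard a b x v j" "Amap (f 0) v = v0" "Omap (g (Suc 0)) j = h0"
proof -
  have v0: "v0 \<in> hom C.X0 (Omap (f 0) a) (Omap C.s h0)" "h0 \<in> Obj C.X1" "Omap C.t h0 = Omap (g 0) b"
    using c by (simp_all add: C.corner_simps)
  obtain j where j: "j \<in> Obj B.X1" "Omap (g (Suc 0)) j = h0" "Omap B.t j = b"
    using horizontal_lift[OF v0(2) b v0(3)] by blast
  obtain v where v: "v \<in> hom A.X0 a (Cod A.X0 v)" "Amap (f 0) v = v0"
    using vertical_lift[OF a v0(1)] by blast
  have "Omap (f 0) (Cod A.X0 v) = Omap (g 0) (Omap B.s j)"
    using f0.Amap_in[OF v(1)] v(2) v0(1) j g.face_elem(1)[of "Suc 0" 0 j] by (auto simp: hom_def)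
  then obtain x where "x \<in> Obj P.X0" "Omap (p 0) x = Cod A.X0 v" "Omap (q 0) x = Omap B.s j"
    using P0_object[OF A.X0.hom_objs(2)[OF v(1)] B.s.Omap_Obj[OF j(1)]] by blast
  then show thesis using that[of x v j] v j by (simp add: standard_def)
qed

text \<open>The vertical arrow \<open>w\<close> is moved to the first part across an arrow of
  \<open>P\<close> whose \<open>q\<close>-image is \<open>w\<close> and whose \<open>p\<close>-image
  is a lift of \<open>g w\<close> along \<open>f_0\<close>.\<close>

lemma standard_push:
  assumes x: "x \<in> Obj P.X0" and v: "v \<in> hom A.X0 a (Omap (p 0) x)"
    and w: "w \<in> hom B.X0 (Omap (q 0) x) (Omap B.s j)" and j: "j \<in> Obj B.X1" "Omap B.t j = b"
  obtains x' v' where "standard a b x' v' j" "Amap (f 0) v' = Comp C.X0 (Amap (g 0) w) (Amap (f 0) v)"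
    "linked a b (Omap kP0 x, Comp ZB (kB1 j) (Amap kB0 w), Amap kA0 v)
      (triple x' v' j)"
proof -
  have gw: "Amap (g 0) w \<in> hom C.X0 (Omap (f 0) (Omap (p 0) x)) (Omap (g 0) (Omap B.s j))"
    using g0.Amap_in[OF w] level_comm(1)[OF x] by simp
  obtain m where m: "m \<in> hom A.X0 (Omap (p 0) x) (Cod A.X0 m)" "Amap (f 0) m = Amap (g 0) w"
    using vertical_lift[OF p0.Omap_Obj[OF x] gw] by blast
  obtain x' k where k: "k \<in> hom P.X0 x x'" "Amap (p 0) k = m" "Amap (q 0) k = w"
      "Omap (p 0) x' = Cod A.X0 m" "Omap (q 0) x' = Omap B.s j"
    using P0_arrow[OF x m(1) w m(2)] by blast
  have x': "x' \<in> Obj P.X0" "k \<in> Arr P.X0" using P.X0.hom_objs[OF k(1)] homD[OF k(1)] by auto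
  have "standard a b x' (Comp A.X0 m v) j"
    using A.X0.Comp_in[OF v m(1)] k x' j by (simp add: standard_def)
  moreover have "Amap (f 0) (Comp A.X0 m v) = Comp C.X0 (Amap (g 0) w) (Amap (f 0) v)"
    using f0.Amap_Comp[OF v m(1)] m(2) by simp
  moreover have "linked a b (Omap kP0 x, Comp ZB (kB1 j) (Amap kB0 w), Amap kA0 v)
      (Omap kP0 x', kB1 j, Amap kA0 (Comp A.X0 m v))"
    using fact_step[OF P.k0.Amap_in[OF k(1)], of "kB1 j" "Omap kB0 b" "Amap kA0 v" "Omap kA0 a"]
      B.k1_hom[OF j(1)] j A.k0.Amap_in[OF v] x x' k A.k0.Amap_Comp[OF v m(1)] by (simp add: p'_simps q'_simps)
  ultimately show thesis by (rule that)
qed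

text \<open>Both parts are corners, and each has a piece of the wrong kind. The horizontal piece
  \<open>h\<close> of \<open>m\<close> lies under a horizontal arrow \<open>y\<close> of
  \<open>P\<close>, found by lifting \<open>f h\<close> along \<open>g\<close>, and is moved into
  the second part. The second part is then written as a corner again, and its vertical piece is
  pushed back into the first.\<close>

lemma fact_standard:
  assumes a: "a \<in> Obj A.X0" and b: "b \<in> Obj B.X0" and fz: "factors (Omap kA0 a) (Omap kB0 b) (z, u, m)"
  obtains x v j where "standard a b x v j"
    "linked a b (z, u, m) (triple x v j)"
proof -
  obtain x where x: "x \<in> Obj P.X0" "z = Omap kP0 x" using fz P.Z_generated(1) by (auto simp: factorisation_def)
  have u: "u \<in> hom ZB (Omap kB0 (Omap (q 0) x)) (Omap kB0 b)"
    and m: "m \<in> hom ZA (Omap kA0 a) (Omap kA0 (Omap (p 0) x))"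
    using fz x by (simp_all add: factorisation_def p'_simps q'_simps)
  obtain v h where v: "v \<in> hom A.X0 a (Omap A.s h)" "h \<in> Obj A.X1" "Omap A.t h = Omap (p 0) x"
      "m = Comp ZA (kA1 h) (Amap kA0 v)"
    using A.edgeE[OF m a p0.Omap_Obj[OF x(1)]] by blast
  have th: "Omap C.t (Omap (f (Suc 0)) h) = Omap (g 0) (Omap (q 0) x)"
    using f.face_elem(1)[of 0 0 h] v level_comm(1)[OF x(1)] by simp
  obtain k where k: "k \<in> Obj B.X1" "Omap (g (Suc 0)) k = Omap (f (Suc 0)) h" "Omap B.t k = Omap (q 0) x"
    using horizontal_lift[OF f1.Omap_Obj[OF v(2)] q0.Omap_Obj[OF x(1)] th] by blast
  obtain y where y: "y \<in> Obj P.X1" "Omap (p (Suc 0)) y = h" "Omap (q (Suc 0)) y = k"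
    using crossed_pullback_ex(1)[OF pullback v(2) k(1)] k(2) by auto
  have ty: "Omap P.t y = x"
    by (rule crossed_pullback_eq[OF pullback P.S.Omap_Obj[OF y(1)] x(1)])
      (use y v k p.face_elem(1)[of 0 0 y] q.face_elem(1)[of 0 0 y] in auto)
  define x1 where "x1 = Omap P.s y"
  have x1: "x1 \<in> Obj P.X0" "Omap (p 0) x1 = Omap A.s h" "Omap (q 0) x1 = Omap B.s k"
    using y p.face_elem(1)[of "Suc 0" 0 y] q.face_elem(1)[of "Suc 0" 0 y] P.s.Omap_Obj by (auto simp: x1_def)
  have n: "kP1 y \<in> hom ZP (Omap kP0 x1) z" using P.k1_hom[OF y(1)] ty x by (simp add: x1_def)
  have s1: "linked a b (Omap kP0 x1, Comp ZB u (kB1 k), Amap kA0 v) (z, u, m)"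
    using fact_step[OF n, of u "Omap kB0 b" "Amap kA0 v" "Omap kA0 a"] u A.k0.Amap_in[OF v(1)] x x1 y v(4)
    by (simp add: p'_simps q'_simps)
  have "Comp ZB u (kB1 k) \<in> hom ZB (Omap kB0 (Omap (q 0) x1)) (Omap kB0 b)"
    using B.k0.B.Comp_in[OF B.k1_hom[OF k(1)]] u k x1 by simp
  then obtain w j where w: "w \<in> hom B.X0 (Omap (q 0) x1) (Omap B.s j)" "j \<in> Obj B.X1" "Omap B.t j = b"
      "Comp ZB u (kB1 k) = Comp ZB (kB1 j) (Amap kB0 w)"
    using B.edgeE[OF _ q0.Omap_Obj[OF x1(1)] b] by blast
  have v1: "v \<in> hom A.X0 a (Omap (p 0) x1)" using v x1 by simp
  obtain x' v' where "standard a b x' v' j" "linked a b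
      (Omap kP0 x1, Comp ZB (kB1 j) (Amap kB0 w), Amap kA0 v) (triple x' v' j)"
    using standard_push[OF x1(1) v1 w(1-3)] by blast
  then show thesis
    using that[of x' v' j] equivclp_trans[OF equivclp_sym[OF s1]] w(4) by simp
qed

text \<open>Discreteness of \<open>g\<close> makes the horizontal parts equal. There need be no
  arrow between \<open>v\<close> and \<open>v'\<close>, but each factors through an opcartesian
  \<open>m\<close> by an arrow over an identity; paired with an identity of \<open>B\<close> this is
  an arrow of \<open>P\<close>, so both factorisations are linked to the one given by
  \<open>m\<close>.\<close>

lemma standard_same_corner:
  assumes s1: "standard a b x v j" and s2: "standard a b x' v' j'"
    and eq: "Amap (f 0) v = Amap (f 0) v'" "Omap (g (Suc 0)) j = Omap (g (Suc 0)) j'"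
  shows "linked a b (triple x v j) (triple x' v' j')"
proof -
  have a: "a \<in> Obj A.X0" using s1 A.X0.hom_objs by (auto simp: standard_def)
  have jj: "j' = j" using s1 s2 eq(2) horizontal_lift_eq[of j j'] by (simp add: standard_def)
  have fv: "Amap (f 0) v \<in> hom C.X0 (Omap (f 0) a) (Omap (f 0) (Omap (p 0) x))"
    using s1 f0.Amap_in by (simp add: standard_def)
  obtain m where m: "opcartesian A.X0 C.X0 (f 0) m" "m \<in> hom A.X0 a (Cod A.X0 m)" "Amap (f 0) m = Amap (f 0) v"
    using vertical_lift[OF a fv] by blast
  have fm: "Omap (f 0) (Cod A.X0 m) = Omap (f 0) (Omap (p 0) x)"
    using f0.Amap_in[OF m(2)] fv m(3) by (simp add: hom_def)
  have x: "x \<in> Obj P.X0" using s1 by (simp add: standard_def)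
  obtain y where y: "y \<in> Obj P.X0" "Omap (p 0) y = Cod A.X0 m" "Omap (q 0) y = Omap (q 0) x"
    using P0_object[OF A.X0.hom_objs(2)[OF m(2)] q0.Omap_Obj[OF x]] fm level_comm(1)[OF x] by auto
  have "linked a b (triple y m j) (triple x'' v'' j)"
    if st: "standard a b x'' v'' j" and fv'': "Amap (f 0) v'' = Amap (f 0) v" for x'' v''
  proof -
    have *: "x'' \<in> Obj P.X0" "v'' \<in> hom A.X0 a (Omap (p 0) x'')" "j \<in> Obj B.X1" "Omap B.s j = Omap (q 0) x''" "Omap B.t j = b"
      using st by (auto simp: standard_def)
    have qq: "Omap (q 0) x'' = Omap (q 0) y" using * s1 y by (simp add: standard_def)
    let ?c = "Omap (f 0) (Cod A.X0 m)"
    have fx: "?c = Omap (f 0) (Cod A.X0 v'')"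
      using f0.Amap_in[OF *(2)] f0.Amap_in[OF m(2)] m(3) fv'' homD(3)[OF *(2)] by (simp add: hom_def)
    have c: "?c \<in> Obj C.X0" using f0.Omap_Obj[OF A.X0.hom_objs(2)[OF m(2)]] .
    have "\<exists>!n. n \<in> hom A.X0 (Cod A.X0 m) (Cod A.X0 v'') \<and> Amap (f 0) n = Ident C.X0 ?c \<and> Comp A.X0 n m = v''"
    proof -
      have "v'' \<in> Arr A.X0" "Dom A.X0 v'' = Dom A.X0 m" using homD[OF *(2)] homD[OF m(2)] by auto
      moreover have "Ident C.X0 ?c \<in> hom C.X0 ?c (Omap (f 0) (Cod A.X0 v''))" using C.X0.Ident_in[OF c] fx by simp
      moreover have "Comp C.X0 (Ident C.X0 ?c) (Amap (f 0) m) = Amap (f 0) v''"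
        using C.X0.Ident_left[OF f0.Amap_in[OF m(2)]] m(3) fv'' by simp
      ultimately show ?thesis using m(1) unfolding opcartesian_def by blast
    qed
    then obtain n where n: "n \<in> hom A.X0 (Omap (p 0) y) (Omap (p 0) x'')" "Amap (f 0) n = Ident C.X0 ?c"
        "Comp A.X0 n m = v''"
      using y(2) homD(3)[OF *(2)] by auto
    have Iq: "Ident B.X0 (Omap (q 0) y) \<in> hom B.X0 (Omap (q 0) y) (Omap (q 0) x'')"
      using B.X0.Ident_in[OF q0.Omap_Obj[OF y(1)]] qq by simp
    have "Amap (f 0) n = Amap (g 0) (Ident B.X0 (Omap (q 0) y))"
      using n(2) g0.Amap_Ident[OF q0.Omap_Obj[OF y(1)]] level_comm(1)[OF y(1)] y(2) by simp
    then obtain z k where k: "k \<in> hom P.X0 y z" "Amap (p 0) k = n" "Amap (q 0) k = Ident B.X0 (Omap (q 0) y)"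
        "Omap (p 0) z = Omap (p 0) x''" "Omap (q 0) z = Omap (q 0) x''"
      using P0_arrow[OF y(1) n(1) Iq] by blast
    have z: "z = x''" by (rule crossed_pullback_eq[OF pullback P.X0.hom_objs(2)[OF k(1)] *(1) k(4,5)])
    have m': "m \<in> hom A.X0 a (Omap (p 0) y)" using m(2) y(2) by simp
    have kj: "kB1 j \<in> hom ZB (Omap kB0 (Omap (q 0) y)) (Omap kB0 b)" using B.k1_hom[OF *(3)] * qq by simp
    have "Comp ZB (kB1 j) (Amap q' (Amap kP0 k)) = kB1 j"
      using B.k0.B.Ident_right[OF kj] homD(1)[OF k(1)] k(3) q0.Omap_Obj[OF y(1)] by (simp add: q'_simps B.k0.Amap_Ident)
    moreover have "Comp ZA (Amap p' (Amap kP0 k)) (Amap kA0 m) = Amap kA0 v''"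
      using A.k0.Amap_Comp[OF m' n(1)] n(3) homD(1)[OF k(1)] k(2) by (simp add: p'_simps)
    ultimately show ?thesis
      using fact_step[OF P.k0.Amap_in[OF k(1)], of "kB1 j" "Omap kB0 b" "Amap kA0 m" "Omap kA0 a"]
        kj A.k0.Amap_in[OF m'] qq y(1) *(1) by (simp add: z p'_simps q'_simps)
  qed
  note c = this
  show ?thesis
    unfolding jj by (rule equivclp_trans[OF equivclp_sym[OF c[OF s1 refl]] c[OF s2[unfolded jj] eq(1)[symmetric]]])
qed

text \<open>Lifting the square along \<open>g\<close> over the identity of \<open>b\<close> gives
  \<open>\<beta>\<close> with domain \<open>j\<close>. Naturality of \<open>kB1\<close> at
  \<open>\<beta>\<close> turns \<open>j\<close> into the vertical arrow \<open>d_1 \<beta>\<close>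
  followed by \<open>j'\<close>, and that vertical arrow is pushed into the first part.\<close>

lemma standard_corner_step:
  assumes st: "standard a b x v j" and cs: "C.corner_step (Amap (f 0) v, Omap (g (Suc 0)) j) (v0, h0)"
  obtains x' v' j' where "standard a b x' v' j'" "Amap (f 0) v' = v0" "Omap (g (Suc 0)) j' = h0"
    "linked a b (triple x v j) (triple x' v' j')"
proof -
  have *: "x \<in> Obj P.X0" "v \<in> hom A.X0 a (Omap (p 0) x)" "j \<in> Obj B.X1" "Omap B.s j = Omap (q 0) x" "Omap B.t j = b"
    using st by (auto simp: standard_def)
  have b: "b \<in> Obj B.X0" using B.S.Omap_Obj[OF *(3)] *(5) by simp
  obtain \<alpha> where al: "\<alpha> \<in> hom C.X1 (Omap (g (Suc 0)) j) h0" "Amap C.t \<alpha> = Ident C.X0 (Omap (g 0) b)"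
      "v0 = Comp C.X0 (Amap C.s \<alpha>) (Amap (f 0) v)"
    using C.corner_step_hom[OF cs standard_fact(3)[OF st]] by blast
  obtain \<beta> where be: "\<beta> \<in> Arr B.X1" "Amap (g (Suc 0)) \<beta> = \<alpha>" "Amap B.t \<beta> = Ident B.X0 b"
    using Cat_pullback_ex(2)[OF fibration_pullback homD(1)[OF al(1)] homD(1)[OF B.X0.Ident_in[OF b]]]
      al(2) g0.Amap_Ident[OF b] by auto
  define j' where "j' = Cod B.X1 \<beta>"
  have "Dom B.X1 \<beta> = j"
    by (rule horizontal_lift_eq[OF B.X1.Dom_in[OF be(1)] *(3)])
      (use be al g1.Dom_Amap[OF be(1)] B.S.Dom_Amap[OF be(1)] homD[OF B.X0.Ident_in[OF b]] *(5) in \<open>auto simp: hom_def\<close>)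
  then have \<beta>: "\<beta> \<in> hom B.X1 j j'" using be by (simp add: hom_def j'_def)
  have j': "j' \<in> Obj B.X1" "Omap (g (Suc 0)) j' = h0" "Omap B.t j' = b"
    using B.X1.hom_objs[OF \<beta>] g1.Amap_in[OF \<beta>] B.S.Amap_in[OF \<beta>] be al homD[OF B.X0.Ident_in[OF b]] by (auto simp: hom_def)
  have w: "Amap B.s \<beta> \<in> hom B.X0 (Omap (q 0) x) (Omap B.s j')" using B.s.Amap_in[OF \<beta>] * by simp
  have kj: "kB1 j \<in> hom ZB (Omap kB0 (Omap (q 0) x)) (Omap kB0 b)" using B.k1_hom[OF *(3)] * by simp
  have n: "Comp ZB (kB1 j') (Amap kB0 (Amap B.s \<beta>)) = kB1 j"
    using B.k1_natural[OF \<beta>] be(3) B.k0.B.Ident_left[OF kj] b by (simp add: B.k0.Amap_Ident)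
  obtain x' v' where x': "standard a b x' v' j'" "Amap (f 0) v' = Comp C.X0 (Amap (g 0) (Amap B.s \<beta>)) (Amap (f 0) v)"
      "linked a b (Omap kP0 x, Comp ZB (kB1 j') (Amap kB0 (Amap B.s \<beta>)), Amap kA0 v)
      (triple x' v' j')"
    using standard_push[OF *(1,2) w j'(1,3)] by blast
  show thesis
    by (rule that[OF x'(1) _ j'(2)])
      (use x' al be n g.face_elem(2)[of "Suc 0" 0 \<beta>] in auto)
qed

lemma standard_equiv_corners:
  assumes a: "a \<in> Obj A.X0" and b: "b \<in> Obj B.X0"
    and st: "standard a b x v j" and st': "standard a b x' v' j'"
    and eq: "equivclp C.corner_step (Amap (f 0) v, Omap (g (Suc 0)) j) (Amap (f 0) v', Omap (g (Suc 0)) j')"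
  shows "linked a b (triple x v j) (triple x' v' j')"
proof -
  \<comment> \<open>The claim covers every standard factorisation over \<open>c\<close>, since the
    one reached by earlier steps need not be the one to which the next step applies. Any two over
    the same corner are linked.\<close>
  have "\<forall>y w k. standard a b y w k \<and> (Amap (f 0) w, Omap (g (Suc 0)) k) = c \<longrightarrow>
      linked a b (triple x v j) (triple y w k)"
    if "equivclp C.corner_step (Amap (f 0) v, Omap (g (Suc 0)) j) c" for c
    using that
  proof (induction rule: equivclp_induct)
    case base
    then show ?case using standard_same_corner[OF st] by auto
  next
    case (step c c')
    show ?case
    proof (intro allI impI)
      fix y w k assume c': "standard a b y w k \<and> (Amap (f 0) w, Omap (g (Suc 0)) k) = c'"
      from step(2) show "linked a b (triple x v j) (triple y w k)"
      proof
        assume cs: "C.corner_step c c'"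
        have "c \<in> hom C.corner_cat (Omap (f 0) a) (Omap (g 0) b)"
          using C.equiv_corners_parallel[OF step(1)] standard_fact(3)[OF st] by blast
        \<comment> \<open>A forward step has to start at some factorisation over \<open>c\<close>;
          \<open>standard_ex\<close> provides one, and the induction hypothesis links it to the
          initial factorisation.\<close>
        then obtain y' w' k' where s1: "standard a b y' w' k'" "(Amap (f 0) w', Omap (g (Suc 0)) k') = c"
          using standard_ex[OF a b] by (metis surj_pair)
        then obtain y'' w'' k'' where s2: "standard a b y'' w'' k''" "(Amap (f 0) w'', Omap (g (Suc 0)) k'') = c'"
          "linked a b (triple y' w' k') (triple y'' w'' k'')"
          using standard_corner_step[OF s1(1)] cs by (metis surj_pair)
        have "linked a b (triple x v j) (triple y' w' k')"
          using step.IH s1 by blast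
        also note s2(3)
        also have "linked a b (triple y'' w'' k'') (triple y w k)"
          by (rule standard_same_corner) (use s2 c' in auto)
        finally show ?thesis .
      next
        \<comment> \<open>Here the step is lifted from the given factorisation over
          \<open>c'\<close>, ending over \<open>c\<close>, and is then traversed in reverse.\<close>
        assume cs: "C.corner_step c' c"
        then obtain y'' w'' k'' where s2: "standard a b y'' w'' k''" "(Amap (f 0) w'', Omap (g (Suc 0)) k'') = c"
          "linked a b (triple y w k) (triple y'' w'' k'')"
          using standard_corner_step[of a b y w k] c' by (metis surj_pair)
        have "linked a b (triple x v j) (triple y'' w'' k'')"
          using step.IH s2 by blast
        also note equivclp_sym[OF s2(3)]
        finally show ?thesis .
      qed
    qed
  qed
  from this[OF eq] st' show ?thesis by blast
qed

lemma exact: "exact_square TYPE(('q, 'd) category) ZP ZA ZB ZC p' q' f' g' (id_trans ZP ZC (func_comp ZP f' p'))"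
proof (rule exact_squareI[OF p'.is_functor_axioms q'.is_functor_axioms f'.is_functor_axioms g'.is_functor_axioms square_comm])
  fix z z' w assume z: "z \<in> Obj ZA" "z' \<in> Obj ZB" and w: "w \<in> hom ZC (Omap f' z) (Omap g' z')"
  obtain a where a: "a \<in> Obj A.X0" "z = Omap kA0 a" using z(1) A.Z_generated(1) by blast
  obtain b where b: "b \<in> Obj B.X0" "z' = Omap kB0 b" using z(2) B.Z_generated(1) by blast
  have "w \<in> hom ZC (Omap kC0 (Omap (f 0) a)) (Omap kC0 (Omap (g 0) b))"
    using w a b by (simp add: f'_simps g'_simps)
  then obtain v h where v: "v \<in> hom C.X0 (Omap (f 0) a) (Omap C.s h)" "h \<in> Obj C.X1" "Omap C.t h = Omap (g 0) b"
      "w = Comp ZC (kC1 h) (Amap kC0 v)"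
    using C.edgeE[OF _ f0.Omap_Obj[OF a(1)] g0.Omap_Obj[OF b(1)]] by blast
  then have "(v, h) \<in> hom C.corner_cat (Omap (f 0) a) (Omap (g 0) b)" by (simp add: C.corner_simps)
  then obtain x v' j where s: "standard a b x v' j" "Amap (f 0) v' = v" "Omap (g (Suc 0)) j = h"
    using standard_ex[OF a(1) b(1)] by blast
  show "\<exists>x u m. factors z z' (x, u, m) \<and> Comp ZC (Amap g' u) (Amap f' m) = w"
    using standard_fact[OF s(1)] s v(4) unfolding a(2) b(2) C.edge_def by auto
next
  fix z z' x u m x' u' m'
  assume z: "z \<in> Obj ZA" "z' \<in> Obj ZB" and fx: "factors z z' (x, u, m)" and fx': "factors z z' (x', u', m')"
    and eq: "Comp ZC (Amap g' u) (Amap f' m) = Comp ZC (Amap g' u') (Amap f' m')"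
  obtain a where a: "a \<in> Obj A.X0" "z = Omap kA0 a" using z(1) A.Z_generated(1) by blast
  obtain b where b: "b \<in> Obj B.X0" "z' = Omap kB0 b" using z(2) B.Z_generated(1) by blast
  obtain y v j where s: "standard a b y v j" "connected_by z z' (x, u, m) (triple y v j)"
    using fact_standard[OF a(1) b(1)] fx unfolding a(2) b(2) by blast
  obtain y' v' j' where s': "standard a b y' v' j'" "connected_by z z' (x', u', m') (triple y' v' j')"
    using fact_standard[OF a(1) b(1)] fx' unfolding a(2) b(2) by blast
  have "C.edge (Amap (f 0) v, Omap (g (Suc 0)) j) = C.edge (Amap (f 0) v', Omap (g (Suc 0)) j')"
    using connected_composite[OF s(2)] connected_composite[OF s'(2)] eq
    by (simp add: standard_fact(2)[OF s(1)] standard_fact(2)[OF s'(1)])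
  then have "equivclp C.corner_step (Amap (f 0) v, Omap (g (Suc 0)) j) (Amap (f 0) v', Omap (g (Suc 0)) j')"
    using C.edge_eqD standard_fact(3)[OF s(1)] standard_fact(3)[OF s'(1)] by (auto simp: hom_def)
  then have "connected_by z z' (triple y v j) (triple y' v' j')"
    unfolding a(2) b(2) by (rule standard_equiv_corners[OF a(1) b(1) s(1) s'(1)])
  then show "connected_by z z' (x, u, m) (x', u', m')"
    using s(2) s'(2) by (blast intro: equivclp_sym equivclp_trans)
qed

end

theorem theorem5p1p4:
  fixes P A B C :: "('u::infinite, 'u) crossed_double_cat"
    and p q f g :: "('u, 'u) simplicial_map"
    and ZP ZA ZB ZC :: "('u, 'u) category"
    and p' q' f' g' :: "('u, 'u, 'u, 'u) func"
  assumes "crossed_pullback P A B C p q f g"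
    and "discrete_fibration B C g"
    and "objectwise_opfibration A C f"
    and "codescent_object P ZP kP0 kP1"
    and "codescent_object A ZA kA0 kA1"
    and "codescent_object B ZB kB0 kB1"
    and "codescent_object C ZC kC0 kC1"
    and "codescent_map P p ZP kP0 kP1 ZA kA0 kA1 p'"
    and "codescent_map P q ZP kP0 kP1 ZB kB0 kB1 q'"
    and "codescent_map A f ZA kA0 kA1 ZC kC0 kC1 f'"
    and "codescent_map B g ZB kB0 kB1 ZC kC0 kC1 g'"
  shows "exact_square TYPE(('q, 'd) category) ZP ZA ZB ZC p' q' f' g'
    (id_trans ZP ZC (func_comp ZP f' p'))"
proof -
  have X: "universal_crossed_double_category P" "universal_crossed_double_category A"
    "universal_crossed_double_category B" "universal_crossed_double_category C"
    using assms(1) by (auto simp: is_pullback_def intro: universal_crossedI)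
  interpret crossed_square P ZP kP0 kP1 A ZA kA0 kA1 B ZB kB0 kB1 C ZC kC0 kC1 p q f g p' q' f' g'
    by (intro crossed_square.intro crossed_square_axioms.intro universal_codescent.intro
      universal_codescent_axioms.intro X assms)
  show ?thesis by (rule exact)
qed

end
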